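(* Fix integers $n>d\ge 2$ and $1\le r\le P(d)$. Let $M$ be a maximal $r$-generated submodule of $R_d$. Then $\dim_k M\le \dim_k R_d-(P(d)-r)$, with equality if and only if $$n\ \ge\ 1+\frac{\sum_{i=0}^{d-1}P(i)}{r}.$$ Consequently, a general $(r,d)$-symmetric ideal $I$ satisfies $\dim_k I_d=\dim_k R_d-(P(d)-r)$ if and only if $n\ge 1+\frac{1}{r}\sum_{i=0}^{d-1}P(i)$.
   Context: $k$ is an infinite field with $\operatorname{char}(k)=0$ or $\operatorname{char}(k)>n$; $R=k[x_1,\dots,x_n]$ with the standard grading, and $R_d$, $I_d$ denote degree-$d$ components. $P(i)$ is the number of integer partitions of $i$ (with $P(0)=1$). The symmetric group $\mathfrak{S}_n$ acts on $R$ by permuting variables: $\sigma\cdot f(x_1,\dots,x_n)=f(x_{\sigma(1)},\dots,x_{\sigma(n)})$. A $k\mathfrak{S}_n$-module is $r$-generated if it can be generated by $r$ elements as a $k\mathfrak{S}_n$-module. A maximal $r$-generated submodule of $R_d$ is an $r$-generated $k\mathfrak{S}_n$-submodule of $R_d$ not contained in any other $r$-generated $k\mathfrak{S}_n$-submodule of $R_d$. Let $\operatorname{Gr}_k(r,R_d)$ be the Grassmannian of $r$-dimensional linear subspaces of $R_d$ (with its Zariski topology). For $L\in\operatorname{Gr}_k(r,R_d)$ let $(L)_{\mathfrak{S}_n}$ be the ideal of $R$ generated by all $\sigma\cdot f$ with $\sigma\in\mathfrak{S}_n$, $f\in L$. A property holds for a general $(r,d)$-symmetric ideal if there is a nonempty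 Zariski open set $U\subseteq\operatorname{Gr}_k(r,R_d)$ such that for all $L\in U$ the property holds for $I=(L)_{\mathfrak{S}_n}$. *)

theory Defs
  imports
    "HOL-Library.Poly_Mapping"
    "HOL-Library.Cardinality"
    "HOL-Library.Multiset"
    "Jordan_Normal_Form.Determinant"
begin

text \<open>Multivariate polynomials over \<open>'k\<close> in the variables \<open>'v\<close> are the finitely supported
  functions from exponent vectors to coefficients, with the convolution product of
  \<^theory>\<open>HOL-Library.Poly_Mapping\<close>. The ring \<open>k[x\<^sub>1,\<dots>,x\<^sub>n]\<close> is the case of a finite
  type \<open>'v\<close> of cardinality \<open>n\<close>.\<close>

type_synonym ('v, 'k) mpoly = "('v \<Rightarrow>\<^sub>0 nat) \<Rightarrow>\<^sub>0 'k"

definition mvar :: "'v \<Rightarrow> ('v, 'k::comm_ring_1) mpoly" where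
  "mvar v = Poly_Mapping.single (Poly_Mapping.single v 1) 1"

definition mconst :: "'k \<Rightarrow> ('v, 'k::comm_ring_1) mpoly" where
  "mconst c = Poly_Mapping.single 0 c"

definition mscale :: "'k \<Rightarrow> ('v, 'k) mpoly \<Rightarrow> ('v, 'k::comm_ring_1) mpoly" where
  "mscale c p = mconst c * p"

definition mdeg :: "('v \<Rightarrow>\<^sub>0 nat) \<Rightarrow> nat" where
  "mdeg m = (\<Sum>v\<in>Poly_Mapping.keys m. Poly_Mapping.lookup m v)"

definition homog :: "nat \<Rightarrow> ('v, 'k::comm_ring_1) mpoly set" where
  "homog d = {p. \<forall>m\<in>Poly_Mapping.keys p. mdeg m = d}"

text \<open>Substitution of \<open>x v\<close> for the variable \<open>v\<close>, the coefficients being carried along \<open>h\<close>.\<close>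

definition msubst :: "('k \<Rightarrow> 'r) \<Rightarrow> ('v \<Rightarrow> 'r) \<Rightarrow> ('v, 'k::comm_ring_1) mpoly \<Rightarrow> 'r::comm_ring_1" where
  "msubst h x p = (\<Sum>m\<in>Poly_Mapping.keys p. h (Poly_Mapping.lookup p m) *
     (\<Prod>v\<in>Poly_Mapping.keys m. x v ^ Poly_Mapping.lookup m v))"

lemma vector_space_mscale:
  "vector_space (mscale :: 'k::field \<Rightarrow> ('v, 'k) mpoly \<Rightarrow> ('v, 'k) mpoly)"
proof
  fix a b :: 'k and p q :: "('v, 'k) mpoly"
  show "mscale a (p + q) = mscale a p + mscale a q"
    by (simp add: mscale_def distrib_left)
  show "mscale (a + b) p = mscale a p + mscale b p"
    by (simp add: mscale_def mconst_def single_add distrib_right)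
  show "mscale a (mscale b p) = mscale (a * b) p"
    by (simp add: mscale_def mconst_def mult_single flip: mult.assoc)
  show "mscale 1 p = p"
    by (simp add: mscale_def mconst_def)
qed

interpretation mp: vector_space "mscale :: 'k::field \<Rightarrow> ('v, 'k) mpoly \<Rightarrow> ('v, 'k) mpoly"
  by (rule vector_space_mscale)


definition num_partitions :: "nat \<Rightarrow> nat" where
  "num_partitions i = card {P :: nat multiset. 0 \<notin># P \<and> sum_mset P = i}"


text \<open>The action \<open>f(x\<^sub>1,\<dots>,x\<^sub>n) \<mapsto> f(x\<^bsub>\<sigma>(1)\<^esub>,\<dots>,x\<^bsub>\<sigma>(n)\<^esub>)\<close> of the symmetric group; \<open>\<sigma>\<close> ranges over
  the bijections of the index type.\<close>

definition sym_act :: "('v \<Rightarrow> 'v) \<Rightarrow> ('v, 'k) mpoly \<Rightarrow> ('v, 'k::comm_ring_1) mpoly" where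
  "sym_act \<sigma> f = msubst mconst (\<lambda>v. mvar (\<sigma> v)) f"

definition sym_submodule :: "('v, 'k::field) mpoly set \<Rightarrow> bool" where
  "sym_submodule M \<longleftrightarrow> mp.subspace M \<and> (\<forall>\<sigma>. bij \<sigma> \<longrightarrow> (\<forall>f\<in>M. sym_act \<sigma> f \<in> M))"

definition r_generated :: "nat \<Rightarrow> ('v, 'k::field) mpoly set \<Rightarrow> bool" where
  "r_generated r M \<longleftrightarrow> (\<exists>f :: nat \<Rightarrow> ('v, 'k) mpoly. M = sym_submodule hull (f ` {..<r}))"

definition r_gen_submodule ::
    "nat \<Rightarrow> ('v, 'k::field) mpoly set \<Rightarrow> ('v, 'k) mpoly set \<Rightarrow> bool" where
  "r_gen_submodule r V M \<longleftrightarrow> sym_submodule M \<and> M \<subseteq> V \<and> r_generated r M"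

definition max_r_gen_submodule ::
    "nat \<Rightarrow> ('v, 'k::field) mpoly set \<Rightarrow> ('v, 'k) mpoly set \<Rightarrow> bool" where
  "max_r_gen_submodule r V M \<longleftrightarrow>
     r_gen_submodule r V M \<and> (\<forall>N. r_gen_submodule r V N \<and> M \<subseteq> N \<longrightarrow> N = M)"


definition ideal_gen :: "('v, 'k::comm_ring_1) mpoly set \<Rightarrow> ('v, 'k) mpoly set" where
  "ideal_gen A = module.span (*) A"

definition sym_ideal :: "('v, 'k::comm_ring_1) mpoly set \<Rightarrow> ('v, 'k) mpoly set" where
  "sym_ideal L = ideal_gen {sym_act \<sigma> f |\<sigma> f. bij \<sigma> \<and> f \<in> L}"


definition grassmannian ::
    "nat \<Rightarrow> ('v, 'k::field) mpoly set \<Rightarrow> ('v, 'k) mpoly set set" where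
  "grassmannian r V = {L. mp.subspace L \<and> L \<subseteq> V \<and> mp.dim L = r}"

definition ordered_basis ::
    "nat \<Rightarrow> (nat \<Rightarrow> ('v, 'k::field) mpoly) \<Rightarrow> ('v, 'k) mpoly set \<Rightarrow> bool" where
  "ordered_basis r f L \<longleftrightarrow>
     inj_on f {..<r} \<and> mp.independent (f ` {..<r}) \<and> mp.span (f ` {..<r}) = L"

text \<open>The Pluecker coordinates of the span of \<open>f 0, \<dots>, f (r - 1)\<close>: one maximal minor of the
  coefficient matrix for each sequence \<open>s\<close> of monomials, of which only the first \<open>r\<close> entries
  matter. Sequences containing a repetition or a monomial outside the ambient space give the
  coordinate \<open>0\<close>, and reordering a sequence changes the coordinate only by a sign.\<close>

definition pluecker ::
    "nat \<Rightarrow> (nat \<Rightarrow> ('v, 'k::field) mpoly) \<Rightarrow> (nat \<Rightarrow> ('v \<Rightarrow>\<^sub>0 nat)) \<Rightarrow> 'k" where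
  "pluecker r f s = det (mat r r (\<lambda>(i, j). Poly_Mapping.lookup (f i) (s j)))"

text \<open>Zariski closed sets are the common zero loci of sets of homogeneous polynomials in the
  Pluecker coordinates. By homogeneity the vanishing does not depend on the ordered basis.\<close>

definition zariski_closed ::
    "nat \<Rightarrow> ('v, 'k::field) mpoly set \<Rightarrow> ('v, 'k) mpoly set set \<Rightarrow> bool" where
  "zariski_closed r V Z \<longleftrightarrow>
     (\<exists>S :: (nat \<Rightarrow> ('v \<Rightarrow>\<^sub>0 nat), 'k) mpoly set.
        (\<forall>F\<in>S. \<exists>e. F \<in> homog e) \<and>
        Z = {L \<in> grassmannian r V.
               \<forall>f. ordered_basis r f L \<longrightarrow> (\<forall>F\<in>S. msubst id (pluecker r f) F = 0)})"

definition zariski_open ::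
    "nat \<Rightarrow> ('v, 'k::field) mpoly set \<Rightarrow> ('v, 'k) mpoly set set \<Rightarrow> bool" where
  "zariski_open r V U \<longleftrightarrow> U \<subseteq> grassmannian r V \<and> zariski_closed r V (grassmannian r V - U)"

definition general_sym_ideal ::
    "nat \<Rightarrow> nat \<Rightarrow> (('v::finite, 'k::field) mpoly set \<Rightarrow> bool) \<Rightarrow> bool" where
  "general_sym_ideal r d Q \<longleftrightarrow>
     (\<exists>U. zariski_open r (homog d) U \<and> U \<noteq> {} \<and> (\<forall>L\<in>U. Q (sym_ideal L)))"

end

theory Submission
  imports Defs "HOL-Library.Function_Algebras" "HOL-Combinatorics.Permutations"
begin

text \<open>Write \<open>n\<close> for the number of variables, \<open>V\<close> for the forms of degree \<open>d\<close> and \<open>Q\<close> for the sum of the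
  \<open>P(i)\<close> with \<open>i < d\<close>. The hypothesis on the characteristic makes \<open>n!\<close> invertible, so representations of
  the symmetric group are completely reducible. The module \<open>V\<close> is the sum of one permutation module for
  each partition of \<open>d\<close>, spanned by the monomials with these exponents. It contains the trivial
  representation \<open>P(d)\<close> times, and the standard representation, of dimension \<open>n - 1\<close>, once for every
  pair of a partition of \<open>d\<close> and one of its distinct parts. Removing that part shows that there are
  \<open>Q\<close> such pairs (\<open>sum_distinct_parts\<close>).

  A module with \<open>r\<close> generators contains an irreducible \<open>W\<close> at most \<open>r\<close> times the number of times that the
  group algebra does. For the trivial representation this costs at least \<open>P(d) - r\<close> dimensions
  (\<open>dim_gen_le\<close>); if \<open>Q > r (n - 1)\<close>, some copy of the standard representation is missed as well
  (\<open>reduced_not_generated\<close>). So the equality forces \<open>Q \<le> r (n - 1)\<close>, which is the stated bound on \<open>n\<close>.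

  For the converse one has to see that no other representation is an obstruction. By Frobenius
  reciprocity, the homomorphisms from \<open>V\<close> to a submodule \<open>K\<close> are given by choosing for each partition
  of \<open>d\<close> a vector of \<open>K\<close> invariant under the Young subgroup that fixes a monomial \<open>m\<close> of this type. The
  claim is that their total dimension is at most \<open>r\<close> times that of \<open>K\<close>, if \<open>K\<close> has no invariants
  (\<open>multiplicity_bound\<close>). On copies of the standard representation, the number of invariants is known.
  If \<open>K\<close> contains none of these, then a Young subgroup with \<open>l\<close> orbits should fix at most a fraction
  \<open>(l - 1)/(n - 1)\<close> of \<open>K\<close>. This is proved by comparing the fixed spaces of different Young subgroups
  through \<open>dim A + dim B \<le> dim (A + B) + dim (A \<inter> B)\<close>, as in Shearer's inequality for entropies
  (\<open>cyclic_bound\<close>), and by showing that the fixed space grows when an orbit loses a point to a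
  smaller one (\<open>balancing\<close>). The argument needs two orbits of different sizes (\<open>strong_bound\<close>), and the
  fraction is indeed exceeded for four points in two orbits of size two. As \<open>d < n\<close>, different sizes
  occur for all monomials except possibly \<open>x\<^sub>1 \<dots> x\<^sub>d\<close>, whose contribution is balanced by that of
  \<open>x\<^sub>1\<^sup>d\<close>.

  Given this bound, \<open>r\<close> elements that, together with the invariants, generate as much as possible,
  generate everything: otherwise all perturbations by elements of a complement \<open>K\<close> would be explained by
  homomorphisms to \<open>K\<close>, of which there are too few (\<open>generators_modulo_invariants\<close>). Their
  symmetrizations can be prescribed freely, so that every \<open>r\<close>-generated submodule lies in one of the
  largest possible dimension (\<open>extend_to_large\<close>). Finally, that the submodule generated by \<open>L\<close> has this
  dimension is guaranteed by a nonvanishing minor, and Cramer's rule rewrites this minor as a form in the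
  Pluecker coordinates of \<open>L\<close> (\<open>large_general\<close>).\<close>

section \<open>Finite-dimensional subspaces\<close>

locale lin_space = vector_space
begin

definition fin_dim :: "'b set \<Rightarrow> bool" where
  "fin_dim S \<longleftrightarrow> (\<exists>B. finite B \<and> S \<subseteq> span B)"

lemma fin_dim_mono: "S \<subseteq> T \<Longrightarrow> fin_dim T \<Longrightarrow> fin_dim S"
  unfolding fin_dim_def by blast

lemma fin_dim_span: "finite B \<Longrightarrow> fin_dim (span B)"
  unfolding fin_dim_def by blast

lemma fin_dim_basis:
  assumes "fin_dim S"
  obtains B where "B \<subseteq> S" "independent B" "S \<subseteq> span B" "card B = dim S" "finite B"
proof -
  obtain B where B: "B \<subseteq> S" "independent B" "S \<subseteq> span B" "card B = dim S"
    by (rule basis_exists)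
  obtain T where "finite T" "S \<subseteq> span T" using assms unfolding fin_dim_def by blast
  then have "finite B" using B independent_span_bound[of T B] by blast
  then show ?thesis using that B by blast
qed

lemma independent_fin_dim:
  assumes "fin_dim S" "B \<subseteq> S" "independent B"
  shows "finite B" "card B \<le> dim S"
proof -
  obtain C where C: "C \<subseteq> S" "independent C" "S \<subseteq> span C" "card C = dim S" "finite C"
    using assms(1) by (rule fin_dim_basis)
  then show "finite B" "card B \<le> dim S"
    using independent_span_bound[of C B] assms by auto
qed

lemma dim_mono_fin_dim:
  assumes "S \<subseteq> T" "fin_dim T"
  shows "dim S \<le> dim T"
proof -
  obtain C where C: "C \<subseteq> T" "independent C" "T \<subseteq> span C" "card C = dim T" "finite C"
    using assms(2) by (rule fin_dim_basis)
  then show ?thesis using dim_le_card[of S C] assms by auto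
qed

lemma subspace_dim_eq_fin_dim:
  assumes "subspace S" "S \<subseteq> T" "fin_dim T" "dim T \<le> dim S"
  shows "S = T"
proof -
  obtain B where B: "B \<subseteq> S" "independent B" "S \<subseteq> span B" "card B = dim S" "finite B"
    using fin_dim_basis[OF fin_dim_mono[OF assms(2,3)]] .
  have "x \<in> S" if "x \<in> T" for x
  proof (rule ccontr)
    assume x: "x \<notin> S"
    have sp: "span B \<subseteq> S" using B(1) assms(1) by (rule span_minimal)
    have "x \<notin> span B" "x \<notin> B" using x sp B(1) by auto
    then have "independent (insert x B)" using B(2) by (intro independent_insertI)
    then show False
      using independent_fin_dim(2)[OF assms(3), of "insert x B"] \<open>x \<notin> B\<close> that B assms(2,4) by auto
  qed
  then show ?thesis using assms(2) by blast
qed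

lemma dim_zero_space: "dim {0} = 0"
  by (rule dim_unique[of "{}"]) (simp_all add: independent_empty)

lemma dim_eq_0_fin_dim:
  assumes "fin_dim S" "dim S = 0"
  shows "S \<subseteq> {0}"
proof -
  obtain B where "S \<subseteq> span B" "card B = dim S" "finite B"
    using assms(1) by (metis fin_dim_basis)
  then show ?thesis using assms by simp
qed

lemma linear_intro:
  assumes "\<And>x y. f (x + y) = f x + f y" "\<And>c x. f (scale c x) = scale c (f x)"
  shows "Vector_Spaces.linear scale scale f"
  using assms vector_space_axioms by (simp add: Vector_Spaces.linear_iff)

lemma span_basis_Int:
  assumes "independent B" "x \<in> span (B \<inter> C)" "x \<in> span (B - C)"
  shows "x = 0"
proof -
  interpret p: vector_space_pair scale scale by unfold_locales
  obtain g where g: "Vector_Spaces.linear scale scale g" "\<forall>b\<in>B. g b = (if b \<in> C then b else 0)"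
    using p.linear_independent_extend[OF assms(1), of "\<lambda>b. if b \<in> C then b else 0"] by blast
  have "g x = x"
    using p.linear_eq_on[OF g(1) linear_intro[of "\<lambda>x. x"] assms(2)] g(2) by auto
  moreover have "g x = 0"
    using p.linear_eq_on[OF g(1) linear_intro[of "\<lambda>x. 0"] assms(3)] g(2) by auto
  ultimately show ?thesis by simp
qed

end

text \<open>The whole space may be infinite-dimensional; it suffices that the kernel and the image on
  the subspace considered are not.\<close>

lemma rank_nullity:
  assumes "lin_space s1" "lin_space s2"
  assumes lin: "Vector_Spaces.linear s1 s2 f" and S: "module.subspace s1 S"
    and ker: "lin_space.fin_dim s1 {x \<in> S. f x = 0}" and im: "lin_space.fin_dim s2 (f ` S)"
  shows "lin_space.fin_dim s1 S \<and> vector_space.dim s1 S =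
    vector_space.dim s1 {x \<in> S. f x = 0} + vector_space.dim s2 (f ` S)"
proof -
  interpret vs1: lin_space s1 by fact
  interpret vs2: lin_space s2 by fact
  interpret vector_space_pair s1 s2 by unfold_locales
  let ?K = "{x \<in> S. f x = 0}"
  obtain B0 where B0: "B0 \<subseteq> ?K" "vs1.independent B0" "?K \<subseteq> vs1.span B0"
      "card B0 = vs1.dim ?K" "finite B0"
    using ker by (rule vs1.fin_dim_basis)
  obtain B where B: "B0 \<subseteq> B" "B \<subseteq> S" "vs1.independent B" "S \<subseteq> vs1.span B"
    using vs1.maximal_independent_subset_extend[OF _ B0(2), of S] B0(1) by blast
  have sub: "vs1.span (B - B0) \<subseteq> S" using B(2) S by (intro vs1.span_minimal) auto
  have inj: "inj_on f (vs1.span (B - B0))"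
  proof (subst linear_inj_on_iff_eq_0[OF lin])
    show "\<forall>x\<in>vs1.span (B - B0). f x = 0 \<longrightarrow> x = 0"
    proof (intro ballI impI)
      fix x assume x: "x \<in> vs1.span (B - B0)" "f x = 0"
      then have "x \<in> vs1.span (B \<inter> B0)" using sub B0(3) B(1) by (auto simp: Int_absorb1)
      then show "x = 0" using vs1.span_basis_Int[OF B(3)] x(1) by blast
    qed
  qed simp
  have ind: "vs2.independent (f ` (B - B0))"
    using linear_independent_injective_image[OF lin vs1.independent_mono[OF B(3)] inj] by blast
  have inj': "inj_on f (B - B0)"
    using inj vs1.span_superset by (blast intro: inj_on_subset)
  have "f ` (B - B0) \<subseteq> f ` S" using B(2) by blast
  from vs2.independent_fin_dim(1)[OF im this ind] have fin: "finite (B - B0)"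
    using inj' finite_imageD by blast
  have "f ` S \<subseteq> vs2.span (f ` B)"
    using B(4) linear_span_image[OF lin] by blast
  also have "f ` B \<subseteq> insert 0 (f ` (B - B0))" using B0(1) by blast
  then have "vs2.span (f ` B) \<subseteq> vs2.span (f ` (B - B0))"
    using vs2.span_mono vs2.span_insert_0 by metis
  finally have "vs2.dim (f ` S) = card (f ` (B - B0))"
    using \<open>f ` (B - B0) \<subseteq> f ` S\<close> ind by (intro vs2.dim_unique) auto
  also have "\<dots> = card (B - B0)" using inj' by (rule card_image)
  finally have im_dim: "vs2.dim (f ` S) = card (B - B0)" .
  have finB: "finite B" using fin B0(5) finite_Diff2 by blast
  have "vs1.dim S = card B" using B by (intro vs1.dim_unique) auto
  also have "\<dots> = card B0 + card (B - B0)"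
    using card_Diff_subset[OF B0(5) B(1)] card_mono[OF finB B(1)] by simp
  finally show ?thesis using im_dim B0(4) B(4) finB unfolding vs1.fin_dim_def by auto
qed

context lin_space
begin

lemma subspace_quotient_map:
  assumes "subspace T"
  shows "\<exists>f. Vector_Spaces.linear scale scale f \<and> (\<forall>x. f x = 0 \<longleftrightarrow> x \<in> T)"
proof -
  interpret p: vector_space_pair scale scale by unfold_locales
  obtain B0 where B0: "B0 \<subseteq> T" "independent B0" "T \<subseteq> span B0" "card B0 = dim T"
    by (rule basis_exists)
  obtain B where B: "B0 \<subseteq> B" "independent B" "UNIV \<subseteq> span B"
    by (rule maximal_independent_subset_extend[OF subset_UNIV B0(2)])
  obtain g where g: "Vector_Spaces.linear scale scale g" "\<forall>b\<in>B. g b = (if b \<in> B0 then 0 else b)"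
    using p.linear_independent_extend[OF B(2), of "\<lambda>b. if b \<in> B0 then 0 else b"] by blast
  have gb: "g b = 0" if "b \<in> B0" for b using g(2) B(1) that by auto
  have g0: "g x = 0" if "x \<in> span B0" for x
    using p.linear_eq_on[OF g(1) linear_intro[of "\<lambda>x. 0"] that] gb by simp
  have g1: "g x = x" if "x \<in> span (B - B0)" for x
    using p.linear_eq_on[OF g(1) linear_intro[of "\<lambda>x. x"] that] g(2) by auto
  have "g x = 0 \<longleftrightarrow> x \<in> T" for x
  proof
    assume "x \<in> T" then show "g x = 0" using g0 B0 by blast
  next
    assume gx: "g x = 0"
    have "B0 \<union> (B - B0) = B" using B(1) by blast
    then have "x \<in> span (B0 \<union> (B - B0))" using B(3) by auto
    then obtain y z where yz: "x = y + z" "y \<in> span B0" "z \<in> span (B - B0)"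
      unfolding span_Un by blast
    then have "z = 0" using gx g0 g1 p.linear_add[OF g(1)] by simp
    then show "x \<in> T" using yz span_minimal[OF B0(1) assms] by auto
  qed
  then show ?thesis using g(1) by blast
qed

lemma rank_nullity_self:
  assumes "Vector_Spaces.linear scale scale f" "subspace S" "fin_dim S"
  shows "dim S = dim {x \<in> S. f x = 0} + dim (f ` S)" "fin_dim (f ` S)"
proof -
  interpret p: vector_space_pair scale scale by unfold_locales
  show fd: "fin_dim (f ` S)"
    using assms(3) p.linear_spans_image[OF assms(1)] unfolding fin_dim_def by blast
  show "dim S = dim {x \<in> S. f x = 0} + dim (f ` S)"
    using rank_nullity[OF lin_space_axioms lin_space_axioms assms(1,2) fin_dim_mono[OF _ assms(3)] fd] by blast
qed

lemma dim_add_le: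
  assumes "subspace S" "subspace T" "subspace W" "S \<subseteq> W" "T \<subseteq> W" "fin_dim W"
  shows "dim S + dim T \<le> dim W + dim (S \<inter> T)"
proof -
  obtain f where f: "Vector_Spaces.linear scale scale f" "\<And>x. f x = 0 \<longleftrightarrow> x \<in> T"
    using subspace_quotient_map[OF assms(2)] by blast
  have "{x \<in> W. f x = 0} = T" "{x \<in> S. f x = 0} = S \<inter> T" using f(2) assms(5) by auto
  then have "dim W = dim T + dim (f ` W)" "dim S = dim (S \<inter> T) + dim (f ` S)"
    using rank_nullity_self(1)[OF f(1), of W] rank_nullity_self(1)[OF f(1), of S] assms
      fin_dim_mono[OF assms(4,6)] by simp_all
  moreover have "dim (f ` S) \<le> dim (f ` W)"
    using rank_nullity_self(2)[OF f(1) assms(3,6)] assms(4) by (intro dim_mono_fin_dim) auto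
  ultimately show ?thesis by simp
qed

lemma linear_projection_along:
  assumes "subspace S" "subspace T" "S \<inter> T \<subseteq> {0}"
  shows "\<exists>p. Vector_Spaces.linear scale scale p \<and> range p \<subseteq> S \<and> (\<forall>x\<in>S. p x = x) \<and> (\<forall>x\<in>T. p x = 0)"
proof -
  interpret p: vector_space_pair scale scale by unfold_locales
  obtain f where f: "Vector_Spaces.linear scale scale f" "\<And>x. f x = 0 \<longleftrightarrow> x \<in> T"
    using subspace_quotient_map[OF assms(2)] by blast
  have "inj_on f S"
    using f assms(3) by (subst p.linear_inj_on_iff_eq_0[OF f(1) assms(1)]) auto
  then obtain g where g: "g ` UNIV \<subseteq> S" "Vector_Spaces.linear scale scale g" "\<forall>v\<in>S. g (f v) = v"
    using p.linear_exists_left_inverse_on[OF f(1) assms(1)] by blast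
  have "Vector_Spaces.linear scale scale (\<lambda>x. g (f x))"
    using f(1) g(2) by (simp add: Vector_Spaces.linear_iff)
  moreover have "range (\<lambda>x. g (f x)) \<subseteq> S" using g(1) by blast
  moreover have "g (f x) = x" if "x \<in> S" for x using g(3) that by blast
  moreover have "g (f x) = 0" if "x \<in> T" for x
    using f(2)[of x] that p.linear_0[OF g(2)] by simp
  ultimately show ?thesis by blast
qed

end

section \<open>Representations of the symmetric group\<close>

abbreviation transp :: "'v \<Rightarrow> 'v \<Rightarrow> 'v \<Rightarrow> 'v" where
  "transp \<equiv> Transposition.transpose"

locale sym_rep = lin_space scale
  for scale :: "'k::field \<Rightarrow> 'b::ab_group_add \<Rightarrow> 'b" +
  fixes act :: "('v::finite \<Rightarrow> 'v) \<Rightarrow> 'b \<Rightarrow> 'b"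
  assumes act_add: "act \<sigma> (x + y) = act \<sigma> x + act \<sigma> y"
    and act_scale: "act \<sigma> (scale c x) = scale c (act \<sigma> x)"
    and act_id: "act id x = x"
    and act_comp: "bij \<sigma> \<Longrightarrow> bij \<tau> \<Longrightarrow> act \<sigma> (act \<tau> x) = act (\<sigma> \<circ> \<tau>) x"
    and fact_nonzero: "of_nat (fact CARD('v)) \<noteq> (0::'k)"
begin

definition submod :: "'b set \<Rightarrow> bool" where
  "submod M \<longleftrightarrow> subspace M \<and> (\<forall>\<sigma>. bij \<sigma> \<longrightarrow> (\<forall>f\<in>M. act \<sigma> f \<in> M))"

text \<open>The labelling \<open>m\<close> stands for the partition of the points into its fibres. Swaps generate the
  corresponding Young subgroup, so that this is the space of its invariants in \<open>K\<close>.\<close>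

definition young_inv :: "'b set \<Rightarrow> ('v \<Rightarrow> 'l) \<Rightarrow> 'b set" where
  "young_inv K m = {w \<in> K. \<forall>i j. m i = m j \<longrightarrow> act (transp i j) w = w}"

lemma act_linear: "Vector_Spaces.linear scale scale (act \<sigma>)"
  by (intro linear_intro act_add act_scale)

lemma act_0 [simp]: "act \<sigma> 0 = 0"
  using act_add[of \<sigma> 0 0] by simp

lemma act_neg: "act \<sigma> (- x) = - act \<sigma> x"
  using act_add[of \<sigma> x "- x"] by (simp add: eq_neg_iff_add_eq_0 add.commute)

lemma act_diff: "act \<sigma> (x - y) = act \<sigma> x - act \<sigma> y"
  using act_add[of \<sigma> x "- y"] by (simp add: act_neg)

lemma act_sum: "act \<sigma> (\<Sum>x\<in>X. f x) = (\<Sum>x\<in>X. act \<sigma> (f x))"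
  by (induction X rule: infinite_finite_induct) (simp_all add: act_add)

lemma act_inv: "bij \<sigma> \<Longrightarrow> act \<sigma> (act (Hilbert_Choice.inv \<sigma>) x) = x"
  "bij \<sigma> \<Longrightarrow> act (Hilbert_Choice.inv \<sigma>) (act \<sigma> x) = x"
  using act_comp[of \<sigma> "Hilbert_Choice.inv \<sigma>" x] act_comp[of "Hilbert_Choice.inv \<sigma>" \<sigma> x]
  by (simp_all add: bij_imp_bij_inv act_id bij_is_surj[THEN surj_iff[THEN iffD1]]
      bij_is_inj[THEN inj_iff[THEN iffD1]])

lemma act_inj: "bij \<sigma> \<Longrightarrow> act \<sigma> x = act \<sigma> y \<Longrightarrow> x = y"
  by (metis act_inv(2))

lemma submodD:
  "submod M \<Longrightarrow> subspace M"
  "submod M \<Longrightarrow> bij \<sigma> \<Longrightarrow> x \<in> M \<Longrightarrow> act \<sigma> x \<in> M"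
  by (simp_all add: submod_def)

lemma act_permutes:
  assumes "\<And>i j. i \<in> A \<Longrightarrow> j \<in> A \<Longrightarrow> act (transp i j) w = w" "\<sigma> permutes A"
  shows "act \<sigma> w = w"
proof (rule permutes_induct[OF assms(2)])
  show "finite A" by simp
  show "act id w = w" by (rule act_id)
  fix a b p assume "a \<in> A" "b \<in> A" "act p w = w" "p permutes A"
  then show "act (transp a b \<circ> p) w = w"
    using assms(1) act_comp[of "transp a b" p w] by (simp add: permutes_bij)
qed

lemma transp_fixed_trans:
  assumes "act (transp x y) w = w" "act (transp y z) w = w"
  shows "act (transp x z) w = w"
proof (cases "x = z \<or> y = z")
  case True
  then show ?thesis using assms by (auto simp: act_id)
next
  case False
  then have "transp x z = transp x y \<circ> (transp y z \<circ> transp x y)"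
    by (simp add: transpose_comp_triple flip: comp_assoc)
  then show ?thesis using assms by (simp add: bij_comp flip: act_comp)
qed

lemma transp_conj:
  assumes "bij \<sigma>"
  shows "act (transp (\<sigma> i) (\<sigma> j)) (act \<sigma> w) = act \<sigma> (act (transp i j) w)"
proof -
  have "transp (\<sigma> i) (\<sigma> j) \<circ> \<sigma> = \<sigma> \<circ> transp i j"
    using assms by (simp add: transpose_comp_eq bij_is_inj)
  then show ?thesis using assms by (simp add: act_comp)
qed

lemma subspace_transp_fixed:
  assumes "subspace K"
  shows "subspace {w \<in> K. \<forall>i j. P i j \<longrightarrow> act (transp i j) w = w}"
  using assms unfolding subspace_def by (auto simp: act_add act_scale)

lemma subspace_young_inv: "subspace K \<Longrightarrow> subspace (young_inv K m)"
  unfolding young_inv_def by (rule subspace_transp_fixed)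

lemma young_inv_subset: "young_inv K m \<subseteq> K"
  unfolding young_inv_def by blast

lemma fin_dim_young_inv: "fin_dim K \<Longrightarrow> fin_dim (young_inv K m)"
  using young_inv_subset by (rule fin_dim_mono)

lemma young_inv_mono: "(\<And>i j. m' i = m' j \<Longrightarrow> m i = m j) \<Longrightarrow> young_inv K m \<subseteq> young_inv K m'"
  unfolding young_inv_def by blast

lemma dim_le_inj:
  assumes "Vector_Spaces.linear scale scale f" "subspace S" "f ` S \<subseteq> T" "fin_dim S" "fin_dim T"
    and "\<And>x. x \<in> S \<Longrightarrow> f x = 0 \<Longrightarrow> x = 0"
  shows "dim S \<le> dim T"
proof -
  interpret p: vector_space_pair scale scale by unfold_locales
  have "{x \<in> S. f x = 0} = {0}"
    using assms(6) subspace_0[OF assms(2)] p.linear_0[OF assms(1)] by auto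
  then have "dim S = dim (f ` S)"
    using rank_nullity_self(1)[OF assms(1,2,4)] dim_zero_space by simp
  also have "\<dots> \<le> dim T" using assms by (intro dim_mono_fin_dim)
  finally show ?thesis .
qed

end

section \<open>Fixed vectors of Young subgroups\<close>

text \<open>The codimension of an intersection is a submodular function of the set of subspaces intersected, and
  this is Shearer's inequality for it: if every \<open>U j\<close> occurs in \<open>e\<close> of the families, the codimensions
  of the intersections add up to at least \<open>e\<close> times the codimension of the intersection of all.\<close>

lemma (in lin_space) shearer:
  fixes U :: "nat \<Rightarrow> 'b set" and E :: "'i \<Rightarrow> nat set"
  assumes K: "subspace K" "fin_dim K" and U: "\<And>j. subspace (U j)" and I: "finite I"
    and cov: "\<And>j. j < N \<Longrightarrow> card {i \<in> I. j \<in> E i} = e"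
    and triv: "{w \<in> K. \<forall>j<N. w \<in> U j} \<subseteq> {0}"
  shows "(\<Sum>i\<in>I. dim {w \<in> K. \<forall>j<N. j \<in> E i \<longrightarrow> w \<in> U j}) + e * dim K \<le> card I * dim K"
proof -
  define G where "G i t = {w \<in> K. \<forall>j<t. j \<in> E i \<longrightarrow> w \<in> U j}" for i t
  define H where "H t = {w \<in> K. \<forall>j<t. w \<in> U j}" for t
  have sub: "subspace (G i t)" "subspace (H t)" for i t
    using K(1) U unfolding G_def H_def subspace_def by auto
  have fd: "fin_dim (G i t)" "fin_dim (H t)" for i t
    using fin_dim_mono[OF _ K(2)] unfolding G_def H_def by auto
  have step: "dim (G i (Suc t)) + (if t \<in> E i then dim (H t) else 0)
      \<le> dim (G i t) + (if t \<in> E i then dim (H (Suc t)) else 0)" for i t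
  proof (cases "t \<in> E i")
    case True
    have "G i (Suc t) \<inter> H t = H (Suc t)"
      using True unfolding G_def H_def by (auto simp: less_Suc_eq)
    moreover have "G i (Suc t) \<subseteq> G i t" "H t \<subseteq> G i t" unfolding G_def H_def by auto
    ultimately show ?thesis
      using dim_add_le[OF sub(1)[of i "Suc t"] sub(2)[of t] sub(1)[of i t] _ _ fd(1)] True by simp
  next
    case False
    then have "G i (Suc t) = G i t" unfolding G_def by (auto simp: less_Suc_eq)
    then show ?thesis using False by simp
  qed
  have "(\<Sum>i\<in>I. dim (G i t)) + e * dim K \<le> card I * dim K + e * dim (H t)" if "t \<le> N" for t
    using that
  proof (induction t)
    case 0
    then show ?case by (simp add: G_def H_def)
  next
    case (Suc t)
    have c: "(\<Sum>i\<in>I. if t \<in> E i then x else (0::nat)) = e * x" for x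
      using cov[of t] Suc.prems I by (simp add: sum.If_cases Int_def conj_commute)
    have "(\<Sum>i\<in>I. dim (G i (Suc t))) + e * dim (H t) \<le> (\<Sum>i\<in>I. dim (G i t)) + e * dim (H (Suc t))"
      using sum_mono[of I "\<lambda>i. dim (G i (Suc t)) + (if t \<in> E i then dim (H t) else 0)", OF step]
      by (simp add: sum.distrib c)
    then show ?case using Suc by simp
  qed
  from this[of N] have "(\<Sum>i\<in>I. dim (G i N)) + e * dim K \<le> card I * dim K + e * dim (H N)"
    by simp
  moreover have "dim (H N) = 0"
    using triv fd(2)[of N] dim_mono_fin_dim[of "H N" "{0}"] dim_zero_space fin_dim_span[of "{}"]
    unfolding H_def by simp
  ultimately show ?thesis unfolding G_def by simp
qed

lemma nat_add_mod_cancel: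
  fixes a b c N :: nat
  assumes "a < N" "b < N" "(c + a) mod N = (c + b) mod N"
  shows "a = b"
proof -
  have *: "x = y" if "x \<le> y" "y < N" "(c + x) mod N = (c + y) mod N" for x y
  proof -
    have "N dvd (c + y) - (c + x)" using that mod_eq_dvd_iff_nat[of "c + x" "c + y" N] by simp
    then show ?thesis using that by (auto dest: dvd_imp_le)
  qed
  show ?thesis using *[of a b] *[of b a] assms by (cases "a \<le> b") auto
qed

lemma rotation_cover:
  fixes N :: nat
  assumes "E0 \<subseteq> {..<N}" "j < N"
  shows "card {i \<in> {..<N}. \<exists>j0\<in>E0. j = (j0 + i) mod N} = card E0"
proof -
  define f where "f j0 = (j + (N - j0)) mod N" for j0
  have f: "(j0 + f j0) mod N = j" "f j0 < N" if "j0 \<in> E0" for j0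
  proof -
    have "j0 < N" using that assms(1) by auto
    then have "(j0 + f j0) mod N = (j + N) mod N" unfolding f_def mod_add_right_eq by simp
    then show "(j0 + f j0) mod N = j" using assms(2) by simp
    show "f j0 < N" using assms(2) unfolding f_def by simp
  qed
  have "inj_on f E0"
  proof (rule inj_onI)
    fix a b assume ab: "a \<in> E0" "b \<in> E0" "f a = f b"
    then have "(f a + a) mod N = (f a + b) mod N" using f(1)[of a] f(1)[of b] by (simp add: add.commute)
    then show "a = b" using nat_add_mod_cancel ab assms(1) by (meson lessThan_iff subsetD)
  qed
  moreover have "f ` E0 = {i \<in> {..<N}. \<exists>j0\<in>E0. j = (j0 + i) mod N}" (is "_ = ?R")
  proof
    show "f ` E0 \<subseteq> ?R" using f by force
    show "?R \<subseteq> f ` E0"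
    proof
      fix i assume "i \<in> ?R"
      then obtain j0 where j0: "i < N" "j0 \<in> E0" "j = (j0 + i) mod N" by auto
      then have "i = f j0" using nat_add_mod_cancel[of i N "f j0" j0] f[of j0] by simp
      then show "i \<in> f ` E0" using j0 by blast
    qed
  qed
  ultimately show ?thesis by (metis card_image)
qed

lemma cyclic_boundaries:
  fixes h :: "nat \<Rightarrow> 'a" and m :: "'a \<Rightarrow> nat"
  assumes "\<And>j j'. j \<le> j' \<Longrightarrow> j' < N \<Longrightarrow> m (h j) \<le> m (h j')"
  shows "card {j \<in> {..<N}. m (h j) \<noteq> m (h (Suc j mod N))} \<le> card ((m \<circ> h) ` {..<N})"
proof -
  let ?B = "{j \<in> {..<N}. m (h j) \<noteq> m (h (Suc j mod N))}"
  have *: False if "j \<in> ?B" "j' \<in> ?B" "m (h j) = m (h j')" "j < j'" for j j'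
  proof -
    have "Suc j mod N = Suc j" using that by auto
    moreover have "m (h j) \<le> m (h (Suc j))" "m (h (Suc j)) \<le> m (h j')"
      using that assms[of j "Suc j"] assms[of "Suc j" j'] by auto
    ultimately show False using that by auto
  qed
  have "inj_on (m \<circ> h) ?B"
  proof (rule inj_onI)
    fix a b assume ab: "a \<in> ?B" "b \<in> ?B" "(m \<circ> h) a = (m \<circ> h) b"
    then have "\<not> a < b" "\<not> b < a" using *[of a b] *[of b a] unfolding comp_def by metis+
    then show "a = b" by simp
  qed
  then have "card ?B = card ((m \<circ> h) ` ?B)" by (rule card_image[symmetric])
  also have "\<dots> \<le> card ((m \<circ> h) ` {..<N})" by (intro card_mono image_mono) auto
  finally show ?thesis .
qed

context sym_rep
begin

text \<open>Arrange the points of \<open>A\<close> on a circle so that the fibres of \<open>m\<close> are intervals, and let \<open>U j\<close> be the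
  fixed space of the swap of the points \<open>j\<close> and \<open>j + 1\<close>. A vector invariant for \<open>m\<close> lies in all \<open>U j\<close>
  except for the at most \<open>card (m ` A)\<close> boundaries of the intervals. Rotating the circle moves these
  exceptions uniformly over all positions and does not change dimensions, so Shearer's inequality
  applies to the rotations.\<close>

lemma cyclic_bound:
  fixes m :: "'v \<Rightarrow> nat" and A :: "'v set"
  assumes K: "submod K" "fin_dim K"
    and triv: "\<And>w. w \<in> K \<Longrightarrow> (\<And>i j. i \<in> A \<Longrightarrow> j \<in> A \<Longrightarrow> act (transp i j) w = w) \<Longrightarrow> w = 0"
  shows "card A * dim (young_inv K m) \<le> card (m ` A) * dim K"
proof (cases "A = {}")
  case False
  define N where "N = card A"
  have N: "N > 0" using False unfolding N_def by (simp add: card_gt_0_iff)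
  obtain xs0 where xs0: "distinct xs0" "set xs0 = A"
    using finite_distinct_list[of A] by auto
  define xs where "xs = sort_key m xs0"
  define h where "h j = xs ! j" for j
  have xs: "distinct xs" "set xs = A" "sorted (map m xs)" "length xs = N"
    using xs0 distinct_card[OF xs0(1)] unfolding xs_def N_def by simp_all
  have h: "bij_betw h {..<N} A"
    using bij_betw_nth[OF xs(1), of "{..<N}" A] xs unfolding h_def by simp
  have mono: "m (h j) \<le> m (h j')" if "j \<le> j'" "j' < N" for j j'
    using sorted_nth_mono[OF xs(3), of j j'] that xs(4) unfolding h_def by simp
  define nx where "nx j = Suc j mod N" for j
  have nx: "nx j < N" for j using N unfolding nx_def by simp
  define \<gamma> where "\<gamma> x = (if x \<in> A then h (nx (the_inv_into {..<N} h x)) else x)" for x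
  have \<gamma>h: "\<gamma> (h j) = h (nx j)" if "j < N" for j
    using that h bij_betwE[OF h] unfolding \<gamma>_def
    by (auto simp: the_inv_into_f_f bij_betw_def)
  have "inj_on \<gamma> A"
  proof (rule inj_onI)
    fix x y assume xy: "x \<in> A" "y \<in> A" "\<gamma> x = \<gamma> y"
    then obtain a b where ab: "x = h a" "y = h b" "a < N" "b < N"
      using h unfolding bij_betw_def by blast
    then have "nx a = nx b" using xy \<gamma>h h nx unfolding bij_betw_def inj_on_def by auto
    then have "a = b" using nat_add_mod_cancel[of a N b 1] ab unfolding nx_def by simp
    then show "x = y" using ab by simp
  qed
  moreover have "\<gamma> ` A \<subseteq> A" using bij_betwE[OF h] nx unfolding \<gamma>_def by auto
  ultimately have "bij_betw \<gamma> A A" by (simp add: bij_betw_def endo_inj_surj)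
  then have "\<gamma> permutes A" by (rule bij_imp_permutes) (simp add: \<gamma>_def)
  then have bij: "bij \<gamma>" by (rule permutes_bij)
  define U where "U j = {w. act (transp (h j) (h (nx j))) w = w}" for j
  have U: "subspace (U j)" for j
    unfolding U_def subspace_def by (auto simp: act_add act_scale)
  have U_shift: "act \<gamma> w \<in> U (nx j)" if "w \<in> U j" "j < N" for w j
    using that transp_conj[OF bij, of "h j" "h (nx j)" w] \<gamma>h nx unfolding U_def by simp
  define E0 where "E0 = {j \<in> {..<N}. m (h j) = m (h (nx j))}"
  define E where "E i = {j. \<exists>j0\<in>E0. j = (j0 + i) mod N}" for i
  define F where "F i = {w \<in> K. \<forall>j<N. j \<in> E i \<longrightarrow> w \<in> U j}" for i
  have Fsub: "subspace (F i)" for i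
    using submodD(1)[OF K(1)] U unfolding F_def subspace_def by auto
  have Ffd: "fin_dim (F i)" for i using fin_dim_mono[OF _ K(2)] unfolding F_def by auto
  have F_shift: "dim (F i) \<le> dim (F (Suc i))" for i
  proof (rule dim_le_inj[OF act_linear Fsub _ Ffd Ffd])
    show "act \<gamma> ` F i \<subseteq> F (Suc i)"
    proof
      fix y assume "y \<in> act \<gamma> ` F i"
      then obtain w where w: "w \<in> F i" "y = act \<gamma> w" by blast
      have "y \<in> U j" if "j < N" "j \<in> E (Suc i)" for j
      proof -
        obtain j0 where j0: "j0 \<in> E0" "j = (j0 + Suc i) mod N" using \<open>j \<in> E (Suc i)\<close> E_def by auto
        let ?j = "(j0 + i) mod N"
        have "?j \<in> E i" "?j < N" using j0 N unfolding E_def by auto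
        then have "w \<in> U ?j" using w unfolding F_def by blast
        moreover have "nx ?j = j" using j0 unfolding nx_def by (simp add: mod_Suc_eq)
        ultimately show ?thesis using U_shift[of w ?j] w \<open>?j < N\<close> by simp
      qed
      then show "y \<in> F (Suc i)" using w submodD(2)[OF K(1) bij] unfolding F_def by auto
    qed
    show "x = 0" if "act \<gamma> x = 0" for x using act_inj[OF bij, of x 0] that by simp
  qed
  have F_ge: "dim (F 0) \<le> dim (F i)" for i
    by (induction i) (use F_shift le_trans in blast)+
  have "young_inv K m \<subseteq> F 0"
    unfolding young_inv_def F_def U_def E_def E0_def by auto
  then have D: "dim (young_inv K m) \<le> dim (F 0)" by (rule dim_mono_fin_dim[OF _ Ffd])
  have all: "{w \<in> K. \<forall>j<N. w \<in> U j} \<subseteq> {0}"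
  proof (intro subsetI)
    fix w assume w: "w \<in> {w \<in> K. \<forall>j<N. w \<in> U j}"
    have h0: "act (transp (h 0) (h j)) w = w" if "j < N" for j
      using that
    proof (induction j)
      case 0
      show ?case using act_id by (simp add: id_def)
    next
      case (Suc j)
      then have "nx j = Suc j" unfolding nx_def by simp
      moreover have "w \<in> U j" using w Suc by simp
      ultimately have "act (transp (h j) (h (Suc j))) w = w" unfolding U_def by simp
      then show ?case using Suc transp_fixed_trans by auto
    qed
    have "act (transp x y) w = w" if xy: "x \<in> A" "y \<in> A" for x y
    proof -
      obtain a b where "x = h a" "y = h b" "a < N" "b < N"
        using h xy unfolding bij_betw_def by blast
      then show ?thesis
        using h0[of a] h0[of b] transp_fixed_trans[of "h a" "h 0" w "h b"]
        by (simp add: transpose_commute)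
    qed
    then show "w \<in> {0}" using triv w by blast
  qed
  have cov: "card {i \<in> {..<N}. j \<in> E i} = card E0" if "j < N" for j
    using rotation_cover[of E0 N j] that unfolding E_def E0_def by auto
  have "(\<Sum>i<N. dim (F i)) + card E0 * dim K \<le> N * dim K"
    using shearer[OF submodD(1)[OF K(1)] K(2) U, of "{..<N}" N E "card E0"] cov all
    unfolding F_def by simp
  moreover have "N * dim (young_inv K m) \<le> (\<Sum>i<N. dim (F i))"
    using sum_mono[of "{..<N}" "\<lambda>_. dim (young_inv K m)" "\<lambda>i. dim (F i)"] D F_ge le_trans by force
  moreover have "N = card E0 + card {j \<in> {..<N}. m (h j) \<noteq> m (h (nx j))}"
  proof -
    have "{..<N} = E0 \<union> {j \<in> {..<N}. m (h j) \<noteq> m (h (nx j))}" unfolding E0_def by auto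
    then have "card {..<N} = card E0 + card {j \<in> {..<N}. m (h j) \<noteq> m (h (nx j))}"
      by (metis (no_types, lifting) E0_def card_Un_disjoint disjoint_iff finite_Un finite_lessThan mem_Collect_eq)
    then show ?thesis by simp
  qed
  moreover have "card {j \<in> {..<N}. m (h j) \<noteq> m (h (nx j))} \<le> card (m ` A)"
  proof -
    have "(m \<circ> h) ` {..<N} = m ` A" using h unfolding bij_betw_def by (metis image_comp)
    then show ?thesis using cyclic_boundaries[of N m h, OF mono] unfolding nx_def by simp
  qed
  ultimately have "N * dim (young_inv K m) + card E0 * dim K \<le> (card E0 + card (m ` A)) * dim K"
    by (smt (verit) add_le_mono1 add_left_mono le_trans mult_le_mono1)
  then show ?thesis unfolding N_def by (simp add: add_mult_distrib)
qed simp


lemma of_nat_nonzero: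
  assumes "0 < k" "k \<le> CARD('v)"
  shows "of_nat k \<noteq> (0::'k)"
proof
  assume "of_nat k = (0::'k)"
  moreover have "k dvd fact CARD('v)" using assms by (intro dvd_fact) auto
  ultimately show False using fact_nonzero by (metis dvdE mult_zero_left of_nat_mult)
qed

lemma of_nat_fact_nonzero:
  assumes "k \<le> CARD('v)"
  shows "of_nat (fact k) \<noteq> (0::'k)"
proof
  assume "of_nat (fact k) = (0::'k)"
  moreover have "fact k dvd (fact CARD('v) :: nat)" using assms by (rule fact_dvd)
  ultimately show False using fact_nonzero by (metis dvdE mult_zero_left of_nat_mult)
qed

text \<open>The swaps of points with equal labels generate the group of all permutations preserving the labels.\<close>

lemma act_label_preserving:
  assumes "bij \<sigma>" "m \<circ> \<sigma> = m" "w \<in> young_inv K m"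
  shows "act \<sigma> w = w"
  using assms(1,2)
proof (induction "card {x. \<sigma> x \<noteq> x}" arbitrary: \<sigma> rule: less_induct)
  case less
  show ?case
  proof (cases "\<exists>a. \<sigma> a \<noteq> a")
    case False
    then have "\<sigma> = id" by auto
    then show ?thesis by (simp only: act_id)
  next
    case True
    then obtain a where a: "\<sigma> a \<noteq> a" by blast
    define \<tau> where "\<tau> = transp a (\<sigma> a) \<circ> \<sigma>"
    have inj: "inj \<sigma>" using less.prems by (simp add: bij_is_inj)
    have lab: "m (\<sigma> x) = m x" for x using less.prems(2) by (metis comp_apply)
    have "\<tau> a = a" unfolding \<tau>_def by simp
    moreover have "\<tau> x = x" if "\<sigma> x = x" for x
    proof -
      have "x \<noteq> a" using a that by auto
      moreover have "x \<noteq> \<sigma> a" using that inj a by (auto dest: injD)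
      ultimately show ?thesis using that unfolding \<tau>_def by simp
    qed
    ultimately have "{x. \<tau> x \<noteq> x} \<subset> {x. \<sigma> x \<noteq> x}" using a by auto
    then have "card {x. \<tau> x \<noteq> x} < card {x. \<sigma> x \<noteq> x}" by (intro psubset_card_mono) auto
    moreover have bij: "bij \<tau>" using less.prems(1) unfolding \<tau>_def by (simp add: bij_comp)
    moreover have "m \<circ> \<tau> = m"
    proof
      fix x show "(m \<circ> \<tau>) x = m x"
        using lab[of x] lab[of a] unfolding \<tau>_def comp_def by (cases "\<sigma> x = a \<or> \<sigma> x = \<sigma> a") auto
    qed
    ultimately have "act \<tau> w = w" by (rule less.hyps)
    moreover have "\<sigma> = transp a (\<sigma> a) \<circ> \<tau>"
      unfolding \<tau>_def by (simp add: fun_eq_iff)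
    then have "act \<sigma> w = act (transp a (\<sigma> a)) (act \<tau> w)"
      using act_comp[of "transp a (\<sigma> a)" \<tau> w] bij by simp
    moreover have "act (transp a (\<sigma> a)) w = w"
      using assms(3) lab[of a] unfolding young_inv_def by auto
    ultimately show ?thesis by simp
  qed
qed

text \<open>The swaps of \<open>a\<close> with the points of \<open>insert a Y\<close> represent the cosets of the permutations of \<open>Y\<close> in
  those of \<open>insert a Y\<close>.\<close>

lemma act_coset:
  assumes "\<And>i j. i \<in> Y \<Longrightarrow> j \<in> Y \<Longrightarrow> act (transp i j) w = w" "\<sigma> permutes insert a Y" "a \<notin> Y"
  shows "act \<sigma> w = act (transp a (\<sigma> a)) w"
proof -
  define \<tau> where "\<tau> = transp a (\<sigma> a) \<circ> \<sigma>"
  have sa: "\<sigma> a \<in> insert a Y" using assms(2) by (metis insertI1 permutes_in_image)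
  have "\<tau> permutes insert a Y"
    unfolding \<tau>_def using sa by (intro permutes_compose[OF assms(2)] permutes_swap_id) auto
  moreover have "\<tau> a = a" unfolding \<tau>_def by simp
  ultimately have perm: "\<tau> permutes Y"
    using permutes_superset[of \<tau> "insert a Y" Y] by blast
  have "act \<tau> w = w" by (rule act_permutes[OF assms(1) perm])
  moreover have "bij \<tau>" using perm by (rule permutes_bij)
  moreover have "\<sigma> = transp a (\<sigma> a) \<circ> \<tau>" unfolding \<tau>_def by (simp add: fun_eq_iff)
  ultimately show ?thesis using act_comp[of "transp a (\<sigma> a)" \<tau> w] by simp
qed

lemma card_permutes_preserving:
  fixes X Y :: "'v set"
  assumes "X \<inter> Y = {}"
  shows "card {h. h permutes (X \<union> Y) \<and> Y \<subseteq> h ` Y} = fact (card X) * fact (card Y)"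
proof -
  let ?P = "{p. p permutes X} \<times> {q. q permutes Y}"
  have "inj_on (\<lambda>(p, q). p \<circ> q) ?P"
  proof (rule inj_onI, clarify)
    fix p q p' q' assume pq: "p permutes X" "q permutes Y" "p' permutes X" "q' permutes Y"
      "p \<circ> q = p' \<circ> q'"
    have 1: "p x = p' x" for x
    proof (cases "x \<in> X")
      case True
      then have "x \<notin> Y" using assms by auto
      then have "q x = x" "q' x = x" using pq permutes_not_in by metis+
      then show ?thesis using fun_cong[OF pq(5), of x] by simp
    next
      case False
      then show ?thesis using pq permutes_not_in by metis
    qed
    then have "p = p'" by auto
    moreover have "q x = q' x" for x
      using fun_cong[OF pq(5), of x] permutes_inj[OF pq(1)] \<open>p = p'\<close> by (auto dest: injD)
    ultimately show "p = p' \<and> q = q'" by auto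
  qed
  moreover have "(\<lambda>(p, q). p \<circ> q) ` ?P = {h. h permutes (X \<union> Y) \<and> Y \<subseteq> h ` Y}" (is "_ = ?R")
  proof
    show "(\<lambda>(p, q). p \<circ> q) ` ?P \<subseteq> ?R"
    proof (clarsimp)
      fix p q assume pq: "p permutes X" "q permutes Y"
      have "p permutes X \<union> Y" "q permutes X \<union> Y" using pq permutes_subset by blast+
      moreover have "p y = y" if "y \<in> Y" for y using pq(1) that assms permutes_not_in by fastforce
      then have "p ` (q ` Y) = Y" using permutes_image[OF pq(2)] by force
      ultimately show "p \<circ> q permutes X \<union> Y \<and> Y \<subseteq> (\<lambda>x. p (q x)) ` Y"
        using permutes_compose by (auto simp: image_image)
    qed
    show "?R \<subseteq> (\<lambda>(p, q). p \<circ> q) ` ?P"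
    proof
      fix h assume h: "h \<in> ?R"
      then have perm: "h permutes (X \<union> Y)" and "Y \<subseteq> h ` Y" by auto
      then have hY: "h ` Y = Y" by (metis card_image card_subset_eq finite permutes_inj_on)
      have "h ` X = h ` ((X \<union> Y) - Y)" using assms by (intro arg_cong[where f = "image h"]) auto
      also have "\<dots> = X"
        using permutes_image[OF perm] hY assms permutes_inj[OF perm] by (auto simp: image_set_diff)
      finally have hX: "h ` X = X" .
      define p where "p x = (if x \<in> X then h x else x)" for x
      define q where "q x = (if x \<in> Y then h x else x)" for x
      have "bij_betw h X X" "bij_betw h Y Y"
        using hX hY permutes_inj_on[OF perm] unfolding bij_betw_def by auto
      then have "bij_betw p X X" "bij_betw q Y Y"
        by (simp_all add: p_def q_def cong: bij_betw_cong)
      then have "p permutes X" "q permutes Y"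
        by (auto intro!: bij_imp_permutes simp: p_def q_def)
      moreover have "h x = p (q x)" for x
        using hY assms permutes_not_in[OF perm, of x] unfolding p_def q_def by (auto; blast)
      then have "h = p \<circ> q" by auto
      ultimately show "h \<in> (\<lambda>(p, q). p \<circ> q) ` ?P" by force
    qed
  qed
  ultimately have "card {h. h permutes (X \<union> Y) \<and> Y \<subseteq> h ` Y} = card ?P"
    using card_image[of "\<lambda>(p, q). p \<circ> q" ?P] by simp
  also have "\<dots> = card {p. p permutes X} * card {q. q permutes Y}"
    by (rule card_cartesian_product)
  finally show ?thesis
    using card_permutations[OF refl, of X] card_permutations[OF refl, of Y] by simp
qed


text \<open>For a subset \<open>S\<close> of \<open>X \<union> Y\<close> of the size of \<open>Y\<close>, all permutations of \<open>X \<union> Y\<close> that carry \<open>Y\<close> to \<open>S\<close> have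
  the same effect on \<open>w\<close>; call the result \<open>F S\<close>. The hypothesis says that \<open>F\<close> sums to zero over the
  subsets of every set with one more element than \<open>Y\<close>. As \<open>Y\<close> is smaller than \<open>X\<close>, it therefore sums
  to zero over the \<open>S\<close> disjoint from a given \<open>B \<subseteq> Y\<close>, and inclusion-exclusion over \<open>B\<close> isolates
  \<open>F Y = w\<close>. Summing over permutations instead of sets only introduces factorials.\<close>

lemma balancing_injective:
  fixes m :: "'v \<Rightarrow> 'l" and X Y :: "'v set"
  assumes w: "w \<in> young_inv K m"
    and XY: "X = {i. m i = lx}" "Y = {i. m i = ly}" "lx \<noteq> ly" "card Y < card X"
    and sum0: "\<And>a. a \<in> X \<Longrightarrow> (\<Sum>c\<in>insert a Y. act (transp a c) w) = 0"
  shows "w = 0"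
proof -
  define H where "H = {h. h permutes (X \<union> Y)}"
  have finH: "finite H" unfolding H_def by (rule finite_permutations) simp
  have disj: "X \<inter> Y = {}" using XY by auto
  have bijH: "bij h" if "h \<in> H" for h using that permutes_bij unfolding H_def by auto
  \<comment> \<open>the sum of \<open>F S\<close> over the \<open>S\<close> containing \<open>A\<close> and avoiding \<open>B\<close>, up to a factor\<close>
  define G where "G A B = (\<Sum>h\<in>{h \<in> H. A \<subseteq> h ` Y \<and> B \<inter> h ` Y = {}}. act h w)" for A B
  have avoid: "G {} B = 0" if B: "B \<subseteq> Y" for B
  proof -
    have cardB: "card B < card X" using card_mono[OF _ B] XY(4) by simp
    define Hs where "Hs a = {h \<in> H. B \<inter> h ` (insert a Y) = {}}" for a
    \<comment> \<open>\<open>Hs a\<close> is a union of left cosets of the permutations of \<open>insert a Y\<close>\<close>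
    have S0: "(\<Sum>h\<in>Hs a. act h w) = 0" if a: "a \<in> X" for a
    proof -
      have shift: "(\<Sum>h\<in>Hs a. act (h \<circ> transp a c) w) = (\<Sum>h\<in>Hs a. act h w)"
        if c: "c \<in> insert a Y" for c
      proof -
        have perm: "transp a c permutes X \<union> Y" using a c by (intro permutes_swap_id) auto
        have img: "(h \<circ> transp a c) ` insert a Y = h ` insert a Y" for h :: "'v \<Rightarrow> 'v"
          using c by (simp only: image_comp[symmetric], subst transpose_image_eq) auto
        have "h \<circ> transp a c \<in> Hs a" if "h \<in> Hs a" for h
        proof -
          have "B \<inter> (h \<circ> transp a c) ` insert a Y = {}" "h \<circ> transp a c permutes X \<union> Y"
            using that permutes_compose[OF perm] unfolding img Hs_def H_def by auto
          then show ?thesis unfolding Hs_def H_def by blast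
        qed
        moreover have "(h \<circ> transp a c) \<circ> transp a c = h" for h :: "'v \<Rightarrow> 'v"
          by (simp add: comp_assoc)
        ultimately show ?thesis
          by (intro sum.reindex_bij_witness[of _ "\<lambda>h. h \<circ> transp a c" "\<lambda>h. h \<circ> transp a c"]) auto
      qed
      have "0 = (\<Sum>h\<in>Hs a. act h (\<Sum>c\<in>insert a Y. act (transp a c) w))"
        using sum0[OF a] by simp
      also have "\<dots> = (\<Sum>h\<in>Hs a. \<Sum>c\<in>insert a Y. act (h \<circ> transp a c) w)"
      proof (rule sum.cong[OF refl])
        fix h assume "h \<in> Hs a"
        then have "bij h" using bijH unfolding Hs_def by simp
        then show "act h (\<Sum>c\<in>insert a Y. act (transp a c) w)
            = (\<Sum>c\<in>insert a Y. act (h \<circ> transp a c) w)"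
          unfolding act_sum by (intro sum.cong refl act_comp) auto
      qed
      also have "\<dots> = (\<Sum>c\<in>insert a Y. \<Sum>h\<in>Hs a. act h w)"
        unfolding sum.swap[of _ "insert a Y"] by (intro sum.cong refl shift)
      also have "\<dots> = scale (of_nat (card (insert a Y))) (\<Sum>h\<in>Hs a. act h w)"
        by (rule sum_constant_scale)
      finally show ?thesis
        using of_nat_nonzero[of "card (insert a Y)"] card_mono[of UNIV "insert a Y"]
        by (simp add: card_gt_0_iff)
    qed
    define HB where "HB = {h \<in> H. B \<inter> h ` Y = {}}"
    have finHB: "finite HB" using finH unfolding HB_def by simp
    have cnt: "card {a \<in> X. h \<in> Hs a} = card X - card B" if h: "h \<in> HB" for h
    proof -
      have perm: "h permutes X \<union> Y" using h unfolding HB_def H_def by simp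
      have BX: "B \<subseteq> h ` X"
      proof
        fix b assume "b \<in> B"
        then obtain x where x: "x \<in> X \<union> Y" "b = h x" using B permutes_image[OF perm] by blast
        then have "x \<notin> Y" using \<open>b \<in> B\<close> h unfolding HB_def by auto
        then show "b \<in> h ` X" using x by auto
      qed
      have "{a \<in> X. h \<in> Hs a} = {a \<in> X. h a \<notin> B}"
        using h unfolding HB_def Hs_def by auto
      also have "h ` \<dots> = h ` X - B" by auto
      then have "card {a \<in> X. h a \<notin> B} = card (h ` X - B)"
        using card_image[OF permutes_inj_on[OF perm], of "{a \<in> X. h a \<notin> B}"] by simp
      also have "\<dots> = card X - card B"
        using card_Diff_subset[of B "h ` X"] BX card_image[OF permutes_inj_on[OF perm], of X] by simp
      finally show ?thesis .
    qed
    have "0 = (\<Sum>a\<in>X. \<Sum>h\<in>Hs a. act h w)" using S0 by simp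
    also have "\<dots> = (\<Sum>a\<in>X. \<Sum>h\<in>HB. if h \<in> Hs a then act h w else 0)"
    proof (rule sum.cong[OF refl])
      fix a
      have "Hs a = {h \<in> HB. h \<in> Hs a}" unfolding Hs_def HB_def by auto
      then show "(\<Sum>h\<in>Hs a. act h w) = (\<Sum>h\<in>HB. if h \<in> Hs a then act h w else 0)"
        using sum.inter_filter[OF finHB, of "\<lambda>h. act h w" "\<lambda>h. h \<in> Hs a"] by simp
    qed
    also have "\<dots> = (\<Sum>h\<in>HB. \<Sum>a\<in>X. if h \<in> Hs a then act h w else 0)" by (rule sum.swap)
    also have "\<dots> = (\<Sum>h\<in>HB. scale (of_nat (card X - card B)) (act h w))"
    proof (rule sum.cong[OF refl])
      fix h assume "h \<in> HB"
      have "(\<Sum>a\<in>X. if h \<in> Hs a then act h w else 0) = (\<Sum>a\<in>{a \<in> X. h \<in> Hs a}. act h w)"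
        by (rule sum.inter_filter[symmetric]) simp
      then show "(\<Sum>a\<in>X. if h \<in> Hs a then act h w else 0)
          = scale (of_nat (card X - card B)) (act h w)"
        using cnt[OF \<open>h \<in> HB\<close>] sum_constant_scale[of "act h w" "{a \<in> X. h \<in> Hs a}"] by simp
    qed
    also have "\<dots> = scale (of_nat (card X - card B)) (G {} B)"
      unfolding G_def HB_def scale_sum_right by simp
    finally show ?thesis
      using of_nat_nonzero[of "card X - card B"] cardB card_mono[of UNIV X] by simp
  qed
  have G0: "G A B = 0" if "A \<union> B \<subseteq> Y" "finite A" for A B
    using that(2,1)
  proof (induction A arbitrary: B rule: finite_induct)
    case empty
    then show ?case using avoid by simp
  next
    case (insert c A)
    let ?P = "\<lambda>A B. {h \<in> H. A \<subseteq> h ` Y \<and> B \<inter> h ` Y = {}}"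
    have "?P A B = ?P (insert c A) B \<union> ?P A (insert c B)"
      "?P (insert c A) B \<inter> ?P A (insert c B) = {}" by auto
    then have "G A B = G (insert c A) B + G A (insert c B)"
      unfolding G_def using finH by (metis (no_types, lifting) finite_Un rev_finite_subset
          mem_Collect_eq subsetI sum.union_disjoint)
    then show ?case using insert.IH[of B] insert.IH[of "insert c B"] insert.prems by simp
  qed
  have "0 = G Y {}" using G0[of Y "{}"] by simp
  also have "\<dots> = (\<Sum>h\<in>{h \<in> H. Y \<subseteq> h ` Y}. w)"
    unfolding G_def
  proof (rule sum.cong)
    fix h assume "h \<in> {h \<in> H. Y \<subseteq> h ` Y}"
    then have perm: "h permutes X \<union> Y" and "Y \<subseteq> h ` Y" unfolding H_def by auto
    then have hY: "h ` Y = Y" by (metis card_image card_subset_eq finite permutes_inj_on)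
    have "m (h x) = m x" for x
    proof (cases "x \<in> Y")
      case True
      then have "h x \<in> Y" using hY by auto
      then show ?thesis using True XY by simp
    next
      case False
      then have "h x \<notin> Y" using hY permutes_inj[OF perm] by (metis image_iff injD)
      then show ?thesis
      proof (cases "x \<in> X")
        case True
        then have "h x \<in> X" using \<open>h x \<notin> Y\<close> permutes_in_image[OF perm, of x] by auto
        then show ?thesis using True XY by simp
      next
        assume "x \<notin> X"
        then show ?thesis using False permutes_not_in[OF perm, of x] by simp
      qed
    qed
    then show "act h w = w"
      by (intro act_label_preserving[OF permutes_bij[OF perm] _ w]) auto
  qed simp
  also have "\<dots> = scale (of_nat (card {h. h permutes (X \<union> Y) \<and> Y \<subseteq> h ` Y})) w"
    using sum_constant_scale[of w "{h \<in> H. Y \<subseteq> h ` Y}"] unfolding H_def by simp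
  also have "\<dots> = scale (of_nat (fact (card X)) * of_nat (fact (card Y))) w"
    unfolding card_permutes_preserving[OF disj] by simp
  finally show ?thesis
    using of_nat_fact_nonzero[of "card X"] of_nat_fact_nonzero[of "card Y"]
      card_mono[of UNIV X] card_mono[of UNIV Y] by simp
qed

text \<open>Moving a point from a larger orbit to a smaller one does not decrease the fixed space: summing over
  the cosets maps one fixed space injectively to the other. For the symmetric group this is the monotonicity
  of Kostka numbers in the dominance order.\<close>

lemma balancing:
  fixes m :: "'v \<Rightarrow> 'l"
  assumes K: "submod K" "fin_dim K"
    and a: "m a \<noteq> ly" "card {i. m i = ly} < card {i. m i = m a}"
  shows "dim (young_inv K m) \<le> dim (young_inv K (m(a := ly)))"
proof -
  define X where "X = {i. m i = m a}"
  define Y where "Y = {i. m i = ly}"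
  have aY: "a \<notin> Y" using a unfolding Y_def by simp
  define T where "T w = (\<Sum>c\<in>insert a Y. act (transp a c) w)" for w
  have T_lin: "Vector_Spaces.linear scale scale T"
    unfolding T_def by (intro linear_intro) (simp_all add: act_add act_scale sum.distrib scale_sum_right)
  have Ysw: "act (transp i j) w = w" if "w \<in> young_inv K m" "i \<in> Y" "j \<in> Y" for i j w
    using that unfolding young_inv_def Y_def by auto
  have T_in: "T w \<in> young_inv K (m(a := ly))" if w: "w \<in> young_inv K m" for w
  proof -
    have "T w \<in> K"
      unfolding T_def using w young_inv_subset[of K m] submodD[OF K(1)]
      by (intro subspace_sum) auto
    moreover have "act (transp i j) (T w) = T w"
      if ij: "(m(a := ly)) i = (m(a := ly)) j" for i j
    proof -
      have mem: "(i \<in> insert a Y) = ((m(a := ly)) i = ly)" for i unfolding Y_def by auto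
      show ?thesis
      proof (cases "i \<in> insert a Y")
        case True
        then have j: "j \<in> insert a Y" using ij mem by metis
        have "act (transp i j) (act (transp a c) w) = act (transp a (transp i j c)) w"
          if "c \<in> insert a Y" for c
        proof -
          have "transp i j \<circ> transp a c permutes insert a Y"
            using True j that by (intro permutes_compose permutes_swap_id) auto
          from act_coset[OF Ysw[OF w] this aY] show ?thesis
            using act_comp[of "transp i j" "transp a c" w] by simp
        qed
        then have "act (transp i j) (T w) = (\<Sum>c\<in>insert a Y. act (transp a (transp i j c)) w)"
          unfolding T_def act_sum by (intro sum.cong) auto
        also have "\<dots> = T w"
          unfolding T_def
          by (rule sum.reindex_bij_betw) (use True j in \<open>simp add: bij_betw_transpose_iff\<close>)
        finally show ?thesis .
      next
        case False
        then have j: "j \<notin> insert a Y" using ij mem by metis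
        then have "m i = m j" using False ij by auto
        then have fx: "act (transp i j) w = w" using w unfolding young_inv_def by auto
        have "act (transp i j) (act (transp a c) w) = act (transp a c) w" if "c \<in> insert a Y" for c
        proof -
          have "i \<noteq> a" "i \<noteq> c" "j \<noteq> a" "j \<noteq> c" using False j that by auto
          then have "transp a c i = i" "transp a c j = j" by (simp_all add: transpose_apply_other)
          then show ?thesis using transp_conj[of "transp a c" i j w] fx by simp
        qed
        then show ?thesis unfolding T_def act_sum by (intro sum.cong) auto
      qed
    qed
    ultimately show ?thesis unfolding young_inv_def by blast
  qed
  show ?thesis
  proof (rule dim_le_inj[OF T_lin subspace_young_inv[OF submodD(1)[OF K(1)]] _
        fin_dim_young_inv[OF K(2)] fin_dim_young_inv[OF K(2)]])
    show "T ` young_inv K m \<subseteq> young_inv K (m(a := ly))" using T_in by blast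
    fix w assume w: "w \<in> young_inv K m" "T w = 0"
    show "w = 0"
    proof (rule balancing_injective[OF w(1) X_def Y_def])
      show "m a \<noteq> ly" "card Y < card X" using a unfolding X_def Y_def by auto
      fix b assume b: "b \<in> X"
      then have fx: "act (transp a b) w = w" using w(1) unfolding X_def young_inv_def by auto
      have bY: "b \<notin> Y" using b a unfolding X_def Y_def by auto
      have "0 = act (transp a b) (T w)" using w(2) by simp
      also have "\<dots> = (\<Sum>c\<in>insert a Y. act (transp b (transp a b c)) w)"
        unfolding T_def act_sum
        using transp_conj[of "transp a b" a _ w] fx by (intro sum.cong) auto
      also have "\<dots> = act id w + (\<Sum>c\<in>Y. act (transp b (transp a b c)) w)"
        using aY by (simp add: transpose_same)
      also have "(\<Sum>c\<in>Y. act (transp b (transp a b c)) w) = (\<Sum>c\<in>Y. act (transp b c) w)"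
      proof (intro sum.cong refl)
        fix c assume "c \<in> Y"
        then have "c \<noteq> a" "c \<noteq> b" using aY bY by auto
        then show "act (transp b (transp a b c)) w = act (transp b c) w"
          by (simp add: transpose_apply_other)
      qed
      also have "act id w + \<dots> = (\<Sum>c\<in>insert b Y. act (transp b c) w)"
        using bY by (simp add: transpose_same)
      finally show "(\<Sum>c\<in>insert b Y. act (transp b c) w) = 0" by simp
    qed
  qed
qed


text \<open>If \<open>K\<close> has no vectors fixed by the stabiliser of a point, then \<open>cyclic_bound\<close> for the complement of
  a point already gives the bound for labellings with an isolated point. In general let \<open>a\<close> be a
  point of a largest fibre \<open>X\<close> and \<open>Y\<close> a smaller fibre. By \<open>balancing\<close>, moving \<open>a\<close> to \<open>Y\<close> does not
  decrease the fixed space. The fixed spaces before and after the move lie in that of the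
  partition in which \<open>a\<close> is isolated, and intersect in that of the partition in which \<open>X\<close> and \<open>Y\<close> are
  joined; the latter has one fibre fewer, and unless it has only one, its fibres again do not all have the
  same size, as \<open>X \<union> Y\<close> is larger than any other one.\<close>

lemma strong_bound:
  fixes m :: "'v \<Rightarrow> nat"
  assumes K: "submod K" "fin_dim K"
    and triv: "\<And>c w. w \<in> K \<Longrightarrow> (\<And>i j. i \<noteq> c \<Longrightarrow> j \<noteq> c \<Longrightarrow> act (transp i j) w = w) \<Longrightarrow> w = 0"
    and m: "card (range m) = 1 \<or> (\<exists>i j. card {x. m x = m i} \<noteq> card {x. m x = m j})"
  shows "(CARD('v) - 1) * dim (young_inv K m) \<le> (card (range m) - 1) * dim K"
  using m
proof (induction "card (range m)" arbitrary: m rule: less_induct)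
  case less
  note subK = submodD(1)[OF K(1)]
  let ?f = "\<lambda>m i. card {x. m x = m (i::'v)}"
  show ?case
  proof (cases "card (range m) = 1")
    case True
    then obtain l where "range m = {l}" by (auto simp: card_1_singleton_iff)
    then have "m i = m j" for i j by (metis rangeI singletonD)
    then have "young_inv K m \<subseteq> {0}" using triv unfolding young_inv_def by blast
    then have "dim (young_inv K m) = 0"
      using dim_mono_fin_dim[of "young_inv K m" "{0}"] dim_zero_space fin_dim_span[of "{}"] by simp
    then show ?thesis by simp
  next
    case False
    then obtain i j where ij: "?f m i \<noteq> ?f m j" using less.prems by blast
    obtain a where a: "?f m x \<le> ?f m a" for x
    proof -
      have "\<exists>a\<in>UNIV. \<forall>x\<in>UNIV. ?f m x \<le> ?f m a"
        using Max_in[of "range (?f m)"] Max_ge[of "range (?f m)"] by fastforce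
      then show ?thesis using that by blast
    qed
    obtain b where b: "?f m b < ?f m a" using ij a[of i] a[of j] by (metis le_neq_implies_less)
    define lx where "lx = m a"
    define ly where "ly = m b"
    have ne: "lx \<noteq> ly" using b unfolding lx_def ly_def by auto
    obtain fr where fr: "fr \<notin> range m" using ex_new_if_finite[of "range m"] infinite_UNIV_nat by auto
    \<comment> \<open>\<open>a\<close> moved, isolated, and its fibre joined with that of \<open>b\<close>\<close>
    define m1 where "m1 = m(a := ly)"
    define m2 where "m2 = m(a := fr)"
    define m3 where "m3 i = (if m i = lx then ly else m i)" for i
    have fa: "fr \<noteq> m i" for i using fr by auto
    have "{x. m x = m b} \<noteq> {}" by blast
    then have "0 < ?f m b" by (simp add: card_gt_0_iff)
    then have "1 < ?f m a" using b by simp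
    then have "\<not> {x. m x = m a} \<subseteq> {a}" using card_mono[of "{a}" "{x. m x = m a}"] by auto
    then obtain a' where a': "a' \<noteq> a" "m a' = m a" by blast
    have D1: "dim (young_inv K m) \<le> dim (young_inv K m1)"
      unfolding m1_def using ne b unfolding lx_def ly_def by (intro balancing K) auto
    have int: "young_inv K m \<inter> young_inv K m1 \<subseteq> young_inv K m3"
    proof
      fix w assume w: "w \<in> young_inv K m \<inter> young_inv K m1"
      have w1: "act (transp i j) w = w" if "m i = m j" for i j using w that unfolding young_inv_def by auto
      have w2: "act (transp i j) w = w" if "m1 i = m1 j" for i j using w that unfolding young_inv_def by auto
      have hub: "act (transp i a) w = w" if "m3 i = ly" for i
      proof (cases "m i = lx")
        case True
        then show ?thesis using w1 lx_def by simp
      next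
        case False
        then have "m i = ly" "i \<noteq> a" using that unfolding m3_def lx_def by auto
        then show ?thesis using w2[of i a] unfolding m1_def by simp
      qed
      have "act (transp i j) w = w" if "m3 i = m3 j" for i j
      proof (cases "m3 i = ly")
        case True
        then show ?thesis
          using hub[of i] hub[of j] that transp_fixed_trans[of i a w j] by (simp add: transpose_commute)
      next
        case False
        then have "m i = m j" using that unfolding m3_def by (auto split: if_splits)
        then show ?thesis by (rule w1)
      qed
      then show "w \<in> young_inv K m3" using w unfolding young_inv_def by blast
    qed
    have "young_inv K m \<subseteq> young_inv K m2" "young_inv K m1 \<subseteq> young_inv K m2"
      using fa by (auto intro!: young_inv_mono simp: m1_def m2_def split: if_splits; metis)+
    from dim_add_le[OF subspace_young_inv[OF subK] subspace_young_inv[OF subK]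
        subspace_young_inv[OF subK] this fin_dim_young_inv[OF K(2)]]
    have D2: "dim (young_inv K m) + dim (young_inv K m1) \<le> dim (young_inv K m2) + dim (young_inv K m3)"
      using dim_mono_fin_dim[OF int fin_dim_young_inv[OF K(2)]] by simp
    have "m2 ` (UNIV - {a}) \<subseteq> range m" unfolding m2_def by auto
    then have c2: "card (m2 ` (UNIV - {a})) \<le> card (range m)" by (intro card_mono) auto
    have "card (UNIV - {a}) * dim (young_inv K m2) \<le> card (m2 ` (UNIV - {a})) * dim K"
      by (rule cyclic_bound[OF K]) (use triv in blast)
    also have "\<dots> \<le> card (range m) * dim K" using c2 by simp
    finally have D3: "(CARD('v) - 1) * dim (young_inv K m2) \<le> card (range m) * dim K" by simp
    have "range m3 = range m - {lx}"
      using ne unfolding m3_def lx_def ly_def by (auto simp: image_iff; metis)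
    then have c3: "card (range m3) = card (range m) - 1" unfolding lx_def by simp
    have c1: "card (range m) \<ge> 2"
    proof -
      have "card {lx, ly} \<le> card (range m)" unfolding lx_def ly_def by (intro card_mono) auto
      then show ?thesis using ne by simp
    qed
    have D4: "(CARD('v) - 1) * dim (young_inv K m3) \<le> (card (range m3) - 1) * dim K"
    proof (rule less.hyps)
      show "card (range m3) < card (range m)" using c1 c3 by simp
      show "card (range m3) = 1 \<or> (\<exists>i j. ?f m3 i \<noteq> ?f m3 j)"
      proof (cases "card (range m3) = 1")
        case False
        have "\<not> range m \<subseteq> {lx, ly}"
          using False c1 c3 card_mono[of "{lx, ly}" "range m"] ne by auto
        then obtain z where z: "m z \<noteq> lx" "m z \<noteq> ly" by auto
        have "{x. m x = m a} \<subseteq> {x. m3 x = m3 a}" "b \<in> {x. m3 x = m3 a}" "b \<notin> {x. m x = m a}"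
          using ne unfolding m3_def lx_def ly_def by auto
        then have "{x. m x = m a} \<subset> {x. m3 x = m3 a}" by blast
        then have "?f m a < ?f m3 a" by (intro psubset_card_mono) auto
        moreover have "{x. m3 x = m3 z} = {x. m x = m z}" using z unfolding m3_def by auto
        then have "?f m3 z = ?f m z" by simp
        ultimately show ?thesis using a[of z] by (metis leD)
      qed simp
    qed
    have "(CARD('v) - 1) * (2 * dim (young_inv K m))
        \<le> (CARD('v) - 1) * (dim (young_inv K m2) + dim (young_inv K m3))"
      using D1 D2 by (intro mult_left_mono) auto
    also have "\<dots> \<le> card (range m) * dim K + (card (range m3) - 1) * dim K"
      using D3 D4 by (simp add: add_mult_distrib2)
    also have "\<dots> = 2 * ((card (range m) - 1) * dim K)"
    proof -
      obtain l where "card (range m) = l + 2" using c1 by (metis le_add_diff_inverse2)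
      then show ?thesis using c3 by (simp add: algebra_simps)
    qed
    finally show ?thesis by simp
  qed
qed

section \<open>Multiplicities\<close>

text \<open>The images \<open>W i\<close> of a vector fixed by the stabiliser of a point are indexed by the points. They sum
  to an invariant, which is zero, and have no other relations, so they span a copy of the standard
  representation; there the invariants of a Young subgroup are the combinations with coefficients constant on
  the orbits.\<close>

lemma standard_submod:
  assumes K: "submod K" and inv0: "\<And>w. w \<in> K \<Longrightarrow> (\<And>i j. act (transp i j) w = w) \<Longrightarrow> w = 0"
    and w: "w \<in> K" "w \<noteq> 0" "\<And>i j. i \<noteq> c \<Longrightarrow> j \<noteq> c \<Longrightarrow> act (transp i j) w = w"
  shows "\<exists>K0. submod K0 \<and> K0 \<subseteq> K \<and> fin_dim K0 \<and> CARD('v) - 1 \<le> dim K0 \<and>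
    (\<forall>m :: 'v \<Rightarrow> nat. dim (young_inv K0 m) \<le> card (range m) - 1)"
proof -
  define W where "W i = act (transp c i) w" for i
  have act_w: "act \<sigma> w = W (\<sigma> c)" if "bij \<sigma>" for \<sigma>
  proof -
    have "\<sigma> permutes insert c (UNIV - {c})" using that by (auto intro: bij_imp_permutes)
    then show ?thesis unfolding W_def by (rule act_coset[rotated]) (use w(3) in auto)
  qed
  have act_W: "act \<sigma> (W i) = W (\<sigma> i)" if "bij \<sigma>" for \<sigma> i
    unfolding W_def[of i] using act_comp[of \<sigma> "transp c i" w] act_w[of "\<sigma> \<circ> transp c i"] that
    by (simp add: bij_comp)
  have Wc: "W c = w" unfolding W_def using act_id by (simp add: id_def)
  define K0 where "K0 = span (range W)"
  have W_in: "W i \<in> K" for i unfolding W_def using submodD(2)[OF K] w(1) by simp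
  have sub: "K0 \<subseteq> K" unfolding K0_def using W_in submodD(1)[OF K] by (intro span_minimal) auto
  have mod: "submod K0"
  proof -
    have "act \<sigma> x \<in> K0" if "bij \<sigma>" "x \<in> K0" for \<sigma> x
      using that(2) unfolding K0_def
    proof (induction rule: span_induct_alt)
      case base
      then show ?case by (simp add: span_zero)
    next
      case (step a x y)
      then obtain i where "x = W i" by blast
      then have "act \<sigma> x \<in> span (range W)" using act_W[OF that(1), of i] span_base[of "W (\<sigma> i)"] by simp
      then show ?case unfolding act_add act_scale by (intro span_add span_scale step)
    qed
    moreover have "subspace K0" unfolding K0_def by (rule subspace_span)
    ultimately show ?thesis unfolding submod_def by blast
  qed
  have W_ne: "W i \<noteq> W j" if "i \<noteq> j" for i j
  proof
    assume eq: "W i = W j"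
    have all: "W i = W k" for k
    proof (cases "k = i")
      case False
      have "act (transp j k) (W i) = act (transp j k) (W j)" using eq by simp
      moreover have "transp j k i = i" using that False by (intro transpose_apply_other) auto
      ultimately show ?thesis using act_W[of "transp j k" i] act_W[of "transp j k" j] by simp
    qed simp
    have fixed: "act (transp x y) w = w" for x y
      using act_W[of "transp x y" c] Wc all[of c] all[of "transp x y c"] by simp
    have "w = 0" by (rule inv0[OF w(1) fixed])
    then show False using w(2) by simp
  qed
  then have injW: "inj W" unfolding inj_def by blast
  have sumW: "(\<Sum>i\<in>UNIV. W i) = 0"
  proof (rule inv0)
    show "(\<Sum>i\<in>UNIV. W i) \<in> K" using W_in submodD(1)[OF K] by (intro subspace_sum)
    fix i j
    have "act (transp i j) (\<Sum>i\<in>UNIV. W i) = (\<Sum>l\<in>UNIV. W (transp i j l))"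
      unfolding act_sum using act_W[of "transp i j"] by simp
    also have "\<dots> = (\<Sum>i\<in>UNIV. W i)" by (rule sum.reindex_bij_betw) simp
    finally show "act (transp i j) (\<Sum>i\<in>UNIV. W i) = (\<Sum>i\<in>UNIV. W i)" .
  qed
  have coeff: "u i = u j"
    if fx: "act (transp i j) (\<Sum>l\<in>UNIV. scale (u l) (W l)) = (\<Sum>l\<in>UNIV. scale (u l) (W l))" for u i j
  proof (rule ccontr)
    assume ne: "u i \<noteq> u j"
    then have ij: "i \<noteq> j" by auto
    have "act (transp i j) (\<Sum>l\<in>UNIV. scale (u l) (W l)) = (\<Sum>l\<in>UNIV. scale (u l) (W (transp i j l)))"
      unfolding act_sum act_scale using act_W[of "transp i j"] by simp
    then have "0 = (\<Sum>l\<in>UNIV. scale (u l) (W l)) - (\<Sum>l\<in>UNIV. scale (u l) (W (transp i j l)))"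
      using fx by simp
    also have "\<dots> = (\<Sum>l\<in>UNIV. scale (u l) (W l - W (transp i j l)))"
      by (simp add: sum_subtractf scale_right_diff_distrib)
    also have "\<dots> = (\<Sum>l\<in>{i, j}. scale (u l) (W l - W (transp i j l)))"
      by (rule sum.mono_neutral_right) (auto simp: transpose_apply_other)
    also have "\<dots> = scale (u i - u j) (W i - W j)"
      using ij by (simp add: algebra_simps scale_right_diff_distrib scale_left_diff_distrib)
    finally show False using ne W_ne[OF ij] by simp
  qed
  have fin: "fin_dim K0" unfolding K0_def by (rule fin_dim_span) simp
  have "independent (W ` (UNIV - {c}))"
  proof (rule independent_if_scalars_zero)
    fix f x assume f: "(\<Sum>x\<in>W ` (UNIV - {c}). scale (f x) x) = 0" and x: "x \<in> W ` (UNIV - {c})"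
    define u where "u l = (if l = c then 0 else f (W l))" for l
    have "(\<Sum>l\<in>UNIV. scale (u l) (W l)) = (\<Sum>l\<in>UNIV - {c}. scale (f (W l)) (W l))"
      by (rule sum.mono_neutral_cong_right) (auto simp: u_def)
    also have "\<dots> = (\<Sum>x\<in>W ` (UNIV - {c}). scale (f x) x)"
      by (rule sum.reindex_cong[OF inj_on_subset[OF injW subset_UNIV], symmetric]) auto
    finally have s0: "(\<Sum>l\<in>UNIV. scale (u l) (W l)) = 0" using f by (rule trans)
    have "u i = u c" for i by (rule coeff) (simp add: s0)
    then have "u i = 0" for i unfolding u_def by simp
    moreover obtain i where "x = W i" "i \<noteq> c" using x by blast
    ultimately show "f x = 0" unfolding u_def by metis
  qed simp
  moreover have "W ` (UNIV - {c}) \<subseteq> K0" unfolding K0_def by (auto intro: span_base)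
  ultimately have "card (W ` (UNIV - {c})) \<le> dim K0"
    using independent_fin_dim(2)[OF fin, of "W ` (UNIV - {c})"] by simp
  moreover have "card (W ` (UNIV - {c})) = CARD('v) - 1"
    using card_image[OF inj_on_subset[OF injW subset_UNIV], of "UNIV - {c}"] by simp
  ultimately have dimK0: "CARD('v) - 1 \<le> dim K0" by simp
  have "dim (young_inv K0 m) \<le> card (range m) - 1" for m :: "'v \<Rightarrow> nat"
  proof -
    define V where "V l = (\<Sum>i\<in>{i. m i = l}. W i)" for l
    define l0 where "l0 = m c"
    have V0: "(\<Sum>l\<in>range m. V l) = 0"
      unfolding V_def using sum.group[of UNIV "range m" m W] sumW by simp
    have "young_inv K0 m \<subseteq> span (V ` (range m - {l0}))"
    proof
      fix v assume v: "v \<in> young_inv K0 m"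
      then have "v \<in> span (range W)" unfolding young_inv_def K0_def by simp
      then obtain g where "v = (\<Sum>x\<in>range W. scale (g x) x)" by (auto simp: span_finite)
      then have vg: "v = (\<Sum>l\<in>UNIV. scale (g (W l)) (W l))"
        using sum.reindex[OF injW] by simp
      have g: "g (W i) = g (W j)" if "m i = m j" for i j
      proof (rule coeff[of i j "\<lambda>l. g (W l)"])
        show "act (transp i j) (\<Sum>l\<in>UNIV. scale (g (W l)) (W l)) = (\<Sum>l\<in>UNIV. scale (g (W l)) (W l))"
          using v that unfolding young_inv_def vg[symmetric] by blast
      qed
      define g' where "g' l = g (W (SOME i. m i = l))" for l
      have g': "g (W i) = g' (m i)" for i
        unfolding g'_def using someI[of "\<lambda>x. m x = m i" i] by (intro g) auto
      have "v = (\<Sum>l\<in>range m. \<Sum>i\<in>{i \<in> UNIV. m i = l}. scale (g (W i)) (W i))"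
        unfolding vg by (rule sum.group[symmetric]) auto
      also have "\<dots> = (\<Sum>l\<in>range m. scale (g' l) (V l))"
        unfolding V_def scale_sum_right g' by (intro sum.cong refl) auto
      also have "\<dots> = scale (g' l0) (V l0) + (\<Sum>l\<in>range m - {l0}. scale (g' l) (V l))"
        by (rule sum.remove) (auto simp: l0_def)
      finally have vv: "v = scale (g' l0) (V l0) + (\<Sum>l\<in>range m - {l0}. scale (g' l) (V l))" .
      have "V l0 = - (\<Sum>l\<in>range m - {l0}. V l)"
        using V0 sum.remove[of "range m" l0 V] by (simp add: l0_def eq_neg_iff_add_eq_0)
      moreover have "(\<Sum>l\<in>range m - {l0}. V l) \<in> span (V ` (range m - {l0}))"
        by (intro span_sum span_base) auto
      ultimately have "V l0 \<in> span (V ` (range m - {l0}))" using span_neg by simp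
      then show "v \<in> span (V ` (range m - {l0}))"
        unfolding vv by (intro span_add span_scale span_sum) (auto intro: span_base)
    qed
    then have "dim (young_inv K0 m) \<le> card (V ` (range m - {l0}))" by (rule dim_le_card) simp
    also have "\<dots> \<le> card (range m - {l0})" by (rule card_image_le) simp
    also have "\<dots> = card (range m) - 1" by (simp add: l0_def)
    finally show ?thesis .
  qed
  then show ?thesis using mod sub fin dimK0 by blast
qed

definition equivariant :: "('b \<Rightarrow> 'b) \<Rightarrow> bool" where
  "equivariant p \<longleftrightarrow> Vector_Spaces.linear scale scale p \<and> (\<forall>\<sigma> x. bij \<sigma> \<longrightarrow> p (act \<sigma> x) = act \<sigma> (p x))"

lemma card_bij: "card {\<sigma> :: 'v \<Rightarrow> 'v. bij \<sigma>} = fact CARD('v)"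
proof -
  have "{\<sigma> :: 'v \<Rightarrow> 'v. bij \<sigma>} = {\<sigma>. \<sigma> permutes UNIV}"
    by (auto intro: bij_imp_permutes permutes_bij)
  then show ?thesis using card_permutations[of "UNIV :: 'v set"] by simp
qed

text \<open>Averaging a linear projection over the group (Maschke).\<close>

lemma equivariant_projection_along:
  assumes S: "submod S" and T: "submod T" and ST: "S \<inter> T \<subseteq> {0}"
  shows "\<exists>p. equivariant p \<and> range p \<subseteq> S \<and> (\<forall>x\<in>S. p x = x) \<and> (\<forall>x\<in>T. p x = 0)"
proof -
  let ?G = "{\<sigma> :: 'v \<Rightarrow> 'v. bij \<sigma>}"
  obtain q where q: "Vector_Spaces.linear scale scale q" "range q \<subseteq> S" "\<And>x. x \<in> S \<Longrightarrow> q x = x"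
    "\<And>x. x \<in> T \<Longrightarrow> q x = 0"
    using linear_projection_along[OF submodD(1)[OF S] submodD(1)[OF T] ST] by blast
  define p where "p x = scale (inverse (of_nat (fact CARD('v))))
    (\<Sum>\<sigma>\<in>?G. act (Hilbert_Choice.inv \<sigma>) (q (act \<sigma> x)))" for x
  have qa: "q (x + y) = q x + q y" "q (scale c x) = scale c (q x)" for x y c
    using q(1) by (simp_all add: Vector_Spaces.linear_iff)
  have "Vector_Spaces.linear scale scale p"
    unfolding p_def
    by (intro linear_intro) (simp_all add: act_add act_scale qa sum.distrib scale_right_distrib
        scale_left_commute flip: scale_sum_right)
  moreover have "p (act \<tau> x) = act \<tau> (p x)" if \<tau>: "bij \<tau>" for \<tau> x
  proof -
    have "(\<Sum>\<sigma>\<in>?G. act (Hilbert_Choice.inv \<sigma>) (q (act \<sigma> (act \<tau> x))))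
        = (\<Sum>\<sigma>\<in>?G. act \<tau> (act (Hilbert_Choice.inv \<sigma>) (q (act \<sigma> x))))"
    proof (rule sum.reindex_bij_witness[of _ "\<lambda>\<sigma>. \<sigma> \<circ> Hilbert_Choice.inv \<tau>" "\<lambda>\<sigma>. \<sigma> \<circ> \<tau>"])
      fix \<sigma> :: "'v \<Rightarrow> 'v" assume "\<sigma> \<in> ?G"
      then have s: "bij \<sigma>" by simp
      have it: "Hilbert_Choice.inv \<tau> \<circ> \<tau> = id" "\<tau> \<circ> Hilbert_Choice.inv \<tau> = id"
        using \<tau> by (simp_all add: bij_is_inj[THEN inj_iff[THEN iffD1]] bij_is_surj[THEN surj_iff[THEN iffD1]])
      show "\<sigma> \<circ> \<tau> \<circ> Hilbert_Choice.inv \<tau> = \<sigma>" "\<sigma> \<circ> Hilbert_Choice.inv \<tau> \<circ> \<tau> = \<sigma>"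
        using it by (simp_all add: comp_assoc)
      show "\<sigma> \<circ> \<tau> \<in> ?G" "\<sigma> \<circ> Hilbert_Choice.inv \<tau> \<in> ?G"
        using s \<tau> by (simp_all add: bij_comp bij_imp_bij_inv)
      have "\<tau> \<circ> Hilbert_Choice.inv (\<sigma> \<circ> \<tau>) = Hilbert_Choice.inv \<sigma>"
        using o_inv_distrib[OF s \<tau>] it by (simp flip: comp_assoc)
      then show "act \<tau> (act (Hilbert_Choice.inv (\<sigma> \<circ> \<tau>)) (q (act (\<sigma> \<circ> \<tau>) x)))
          = act (Hilbert_Choice.inv \<sigma>) (q (act \<sigma> (act \<tau> x)))"
        using s \<tau> by (simp add: act_comp bij_comp bij_imp_bij_inv)
    qed
    then show ?thesis unfolding p_def by (simp add: act_scale act_sum)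
  qed
  ultimately have "equivariant p" unfolding equivariant_def by blast
  moreover have "range p \<subseteq> S"
    unfolding p_def using q(2) submodD[OF S]
    by (auto intro!: subspace_scale subspace_sum simp: bij_imp_bij_inv range_subsetD)
  moreover have "p x = x" if x: "x \<in> S" for x
  proof -
    have "(\<Sum>\<sigma>\<in>?G. act (Hilbert_Choice.inv \<sigma>) (q (act \<sigma> x))) = (\<Sum>\<sigma>\<in>?G. x)"
      using q(3) submodD(2)[OF S _ x] act_inv(2) by (intro sum.cong) auto
    also have "\<dots> = scale (of_nat (fact CARD('v))) x" using card_bij sum_constant_scale by metis
    finally show ?thesis unfolding p_def using fact_nonzero by simp
  qed
  moreover have "p x = 0" if x: "x \<in> T" for x
    unfolding p_def using q(4) submodD(2)[OF T _ x] by simp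
  ultimately show ?thesis by blast
qed

lemma equivariant_linear: "equivariant p \<Longrightarrow> Vector_Spaces.linear scale scale p"
  and equivariant_act: "equivariant p \<Longrightarrow> bij \<sigma> \<Longrightarrow> p (act \<sigma> x) = act \<sigma> (p x)"
  by (simp_all add: equivariant_def)

lemma equivariant_simps:
  assumes "equivariant p"
  shows "p (x + y) = p x + p y" "p (scale c x) = scale c (p x)" "p 0 = 0" "p (x - y) = p x - p y"
proof -
  interpret p: vector_space_pair scale scale by unfold_locales
  note lin = equivariant_linear[OF assms]
  show "p (x + y) = p x + p y" "p (scale c x) = scale c (p x)" "p 0 = 0" "p (x - y) = p x - p y"
    using p.linear_add[OF lin] p.linear_scale[OF lin] p.linear_0[OF lin] p.linear_diff[OF lin] by auto
qed

lemma submod_kernel: "equivariant p \<Longrightarrow> submod K \<Longrightarrow> submod {x \<in> K. p x = 0}"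
  unfolding submod_def subspace_def by (auto simp: equivariant_simps equivariant_act)

text \<open>Split off copies of the standard representation by complete reducibility, until there are no vectors
  fixed by the stabiliser of a point. Then the labelling \<open>p\<close>, with all points but one in one
  fibre, contributes nothing. This makes up for \<open>q\<close>, for which only the weaker bound with \<open>2\<close> in place of
  \<open>1\<close> is available if its two fibres have the same size.\<close>

lemma multiplicity_bound:
  fixes lab :: "'x \<Rightarrow> 'v \<Rightarrow> nat"
  assumes n: "CARD('v) \<ge> 2" and L: "finite L" "(\<Sum>x\<in>L. card (range (lab x)) - 1) \<le> r * (CARD('v) - 1)"
    and p: "p \<in> L" "card (range (lab p)) = 2" "\<And>i j. i \<noteq> c \<Longrightarrow> j \<noteq> c \<Longrightarrow> lab p i = lab p j"
    and q: "q \<in> L" "card (range (lab q)) = 2" "p \<noteq> q"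
    and others: "\<And>x. x \<in> L \<Longrightarrow> x \<noteq> p \<Longrightarrow> x \<noteq> q \<Longrightarrow>
      \<exists>i j. card {y. lab x y = lab x i} \<noteq> card {y. lab x y = lab x j}"
    and K: "submod K" "fin_dim K" "\<And>w. w \<in> K \<Longrightarrow> (\<And>i j. act (transp i j) w = w) \<Longrightarrow> w = 0"
  shows "(\<Sum>x\<in>L. dim (young_inv K (lab x))) \<le> r * dim K"
  using K
proof (induction "dim K" arbitrary: K rule: less_induct)
  case less
  note K = less.prems
  let ?n = "CARD('v) - 1"
  show ?case
  proof (cases "\<exists>c w. w \<in> K \<and> w \<noteq> 0 \<and> (\<forall>i j. i \<noteq> c \<longrightarrow> j \<noteq> c \<longrightarrow> act (transp i j) w = w)")
    case True
    then obtain c w where w: "w \<in> K" "w \<noteq> 0" "\<And>i j. i \<noteq> c \<Longrightarrow> j \<noteq> c \<Longrightarrow> act (transp i j) w = w"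
      by blast
    have "\<exists>K0. submod K0 \<and> K0 \<subseteq> K \<and> fin_dim K0 \<and> ?n \<le> dim K0 \<and>
        (\<forall>m :: 'v \<Rightarrow> nat. dim (young_inv K0 m) \<le> card (range m) - 1)"
      by (rule standard_submod[OF K(1) _ w]) (use K(3) in blast)
    then obtain K0 where K0: "submod K0" "K0 \<subseteq> K" "fin_dim K0" "?n \<le> dim K0"
      and D0: "\<And>m :: 'v \<Rightarrow> nat. dim (young_inv K0 m) \<le> card (range m) - 1"
      by blast
    have sub0: "submod {0}" unfolding submod_def by simp
    obtain p where p: "equivariant p" "range p \<subseteq> K0" "\<And>x. x \<in> K0 \<Longrightarrow> p x = x"
      using equivariant_projection_along[OF K0(1) sub0] by auto
    define K1 where "K1 = {x \<in> K. p x = 0}"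
    have K1: "submod K1" unfolding K1_def by (rule submod_kernel[OF p(1) K(1)])
    have fd1: "fin_dim K1" by (rule fin_dim_mono[OF _ K(2)]) (auto simp: K1_def)
    have "p ` K = K0" using p(2,3) K0(2) by force
    then have dimK: "dim K = dim K1 + dim K0"
      using rank_nullity_self(1)[OF equivariant_linear[OF p(1)] submodD(1)[OF K(1)] K(2)]
      unfolding K1_def by simp
    have D: "dim (young_inv K m) \<le> dim (young_inv K1 m) + dim (young_inv K0 m)" for m :: "'v \<Rightarrow> nat"
    proof -
      have "dim (young_inv K m)
          = dim {x \<in> young_inv K m. p x = 0} + dim (p ` young_inv K m)"
        by (intro rank_nullity_self equivariant_linear p subspace_young_inv submodD K fin_dim_young_inv)
      moreover have "{x \<in> young_inv K m. p x = 0} \<subseteq> young_inv K1 m"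
        unfolding young_inv_def K1_def by auto
      moreover have "p ` young_inv K m \<subseteq> young_inv K0 m"
        using p(2) equivariant_act[OF p(1), symmetric] unfolding young_inv_def
        by (auto simp: range_subsetD)
      ultimately show ?thesis
        using dim_mono_fin_dim[OF _ fin_dim_young_inv[OF fd1], of "{x \<in> young_inv K m. p x = 0}" m]
          dim_mono_fin_dim[OF _ fin_dim_young_inv[OF K0(3)], of "p ` young_inv K m" m]
        by linarith
    qed
    have "(\<Sum>x\<in>L. dim (young_inv K0 (lab x))) \<le> (\<Sum>x\<in>L. card (range (lab x)) - 1)"
      by (intro sum_mono D0)
    also have "\<dots> \<le> r * dim K0" using L(2) K0(4) by (meson le_trans mult_le_mono2)
    finally have 1: "(\<Sum>x\<in>L. dim (young_inv K0 (lab x))) \<le> r * dim K0" .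
    have 2: "(\<Sum>x\<in>L. dim (young_inv K1 (lab x))) \<le> r * dim K1"
      using dimK K0(4) n K(3) by (intro less.hyps K1 fd1) (auto simp: K1_def)
    have "(\<Sum>x\<in>L. dim (young_inv K (lab x)))
        \<le> (\<Sum>x\<in>L. dim (young_inv K1 (lab x))) + (\<Sum>x\<in>L. dim (young_inv K0 (lab x)))"
      unfolding sum.distrib[symmetric] by (intro sum_mono D)
    then show ?thesis using 1 2 dimK by (simp add: add_mult_distrib2)
  next
    case False
    then have triv: "w = 0" if "w \<in> K" "\<And>i j. i \<noteq> c \<Longrightarrow> j \<noteq> c \<Longrightarrow> act (transp i j) w = w" for c w
      using that by blast
    let ?D = "\<lambda>x. dim (young_inv K (lab x))"
    let ?e = "\<lambda>x. card (range (lab x)) - 1"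
    have "young_inv K (lab p) \<subseteq> {0}"
      using triv p(3) unfolding young_inv_def by blast
    then have Dp: "?D p = 0"
      using dim_mono_fin_dim[of "young_inv K (lab p)" "{0}"] dim_zero_space fin_dim_span[of "{}"] by simp
    have Dq: "?n * ?D q \<le> 2 * dim K"
    proof -
      have "card (UNIV - {c}) * ?D q \<le> card (lab q ` (UNIV - {c})) * dim K"
        by (rule cyclic_bound[OF K(1,2)]) (use triv in blast)
      also have "\<dots> \<le> 2 * dim K"
        using card_mono[of "range (lab q)" "lab q ` (UNIV - {c})"] q(2) by (intro mult_right_mono) auto
      finally show ?thesis by simp
    qed
    have Dx: "?n * ?D x \<le> ?e x * dim K" if "x \<in> L - {p} - {q}" for x
      using that others[of x] by (intro strong_bound[OF K(1,2) triv]) auto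
    have split: "(\<Sum>x\<in>L. g x) = g p + (g q + (\<Sum>x\<in>L - {p} - {q}. g x))" for g :: "'x \<Rightarrow> nat"
      using sum.remove[OF L(1) p(1), of g] sum.remove[of "L - {p}" q g] L(1) q by simp
    have "?n * (\<Sum>x\<in>L. ?D x) = ?n * ?D q + (\<Sum>x\<in>L - {p} - {q}. ?n * ?D x)"
      unfolding split[of ?D] using Dp by (simp add: algebra_simps sum_distrib_left)
    also have "\<dots> \<le> 2 * dim K + (\<Sum>x\<in>L - {p} - {q}. ?e x * dim K)"
      by (intro add_mono Dq sum_mono Dx)
    also have "\<dots> = (\<Sum>x\<in>L. ?e x) * dim K"
      unfolding split[of ?e] sum_distrib_right[symmetric] add_mult_distrib[symmetric]
      using p(2) q(2) add_mult_distrib by simp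
    also have "\<dots> \<le> r * ?n * dim K" using L(2) by (rule mult_right_mono) simp
    finally have "?n * (\<Sum>x\<in>L. ?D x) \<le> ?n * (r * dim K)" by (simp add: algebra_simps)
    then show ?thesis using n by simp
  qed
qed


section \<open>Generators\<close>

definition gen :: "nat \<Rightarrow> (nat \<Rightarrow> 'b) \<Rightarrow> 'b set" where
  "gen r f = span {act \<sigma> (f i) |\<sigma> i. bij \<sigma> \<and> i < r}"

definition invariants :: "'b set \<Rightarrow> 'b set" where
  "invariants V = {v \<in> V. \<forall>\<sigma>. bij \<sigma> \<longrightarrow> act \<sigma> v = v}"

lemma submod_gen: "submod (gen r f)"
proof -
  have "act \<sigma> x \<in> gen r f" if "bij \<sigma>" "x \<in> gen r f" for \<sigma> x
    using that(2) unfolding gen_def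
  proof (induction rule: span_induct_alt)
    case base
    then show ?case by (simp add: span_zero)
  next
    case (step c x y)
    then obtain \<tau> i where "x = act \<tau> (f i)" "bij \<tau>" "i < r" by blast
    then have "act \<sigma> x = act (\<sigma> \<circ> \<tau>) (f i)" "bij (\<sigma> \<circ> \<tau>)" "i < r"
      using that(1) by (simp_all add: act_comp bij_comp)
    then have "act \<sigma> x \<in> span {act \<sigma> (f i) |\<sigma> i. bij \<sigma> \<and> i < r}" by (intro span_base) blast
    then show ?case unfolding act_add act_scale by (intro span_add span_scale step)
  qed
  moreover have "subspace (gen r f)" unfolding gen_def by (rule subspace_span)
  ultimately show ?thesis unfolding submod_def by blast
qed

lemma gen_base: "i < r \<Longrightarrow> f i \<in> gen r f"
  unfolding gen_def using act_id[of "f i"] by (intro span_base) (metis (mono_tags, lifting) bij_id mem_Collect_eq)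

lemma gen_least:
  assumes "submod M" "\<And>i. i < r \<Longrightarrow> f i \<in> M"
  shows "gen r f \<subseteq> M"
  unfolding gen_def using assms submodD by (intro span_minimal) auto

lemma submod_invariants: "submod V \<Longrightarrow> submod (invariants V)"
proof -
  assume V: "submod V"
  have "subspace (invariants V)"
    using submodD(1)[OF V] unfolding invariants_def subspace_def by (simp add: act_add act_scale)
  then show ?thesis unfolding submod_def invariants_def by auto
qed

lemma submod_plus:
  assumes "submod S" "submod T"
  shows "submod {x + y |x y. x \<in> S \<and> y \<in> T}"
proof -
  have "act \<sigma> z \<in> {x + y |x y. x \<in> S \<and> y \<in> T}"
    if "bij \<sigma>" "z \<in> {x + y |x y. x \<in> S \<and> y \<in> T}" for \<sigma> z
    using that assms submodD(2) by (auto simp: act_add) blast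
  then show ?thesis using assms submodD(1) subspace_sums unfolding submod_def by blast
qed

text \<open>Functions vanishing outside of \<open>V\<close> stand for maps defined on \<open>V\<close>, so that these form a
  finite-dimensional space.\<close>

definition fscale :: "'k \<Rightarrow> ('b \<Rightarrow> 'b) \<Rightarrow> 'b \<Rightarrow> 'b" where
  "fscale c \<phi> = (\<lambda>x. scale c (\<phi> x))"

lemma fscale_space: "lin_space fscale"
  by unfold_locales (auto simp: fscale_def fun_eq_iff scale_right_distrib scale_left_distrib)

definition homs :: "'b set \<Rightarrow> 'b set \<Rightarrow> ('b \<Rightarrow> 'b) set" where
  "homs V K = {\<phi>. (\<forall>x\<in>V. \<phi> x \<in> K) \<and> (\<forall>x. x \<notin> V \<longrightarrow> \<phi> x = 0) \<and>
    (\<forall>x\<in>V. \<forall>y\<in>V. \<phi> (x + y) = \<phi> x + \<phi> y) \<and> (\<forall>c. \<forall>x\<in>V. \<phi> (scale c x) = scale c (\<phi> x)) \<and>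
    (\<forall>\<sigma>. bij \<sigma> \<longrightarrow> (\<forall>x\<in>V. \<phi> (act \<sigma> x) = act \<sigma> (\<phi> x)))}"

lemma homsD:
  assumes "\<phi> \<in> homs V K"
  shows "x \<in> V \<Longrightarrow> \<phi> x \<in> K" "x \<notin> V \<Longrightarrow> \<phi> x = 0"
    "x \<in> V \<Longrightarrow> y \<in> V \<Longrightarrow> \<phi> (x + y) = \<phi> x + \<phi> y"
    "x \<in> V \<Longrightarrow> \<phi> (scale c x) = scale c (\<phi> x)"
    "bij \<sigma> \<Longrightarrow> x \<in> V \<Longrightarrow> \<phi> (act \<sigma> x) = act \<sigma> (\<phi> x)"
  using assms unfolding homs_def by auto

lemma subspace_homs:
  assumes "subspace K"
  shows "module.subspace fscale {\<phi> \<in> homs V K. \<forall>x\<in>T. \<phi> x = 0}"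
proof -
  interpret fs: lin_space fscale by (rule fscale_space)
  show ?thesis
  proof (rule fs.subspaceI)
    show "0 \<in> {\<phi> \<in> homs V K. \<forall>x\<in>T. \<phi> x = 0}"
      using subspace_0[OF assms] unfolding homs_def by auto
    fix \<phi> \<psi> c assume "\<phi> \<in> {\<phi> \<in> homs V K. \<forall>x\<in>T. \<phi> x = 0}"
    then have \<phi>: "\<phi> \<in> homs V K" "\<forall>x\<in>T. \<phi> x = 0" by auto
    show "fscale c \<phi> \<in> {\<phi> \<in> homs V K. \<forall>x\<in>T. \<phi> x = 0}"
      using homsD[OF \<phi>(1)] \<phi>(2) subspace_scale[OF assms]
      unfolding homs_def fscale_def by (simp add: act_scale scale_right_distrib scale_left_commute)
    assume "\<psi> \<in> {\<phi> \<in> homs V K. \<forall>x\<in>T. \<phi> x = 0}"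
    then have \<psi>: "\<psi> \<in> homs V K" "\<forall>x\<in>T. \<psi> x = 0" by auto
    show "\<phi> + \<psi> \<in> {\<phi> \<in> homs V K. \<forall>x\<in>T. \<phi> x = 0}"
      using homsD[OF \<phi>(1)] homsD[OF \<psi>(1)] \<phi>(2) \<psi>(2) subspace_add[OF assms]
      unfolding homs_def by (simp add: act_add scale_right_distrib algebra_simps)
  qed
qed

lemma homs_of_equivariant:
  assumes V: "submod V" and q: "equivariant q" "\<And>x. x \<in> V \<Longrightarrow> q x \<in> K"
  shows "(\<lambda>x. if x \<in> V then q x else 0) \<in> homs V K"
  unfolding homs_def using submodD[OF V] q
  by (auto simp: equivariant_simps equivariant_act subspace_add subspace_scale)

text \<open>A homomorphism from \<open>V\<close> is determined by its values on the orbit representatives, and these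
  are invariant under the stabilisers.\<close>

lemma dim_homs_le:
  assumes V: "submod V" "V = span X" and R: "finite R" "R \<subseteq> V"
    and orb: "\<And>x. x \<in> X \<Longrightarrow> \<exists>\<sigma> y. bij \<sigma> \<and> y \<in> R \<and> x = act \<sigma> y"
    and lab: "\<And>x i j. x \<in> R \<Longrightarrow> lab x i = lab x j \<Longrightarrow> act (transp i j) x = x"
    and K: "submod K" "fin_dim K"
  shows "lin_space.fin_dim fscale (homs V K) \<and>
    vector_space.dim fscale (homs V K) \<le> (\<Sum>x\<in>R. dim (young_inv K (lab x)))"
proof -
  interpret fs: lin_space fscale by (rule fscale_space)
  define F where "F Q = {\<phi> \<in> homs V K. \<forall>x\<in>R - Q. \<phi> x = 0}" for Q
  have Fsub: "fs.subspace (F Q)" for Q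
    unfolding F_def by (rule subspace_homs[OF submodD(1)[OF K(1)]])
  have "fs.fin_dim (F Q) \<and> fs.dim (F Q) \<le> (\<Sum>x\<in>Q. dim (young_inv K (lab x)))" if "Q \<subseteq> R" for Q
    using finite_subset[OF that R(1)] that
  proof (induction Q rule: finite_induct)
    case empty
    have "\<phi> = 0" if "\<phi> \<in> F {}" for \<phi>
    proof
      have \<phi>: "\<phi> \<in> homs V K" "\<And>x. x \<in> R \<Longrightarrow> \<phi> x = 0" using that unfolding F_def by auto
      note h = homsD[OF \<phi>(1)]
      have "span X \<subseteq> {x \<in> V. \<phi> x = 0}"
      proof (rule span_minimal)
        show "X \<subseteq> {x \<in> V. \<phi> x = 0}"
        proof
          fix x assume x: "x \<in> X"
          then obtain \<sigma> y where "bij \<sigma>" "y \<in> R" "x = act \<sigma> y" using orb by blast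
          moreover have "x \<in> V" using V(2) x span_base by auto
          ultimately show "x \<in> {x \<in> V. \<phi> x = 0}" using h(5)[of \<sigma> y] \<phi>(2)[of y] R(2) by auto
        qed
        show "subspace {x \<in> V. \<phi> x = 0}"
        proof (rule subspaceI)
          show "0 \<in> {x \<in> V. \<phi> x = 0}"
            using subspace_0[OF submodD(1)[OF V(1)]] h(4)[of 0 0] by simp
        qed (use h subspace_add[OF submodD(1)[OF V(1)]] subspace_scale[OF submodD(1)[OF V(1)]] in auto)
      qed
      then show "\<phi> x = 0 x" for x using h(2)[of x] V(2) by (cases "x \<in> V") auto
    qed
    then have sub: "F {} \<subseteq> {0}" by blast
    have fd: "fs.fin_dim {0}" using fs.fin_dim_span[of "{}"] by simp
    have "fs.dim (F {}) \<le> 0" using fs.dim_mono_fin_dim[OF sub fd] fs.dim_zero_space by simp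
    then show ?case using fs.fin_dim_mono[OF sub fd] by simp
  next
    case (insert q Q)
    then have IH: "fs.fin_dim (F Q)" "fs.dim (F Q) \<le> (\<Sum>x\<in>Q. dim (young_inv K (lab x)))"
      and q: "q \<in> R" by auto
    have ker: "{\<phi> \<in> F (insert q Q). \<phi> q = 0} = F Q"
      using q insert.hyps(2) unfolding F_def by auto
    have im: "(\<lambda>\<phi>. \<phi> q) ` F (insert q Q) \<subseteq> young_inv K (lab q)"
    proof
      fix y assume "y \<in> (\<lambda>\<phi>. \<phi> q) ` F (insert q Q)"
      then obtain \<phi> where \<phi>: "\<phi> \<in> homs V K" "y = \<phi> q" unfolding F_def by blast
      have qV: "q \<in> V" using q R(2) by blast
      have "act (transp i j) y = y" if "lab q i = lab q j" for i j
        using homsD(5)[OF \<phi>(1) _ qV, of "transp i j"] lab[OF q that] \<phi>(2) by simp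
      then show "y \<in> young_inv K (lab q)"
        using homsD(1)[OF \<phi>(1) qV] \<phi>(2) unfolding young_inv_def by blast
    qed
    have lin: "Vector_Spaces.linear fscale scale (\<lambda>\<phi>. \<phi> q)"
      unfolding Vector_Spaces.linear_iff
      using fs.vector_space_axioms vector_space_axioms by (simp add: fscale_def)
    have fdim: "fin_dim ((\<lambda>\<phi>. \<phi> q) ` F (insert q Q))"
      using fin_dim_mono[OF im fin_dim_young_inv[OF K(2)]] .
    have "fs.fin_dim (F (insert q Q)) \<and> fs.dim (F (insert q Q))
        = fs.dim (F Q) + dim ((\<lambda>\<phi>. \<phi> q) ` F (insert q Q))"
      using rank_nullity[OF fscale_space lin_space_axioms lin Fsub[of "insert q Q"]] IH(1) fdim
      unfolding ker by blast
    moreover have "dim ((\<lambda>\<phi>. \<phi> q) ` F (insert q Q)) \<le> dim (young_inv K (lab q))"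
      by (rule dim_mono_fin_dim[OF im fin_dim_young_inv[OF K(2)]])
    ultimately show ?case using IH(2) insert.hyps by simp
  qed
  from this[of R] show ?thesis unfolding F_def by simp
qed

lemma equivariant_id: "equivariant (\<lambda>x. x)"
  unfolding equivariant_def by (simp add: linear_intro)

lemma equivariant_diff:
  assumes "equivariant p" "equivariant q"
  shows "equivariant (\<lambda>x. p x - q x)"
  unfolding equivariant_def
  using assms by (auto intro!: linear_intro simp: equivariant_simps equivariant_act act_diff scale_right_diff_distrib)

lemma equivariant_zero: "equivariant (\<lambda>x. 0)"
  unfolding equivariant_def by (auto intro: linear_intro)

text \<open>Choose \<open>r\<close> elements so that the submodule they generate, together with the invariants, is as
  large as possible, and let \<open>K\<close> be a complement. Perturbing the chosen elements by arbitrary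
  \<open>w i\<close> in \<open>K\<close> cannot enlarge the submodule; this forces a homomorphism to \<open>K\<close> with these values. As
  the projection to \<open>K\<close> kills all of the chosen elements, there would be too many homomorphisms.\<close>

lemma generators_modulo_invariants:
  assumes V: "submod V" "fin_dim V" "V = span X" and R: "finite R" "R \<subseteq> V"
    and orb: "\<And>x. x \<in> X \<Longrightarrow> \<exists>\<sigma> y. bij \<sigma> \<and> y \<in> R \<and> x = act \<sigma> y"
    and lab: "\<And>x i j. x \<in> R \<Longrightarrow> lab x i = lab x j \<Longrightarrow> act (transp i j) x = x"
    and bound: "\<And>K. submod K \<Longrightarrow> K \<subseteq> V \<Longrightarrow> K \<inter> invariants V \<subseteq> {0} \<Longrightarrow>
      (\<Sum>x\<in>R. dim (young_inv K (lab x))) \<le> r * dim K"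
  shows "\<exists>f. (\<forall>i<r. f i \<in> V) \<and> V = {x + y |x y. x \<in> gen r f \<and> y \<in> invariants V}"
proof -
  interpret fs: lin_space fscale by (rule fscale_space)
  let ?I = "invariants V"
  define C where "C f = {x + y |x y. x \<in> gen r f \<and> y \<in> ?I}" for f
  have Csub: "submod (C f)" for f
    unfolding C_def by (intro submod_plus submod_gen submod_invariants V)
  have gen_C: "gen r f \<subseteq> C f" for f
    using subspace_0[OF submodD(1)[OF submod_invariants[OF V(1)]]] unfolding C_def by force
  have I_C: "?I \<subseteq> C f" for f
    using subspace_0[OF submodD(1)[OF submod_gen]] unfolding C_def by force
  have C_least: "C f \<subseteq> S" if "subspace S" "gen r f \<subseteq> S" "?I \<subseteq> S" for f S
    using that subspace_add unfolding C_def by blast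
  have IV: "?I \<subseteq> V" unfolding invariants_def by blast
  have CV: "C f \<subseteq> V" if "\<forall>i<r. f i \<in> V" for f
    using that by (intro C_least submodD(1) V(1) gen_least IV) auto
  have Cfd: "fin_dim (C f)" if "\<forall>i<r. f i \<in> V" for f using CV[OF that] V(2) by (rule fin_dim_mono)
  obtain f where f: "\<forall>i<r. f i \<in> V"
    and max: "\<And>g. \<forall>i<r. g i \<in> V \<Longrightarrow> dim (C g) \<le> dim (C f)"
  proof -
    have "\<exists>f. (\<forall>i<r. f i \<in> V) \<and> (\<forall>g. (\<forall>i<r. g i \<in> V) \<longrightarrow> dim (C g) \<le> dim (C f))"
    proof -
      have zero: "\<forall>i<r. (\<lambda>_. 0) i \<in> V" using subspace_0[OF submodD(1)[OF V(1)]] by simp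
      have le: "\<forall>g. (\<forall>i<r. g i \<in> V) \<longrightarrow> dim (C g) < Suc (dim V)"
        unfolding less_Suc_eq_le using dim_mono_fin_dim[OF CV V(2)] by blast
      show ?thesis
        by (rule Lattices_Big.ex_has_greatest_nat[where P = "\<lambda>f. \<forall>i<r. f i \<in> V", OF zero le])
    qed
    then show ?thesis using that by blast
  qed
  have fC: "f i \<in> C f" if "i < r" for i using gen_base[OF that] gen_C by blast
  have "V \<subseteq> C f"
  proof (rule ccontr)
    assume neq: "\<not> V \<subseteq> C f"
    have sub0: "submod {0}" unfolding submod_def by simp
    obtain p where p: "equivariant p" "range p \<subseteq> C f" "\<And>x. x \<in> C f \<Longrightarrow> p x = x"
      using equivariant_projection_along[OF Csub[of f] sub0] by auto
    note pe = equivariant_simps[OF p(1)]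
    define K where "K = {x \<in> V. p x = 0}"
    have K: "submod K" "K \<subseteq> V" "fin_dim K"
      unfolding K_def using submod_kernel[OF p(1) V(1)] fin_dim_mono[OF _ V(2)] by auto
    have pV: "p x \<in> V" for x using p(2) CV[OF f] by auto
    have "K \<inter> ?I \<subseteq> {0}" using p(3) I_C[of f] unfolding K_def by auto
    then have bd: "(\<Sum>x\<in>R. dim (young_inv K (lab x))) \<le> r * dim K" by (rule bound[OF K(1,2)])
    define q0 where "q0 x = (if x \<in> V then x - p x else 0)" for x
    have q0: "q0 \<in> homs V K"
      unfolding q0_def
    proof (rule homs_of_equivariant[OF V(1)])
      show "equivariant (\<lambda>x. x - p x)" by (intro equivariant_diff equivariant_id p)
      show "x - p x \<in> K" if "x \<in> V" for x
        using that pV p(2,3) subspace_diff[OF submodD(1)[OF V(1)]] unfolding K_def by (simp add: pe range_subsetD)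
    qed
    have q0f: "q0 (f i) = 0" if "i < r" for i using p(3)[OF fC[OF that]] unfolding q0_def by simp
    obtain x0 where x0: "x0 \<in> V" "x0 \<notin> C f" using neq by blast
    then have "p x0 \<noteq> x0" using p(2) by (metis rangeI subsetD)
    then have "q0 x0 \<noteq> 0" using x0(1) unfolding q0_def by simp
    then have q0_ne: "q0 \<noteq> 0" by auto
    \<comment> \<open>The projection to \<open>C f\<close> maps \<open>C f'\<close> onto \<open>C f\<close>, so \<open>C f'\<close> has the same, maximal, dimension and
      meets \<open>K\<close> trivially. The projection to \<open>K\<close> along \<open>C f'\<close> then maps \<open>f i\<close> to \<open>- w i\<close>.\<close>
    have ext: "\<exists>\<phi>\<in>homs V K. \<forall>i<r. \<phi> (f i) = w i" if w: "\<And>i. i < r \<Longrightarrow> w i \<in> K" for w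
    proof -
      define f' where "f' i = f i + w i" for i
      have f': "\<forall>i<r. f' i \<in> V"
        using f w K(2) subspace_add[OF submodD(1)[OF V(1)]] unfolding f'_def by blast
      note lin = equivariant_linear[OF p(1)]
      interpret pp: vector_space_pair scale scale by unfold_locales
      have pf': "p (f' i) = f i" if "i < r" for i
        using w[OF that] p(3)[OF fC[OF that]] unfolding f'_def K_def by (simp add: pe)
      have "C f \<subseteq> p ` C f'"
      proof (rule C_least)
        show sub: "subspace (p ` C f')" by (rule pp.linear_subspace_image[OF lin submodD(1)[OF Csub]])
        have "act \<sigma> (f i) = p (act \<sigma> (f' i))" if "bij \<sigma>" "i < r" for \<sigma> i
          using equivariant_act[OF p(1) that(1)] pf'[OF that(2)] by simp
        moreover have "act \<sigma> (f' i) \<in> C f'" if "bij \<sigma>" "i < r" for \<sigma> i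
          using submodD(2)[OF Csub that(1)] gen_base[OF that(2), of f'] gen_C[of f'] by blast
        ultimately show "gen r f \<subseteq> p ` C f'" unfolding gen_def by (intro span_minimal sub) force
        show "?I \<subseteq> p ` C f'" using I_C[of f'] I_C[of f] p(3) by force
      qed
      then have "dim (C f) \<le> dim (p ` C f')"
        by (rule dim_mono_fin_dim) (rule rank_nullity_self(2)[OF lin submodD(1)[OF Csub] Cfd[OF f']])
      then have "dim {x \<in> C f'. p x = 0} = 0"
        using rank_nullity_self(1)[OF lin submodD(1)[OF Csub] Cfd[OF f']] max[OF f'] by simp
      then have "{x \<in> C f'. p x = 0} \<subseteq> {0}"
        by (intro dim_eq_0_fin_dim fin_dim_mono[OF _ Cfd[OF f']]) auto
      then have "K \<inter> C f' \<subseteq> {0}" unfolding K_def by auto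
      then obtain q where q: "equivariant q" "range q \<subseteq> K" "\<forall>x\<in>K. q x = x" "\<forall>x\<in>C f'. q x = 0"
        using equivariant_projection_along[OF K(1) Csub] by blast
      note qe = equivariant_simps[OF q(1)]
      define \<phi> where "\<phi> x = (if x \<in> V then 0 - q x else 0)" for x
      have "\<phi> \<in> homs V K"
        unfolding \<phi>_def
      proof (rule homs_of_equivariant[OF V(1)])
        show "equivariant (\<lambda>x. 0 - q x)" by (intro equivariant_diff equivariant_zero q)
        show "0 - q x \<in> K" for x
          using q(2) subspace_neg[OF submodD(1)[OF K(1)]] by (simp add: range_subsetD)
      qed
      moreover have "\<phi> (f i) = w i" if "i < r" for i
      proof -
        have "q (f' i) = 0" using q(4) gen_base[OF that, of f'] gen_C[of f'] by blast
        then have "q (f i) + w i = 0" using q(3) w[OF that] unfolding f'_def by (simp add: qe)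
        then have "q (f i) = - w i" by (simp add: eq_neg_iff_add_eq_0)
        then show ?thesis using f that unfolding \<phi>_def by simp
      qed
      ultimately show ?thesis by blast
    qed
    define E where "E j = {\<phi> \<in> homs V K. \<forall>x\<in>f ` {..<j}. \<phi> x = 0}" for j
    have Esub: "fs.subspace (E j)" for j
      unfolding E_def by (rule subspace_homs[OF submodD(1)[OF K(1)]])
    have hom: "fs.fin_dim (homs V K)" "fs.dim (homs V K) \<le> (\<Sum>x\<in>R. dim (young_inv K (lab x)))"
      using dim_homs_le[OF V(1,3) R orb lab K(1,3)] by auto
    have Efd: "fs.fin_dim (E j)" for j using hom(1) by (rule fs.fin_dim_mono[rotated]) (auto simp: E_def)
    have "fs.dim (E 0) = j * dim K + fs.dim (E j)" if "j \<le> r" for j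
      using that
    proof (induction j)
      case (Suc j)
      have lin: "Vector_Spaces.linear fscale scale (\<lambda>\<phi>. \<phi> (f j))"
        unfolding Vector_Spaces.linear_iff
        using fs.vector_space_axioms vector_space_axioms by (simp add: fscale_def)
      have ker: "{\<phi> \<in> E j. \<phi> (f j) = 0} = E (Suc j)"
        unfolding E_def by (auto simp: less_Suc_eq)
      have im: "(\<lambda>\<phi>. \<phi> (f j)) ` E j = K"
      proof
        show "(\<lambda>\<phi>. \<phi> (f j)) ` E j \<subseteq> K"
          using homsD(1) f Suc.prems unfolding E_def by auto
        show "K \<subseteq> (\<lambda>\<phi>. \<phi> (f j)) ` E j"
        proof
          fix k assume "k \<in> K"
          then have "\<exists>\<phi>\<in>homs V K. \<forall>i<r. \<phi> (f i) = (if i = j then k else 0)"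
            using subspace_0[OF submodD(1)[OF K(1)]] by (intro ext) simp
          then obtain \<phi> where \<phi>: "\<phi> \<in> homs V K" "\<forall>i<r. \<phi> (f i) = (if i = j then k else 0)"
            by blast
          then have "\<phi> \<in> E j" "\<phi> (f j) = k" using Suc.prems unfolding E_def by auto
          then show "k \<in> (\<lambda>\<phi>. \<phi> (f j)) ` E j" by blast
        qed
      qed
      have "fs.dim (E j) = fs.dim (E (Suc j)) + dim K"
        using rank_nullity[OF fscale_space lin_space_axioms lin Esub[of j]] Efd K(3)
        unfolding ker im by blast
      then show ?case using Suc by simp
    qed simp
    then have "fs.dim (homs V K) = r * dim K + fs.dim (E r)" unfolding E_def by simp
    moreover have "fs.dim (E r) \<noteq> 0"
    proof
      assume "fs.dim (E r) = 0"
      then have "E r \<subseteq> {0}" by (rule fs.dim_eq_0_fin_dim[OF Efd])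
      moreover have "q0 \<in> E r" using q0 q0f unfolding E_def by auto
      ultimately show False using q0_ne by blast
    qed
    ultimately show False using hom(2) bd by linarith
  qed
  then have "V = C f" using CV[OF f] by blast
  then show ?thesis using f unfolding C_def by blast
qed


text \<open>The projection to the invariants; the kernel of its restriction to \<open>V\<close> is the sum of the nontrivial
  irreducible submodules.\<close>

definition symmetrizer :: "'b \<Rightarrow> 'b" where
  "symmetrizer x = scale (inverse (of_nat (fact CARD('v)))) (\<Sum>\<sigma>\<in>{\<sigma>. bij \<sigma>}. act \<sigma> x)"

lemma symmetrizer_linear: "Vector_Spaces.linear scale scale symmetrizer"
  unfolding symmetrizer_def
  by (intro linear_intro) (simp_all add: act_add act_scale sum.distrib scale_right_distrib
      scale_left_commute flip: scale_sum_right)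

lemma symmetrizer_simps:
  "symmetrizer (x + y) = symmetrizer x + symmetrizer y" "symmetrizer (scale c x) = scale c (symmetrizer x)"
  "symmetrizer 0 = 0" "symmetrizer (x - y) = symmetrizer x - symmetrizer y"
proof -
  interpret p: vector_space_pair scale scale by unfold_locales
  note lin = symmetrizer_linear
  show "symmetrizer (x + y) = symmetrizer x + symmetrizer y"
    "symmetrizer (scale c x) = scale c (symmetrizer x)"
    "symmetrizer 0 = 0" "symmetrizer (x - y) = symmetrizer x - symmetrizer y"
    using p.linear_add[OF lin] p.linear_scale[OF lin] p.linear_0[OF lin] p.linear_diff[OF lin] by auto
qed

lemma bij_comp_bij_betw:
  assumes "bij \<tau>"
  shows "bij_betw (\<lambda>\<sigma> :: 'v \<Rightarrow> 'v. \<sigma> \<circ> \<tau>) {\<sigma>. bij \<sigma>} {\<sigma>. bij \<sigma>}"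
    "bij_betw (\<lambda>\<sigma> :: 'v \<Rightarrow> 'v. \<tau> \<circ> \<sigma>) {\<sigma>. bij \<sigma>} {\<sigma>. bij \<sigma>}"
proof -
  have it: "Hilbert_Choice.inv \<tau> \<circ> \<tau> = id" "\<tau> \<circ> Hilbert_Choice.inv \<tau> = id"
    using assms by (simp_all add: bij_is_inj[THEN inj_iff[THEN iffD1]] bij_is_surj[THEN surj_iff[THEN iffD1]])
  have ib: "bij (Hilbert_Choice.inv \<tau>)" using assms by (rule bij_imp_bij_inv)
  show "bij_betw (\<lambda>\<sigma> :: 'v \<Rightarrow> 'v. \<sigma> \<circ> \<tau>) {\<sigma>. bij \<sigma>} {\<sigma>. bij \<sigma>}"
    by (rule bij_betw_byWitness[where f' = "\<lambda>\<sigma>. \<sigma> \<circ> Hilbert_Choice.inv \<tau>"])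
      (use assms ib it in \<open>auto simp: comp_assoc bij_comp\<close>)
  show "bij_betw (\<lambda>\<sigma> :: 'v \<Rightarrow> 'v. \<tau> \<circ> \<sigma>) {\<sigma>. bij \<sigma>} {\<sigma>. bij \<sigma>}"
    by (rule bij_betw_byWitness[where f' = "\<lambda>\<sigma>. Hilbert_Choice.inv \<tau> \<circ> \<sigma>"])
      (use assms ib it in \<open>auto simp: bij_comp simp flip: comp_assoc\<close>)
qed

lemma symmetrizer_act:
  assumes "bij \<tau>"
  shows "symmetrizer (act \<tau> x) = symmetrizer x" "act \<tau> (symmetrizer x) = symmetrizer x"
proof -
  have "(\<Sum>\<sigma>\<in>{\<sigma>. bij \<sigma>}. act \<sigma> (act \<tau> x)) = (\<Sum>\<sigma>\<in>{\<sigma>. bij \<sigma>}. act (\<sigma> \<circ> \<tau>) x)"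
    using assms by (intro sum.cong) (auto simp: act_comp)
  also have "\<dots> = (\<Sum>\<sigma>\<in>{\<sigma>. bij \<sigma>}. act \<sigma> x)"
    by (rule sum.reindex_bij_betw[OF bij_comp_bij_betw(1)[OF assms]])
  finally show "symmetrizer (act \<tau> x) = symmetrizer x" unfolding symmetrizer_def by simp
  have "(\<Sum>\<sigma>\<in>{\<sigma>. bij \<sigma>}. act \<tau> (act \<sigma> x)) = (\<Sum>\<sigma>\<in>{\<sigma>. bij \<sigma>}. act (\<tau> \<circ> \<sigma>) x)"
    using assms by (intro sum.cong) (auto simp: act_comp)
  also have "\<dots> = (\<Sum>\<sigma>\<in>{\<sigma>. bij \<sigma>}. act \<sigma> x)"
    by (rule sum.reindex_bij_betw[OF bij_comp_bij_betw(2)[OF assms]])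
  finally show "act \<tau> (symmetrizer x) = symmetrizer x"
    unfolding symmetrizer_def by (simp add: act_scale act_sum)
qed

lemma symmetrizer_in: "submod M \<Longrightarrow> x \<in> M \<Longrightarrow> symmetrizer x \<in> M"
  unfolding symmetrizer_def using submodD by (intro subspace_scale subspace_sum) auto

lemma symmetrizer_invariant:
  assumes "\<And>\<sigma>. bij \<sigma> \<Longrightarrow> act \<sigma> x = x"
  shows "symmetrizer x = x"
proof -
  have "(\<Sum>\<sigma>\<in>{\<sigma>. bij \<sigma>}. act \<sigma> x) = (\<Sum>\<sigma>\<in>{\<sigma> :: 'v \<Rightarrow> 'v. bij \<sigma>}. x)"
    using assms by (intro sum.cong) auto
  also have "\<dots> = scale (of_nat (fact CARD('v))) x" using card_bij sum_constant_scale by metis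
  finally show ?thesis unfolding symmetrizer_def using fact_nonzero by simp
qed

lemma symmetrizer_range: "submod V \<Longrightarrow> symmetrizer ` V = invariants V"
proof
  assume V: "submod V"
  show "symmetrizer ` V \<subseteq> invariants V"
    using symmetrizer_in[OF V] symmetrizer_act(2) unfolding invariants_def by auto
  show "invariants V \<subseteq> symmetrizer ` V"
    using symmetrizer_invariant unfolding invariants_def by force
qed

definition reduced :: "'b set \<Rightarrow> 'b set" where
  "reduced V = {x \<in> V. symmetrizer x = 0}"

lemma reduced_minus: "submod V \<Longrightarrow> x \<in> V \<Longrightarrow> x - symmetrizer x \<in> reduced V"
  using symmetrizer_in[of V x] submodD(1)[of V] symmetrizer_invariant[OF symmetrizer_act(2), of x]
  unfolding reduced_def by (simp add: subspace_diff symmetrizer_simps)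

lemma dim_reduced:
  assumes "submod V" "fin_dim V"
  shows "dim V = dim (reduced V) + dim (symmetrizer ` V)"
  unfolding reduced_def
  by (rule rank_nullity_self(1)[OF symmetrizer_linear submodD(1)[OF assms(1)] assms(2)])

lemma subspace_reduced: "submod V \<Longrightarrow> subspace (reduced V)"
  using submodD(1) unfolding reduced_def subspace_def by (auto simp: symmetrizer_simps)

lemma symmetrizer_gen: "symmetrizer ` gen r f \<subseteq> span ((\<lambda>i. symmetrizer (f i)) ` {..<r})"
proof -
  interpret p: vector_space_pair scale scale by unfold_locales
  have "symmetrizer ` gen r f = span (symmetrizer ` {act \<sigma> (f i) |\<sigma> i. bij \<sigma> \<and> i < r})"
    unfolding gen_def by (rule p.linear_span_image[OF symmetrizer_linear, symmetric])
  also have "symmetrizer ` {act \<sigma> (f i) |\<sigma> i. bij \<sigma> \<and> i < r} \<subseteq> (\<lambda>i. symmetrizer (f i)) ` {..<r}"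
    using symmetrizer_act(1) by auto
  finally show ?thesis using span_mono by blast
qed

lemma dim_symmetrizer_gen: "dim (symmetrizer ` gen r f) \<le> r"
proof -
  have "dim (symmetrizer ` gen r f) \<le> card ((\<lambda>i. symmetrizer (f i)) ` {..<r})"
    by (rule dim_le_card[OF symmetrizer_gen]) simp
  also have "\<dots> \<le> r" using card_image_le[of "{..<r}"] by simp
  finally show ?thesis .
qed

text \<open>The symmetrizations of \<open>r\<close> generators span the symmetrization of the submodule.\<close>

lemma dim_gen_le:
  assumes V: "submod V" "fin_dim V" and f: "\<And>i. i < r \<Longrightarrow> f i \<in> V"
  shows "dim (gen r f) + dim (invariants V) \<le> dim V + r"
    and "\<not> reduced V \<subseteq> gen r f \<Longrightarrow> dim (gen r f) + dim (invariants V) < dim V + r"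
proof -
  have sub: "gen r f \<subseteq> V" using f by (intro gen_least V)
  then have fd: "fin_dim (gen r f)" using V(2) by (rule fin_dim_mono)
  have red: "reduced (gen r f) \<subseteq> reduced V" using sub unfolding reduced_def by blast
  have fdr: "fin_dim (reduced V)" using V(2) by (rule fin_dim_mono[rotated]) (auto simp: reduced_def)
  note d = dim_reduced[OF submod_gen fd] dim_reduced[OF V] symmetrizer_range[OF V(1)]
    dim_symmetrizer_gen[of r f] dim_mono_fin_dim[OF red fdr]
  then show "dim (gen r f) + dim (invariants V) \<le> dim V + r" by simp
  assume n: "\<not> reduced V \<subseteq> gen r f"
  have "dim (reduced (gen r f)) \<noteq> dim (reduced V)"
  proof
    assume "dim (reduced (gen r f)) = dim (reduced V)"
    then have "reduced (gen r f) = reduced V"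
      by (intro subspace_dim_eq_fin_dim[OF subspace_reduced[OF submod_gen] red fdr]) simp
    then show False using n unfolding reduced_def by blast
  qed
  then show "dim (gen r f) + dim (invariants V) < dim V + r" using d by simp
qed

text \<open>Replace the symmetrizations of the \<open>f i\<close> by a basis of an \<open>r\<close>-dimensional space of invariants that
  contains the symmetrizations of the \<open>g i\<close>. The new elements still generate the reduced part of \<open>V\<close>, as
  a submodule contains the symmetrization of each of its elements.\<close>

lemma extend_to_large:
  assumes V: "submod V" "fin_dim V" and r: "r \<le> dim (invariants V)"
    and f: "\<And>i. i < r \<Longrightarrow> f i \<in> V" "V = {x + y |x y. x \<in> gen r f \<and> y \<in> invariants V}"
    and g: "\<And>i. i < r \<Longrightarrow> g i \<in> V"
  shows "\<exists>h. (\<forall>i<r. h i \<in> V) \<and> gen r g \<subseteq> gen r h \<and> dim (gen r h) + dim (invariants V) = dim V + r \<and>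
    inj_on h {..<r} \<and> independent (h ` {..<r})"
proof -
  let ?I = "invariants V"
  have I: "submod ?I" "?I \<subseteq> V" using submod_invariants[OF V(1)] by (auto simp: invariants_def)
  have Ifd: "fin_dim ?I" using I(2) V(2) by (rule fin_dim_mono)
  have gV: "gen r g \<subseteq> V" using g by (intro gen_least V)
  have sgI: "symmetrizer ` gen r g \<subseteq> ?I" using gV symmetrizer_range[OF V(1)] by blast
  obtain B0 where B0: "B0 \<subseteq> symmetrizer ` gen r g" "independent B0" "symmetrizer ` gen r g \<subseteq> span B0"
      "card B0 = dim (symmetrizer ` gen r g)" "finite B0"
    using fin_dim_basis[OF fin_dim_mono[OF sgI Ifd]] by blast
  obtain B1 where B1: "B0 \<subseteq> B1" "B1 \<subseteq> ?I" "independent B1" "?I \<subseteq> span B1"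
    using maximal_independent_subset_extend[OF subset_trans[OF B0(1) sgI] B0(2)] by blast
  have finB1: "finite B1" by (rule independent_fin_dim(1)[OF Ifd B1(2,3)])
  have "card B1 = dim ?I" using B1 by (metis basis_card_eq_dim)
  then have "\<exists>B. B0 \<subseteq> B \<and> B \<subseteq> B1 \<and> card B = r"
    using B0(4) dim_symmetrizer_gen[of r g] r B1(1) finB1 by (intro exists_subset_between) auto
  then obtain B where B: "B0 \<subseteq> B" "B \<subseteq> B1" "card B = r" by blast
  have finB: "finite B" using B(2) finB1 by (rule finite_subset)
  have indB: "independent B" using B1(3) B(2) by (rule independent_mono)
  obtain b where b: "bij_betw b {..<r} B"
    using ex_bij_betw_nat_finite[OF finB] B(3) by (metis atLeast0LessThan)
  have bI: "b i \<in> ?I" if "i < r" for i using b that B(2) B1(2) unfolding bij_betw_def by blast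
  define h where "h i = (f i - symmetrizer (f i)) + b i" for i
  have sb: "symmetrizer (b i) = b i" if "i < r" for i
    using bI[OF that] symmetrizer_invariant unfolding invariants_def by blast
  have sh: "symmetrizer (h i) = b i" if "i < r" for i
    using sb[OF that] symmetrizer_invariant[OF symmetrizer_act(2), of "f i"]
    unfolding h_def by (simp add: symmetrizer_simps)
  have hV: "h i \<in> V" if "i < r" for i
    using reduced_minus[OF V(1) f(1)[OF that]] bI[OF that] I(2) subspace_add[OF submodD(1)[OF V(1)]]
    unfolding h_def reduced_def by blast
  let ?N = "gen r h"
  have N: "submod ?N" "?N \<subseteq> V" using submod_gen gen_least[OF V(1), of r h] hV by auto
  note subN = submodD(1)[OF N(1)]
  have Nfd: "fin_dim ?N" using N(2) V(2) by (rule fin_dim_mono)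
  have bN: "b i \<in> ?N" if "i < r" for i
    using symmetrizer_in[OF N(1) gen_base[OF that, of h]] sh[OF that] by simp
  have fN: "f i - symmetrizer (f i) \<in> ?N" if "i < r" for i
    using subspace_diff[OF subN gen_base[OF that, of h] bN[OF that]] unfolding h_def by simp
  have genN: "x - symmetrizer x \<in> ?N" if "x \<in> gen r f" for x
  proof -
    have "gen r f \<subseteq> {x. x - symmetrizer x \<in> ?N}"
    proof (rule gen_least)
      have "subspace {x. x - symmetrizer x \<in> ?N}"
      proof (rule subspaceI)
        show "0 \<in> {x. x - symmetrizer x \<in> ?N}" using subspace_0[OF subN] by (simp add: symmetrizer_simps)
      next
        fix x y assume "x \<in> {x. x - symmetrizer x \<in> ?N}" "y \<in> {x. x - symmetrizer x \<in> ?N}"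
        then have "(x - symmetrizer x) + (y - symmetrizer y) \<in> ?N" using subspace_add[OF subN] by blast
        then show "x + y \<in> {x. x - symmetrizer x \<in> ?N}" by (simp add: symmetrizer_simps algebra_simps)
      next
        fix c x assume "x \<in> {x. x - symmetrizer x \<in> ?N}"
        then have "scale c (x - symmetrizer x) \<in> ?N" using subspace_scale[OF subN] by blast
        then show "scale c x \<in> {x. x - symmetrizer x \<in> ?N}"
          by (simp add: symmetrizer_simps scale_right_diff_distrib)
      qed
      moreover have "act \<sigma> x - symmetrizer (act \<sigma> x) \<in> ?N" if "bij \<sigma>" "x - symmetrizer x \<in> ?N" for \<sigma> x
        using submodD(2)[OF N(1) that] symmetrizer_act[OF that(1), of x] by (simp add: act_diff)
      ultimately show "submod {x. x - symmetrizer x \<in> ?N}" unfolding submod_def by blast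
    qed (use fN in auto)
    then show ?thesis using that by blast
  qed
  have redN: "reduced V \<subseteq> ?N"
  proof
    fix v assume v: "v \<in> reduced V"
    then obtain x y where xy: "v = x + y" "x \<in> gen r f" "y \<in> ?I" using f(2) unfolding reduced_def by blast
    have "symmetrizer y = y" using xy(3) symmetrizer_invariant unfolding invariants_def by blast
    then have "v = x - symmetrizer x" using v xy(1) unfolding reduced_def
      by (simp add: symmetrizer_simps eq_neg_iff_add_eq_0 add.commute)
    then show "v \<in> ?N" using genN[OF xy(2)] by simp
  qed
  have sN: "symmetrizer ` ?N = span B"
  proof
    have "(\<lambda>i. symmetrizer (h i)) ` {..<r} \<subseteq> B" using sh b unfolding bij_betw_def by auto
    then show "symmetrizer ` ?N \<subseteq> span B" using symmetrizer_gen[of r h] span_mono by blast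
    have "subspace (symmetrizer ` ?N)"
    proof -
      interpret p: vector_space_pair scale scale by unfold_locales
      show ?thesis by (rule p.linear_subspace_image[OF symmetrizer_linear subN])
    qed
    moreover have "B \<subseteq> symmetrizer ` ?N"
    proof
      fix y assume "y \<in> B"
      then obtain i where "i < r" "y = b i" using b unfolding bij_betw_def by auto
      then show "y \<in> symmetrizer ` ?N" using sh[of i] gen_base[of i r h] by force
    qed
    ultimately show "span B \<subseteq> symmetrizer ` ?N" by (intro span_minimal)
  qed
  have "reduced ?N = reduced V" using redN N(2) unfolding reduced_def by blast
  then have "dim ?N = dim (reduced V) + r"
    using dim_reduced[OF N(1) Nfd] sN dim_span_eq_card_independent[OF indB] B(3) by simp
  then have "dim ?N + dim ?I = dim V + r"
    using dim_reduced[OF V] symmetrizer_range[OF V(1)] by simp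
  moreover have "gen r g \<subseteq> ?N"
  proof
    fix x assume x: "x \<in> gen r g"
    have "x - symmetrizer x \<in> ?N" using redN reduced_minus[OF V(1)] x gV by blast
    moreover have "symmetrizer x \<in> ?N"
    proof -
      have "symmetrizer x \<in> span B" using x B0(3) span_mono[OF B(1)] by blast
      moreover have "B \<subseteq> ?N" using bN b unfolding bij_betw_def by blast
      then have "span B \<subseteq> ?N" by (rule span_minimal[OF _ subN])
      ultimately show ?thesis by blast
    qed
    ultimately have "(x - symmetrizer x) + symmetrizer x \<in> ?N" by (rule subspace_add[OF subN])
    then show "x \<in> ?N" by simp
  qed
  moreover have injh: "inj_on h {..<r}"
  proof (rule inj_onI)
    fix i j assume "i \<in> {..<r}" "j \<in> {..<r}" "h i = h j"
    then have "b i = b j" using sh[of i] sh[of j] by simp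
    then show "i = j" using b \<open>i \<in> _\<close> \<open>j \<in> _\<close> unfolding bij_betw_def inj_on_def by blast
  qed
  moreover have "independent (h ` {..<r})"
  proof (rule independent_if_scalars_zero)
    fix u x assume u: "(\<Sum>x\<in>h ` {..<r}. scale (u x) x) = 0" and x: "x \<in> h ` {..<r}"
    interpret p: vector_space_pair scale scale by unfold_locales
    have "0 = (\<Sum>i<r. scale (u (h i)) (h i))" using u sum.reindex[OF injh, of "\<lambda>x. scale (u x) x"] by simp
    then have "0 = symmetrizer (\<Sum>i<r. scale (u (h i)) (h i))" by (metis symmetrizer_simps(3))
    also have "\<dots> = (\<Sum>i<r. scale (u (h i)) (b i))"
      unfolding p.linear_sum[OF symmetrizer_linear] using sh by (intro sum.cong) (auto simp: symmetrizer_simps)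
    also have "\<dots> = (\<Sum>y\<in>B. scale (u (h (the_inv_into {..<r} b y))) y)"
      using b the_inv_into_f_f[of b "{..<r}"] unfolding bij_betw_def
      by (intro sum.reindex_cong[of b "{..<r}", symmetric]) auto
    finally have z: "(\<Sum>y\<in>B. scale (u (h (the_inv_into {..<r} b y))) y) = 0" by simp
    obtain i where i: "i < r" "x = h i" using x by auto
    have "u (h (the_inv_into {..<r} b (b i))) = 0"
      using independentD[OF indB finB subset_refl z, of "b i"] i b unfolding bij_betw_def by blast
    then show "u x = 0" using i b the_inv_into_f_f[of b "{..<r}" i] unfolding bij_betw_def by simp
  qed simp
  ultimately show ?thesis using hV by blast
qed

end

section \<open>Polynomials and permutations of the variables\<close>

abbreviation lk :: "('a \<Rightarrow>\<^sub>0 'b::zero) \<Rightarrow> 'a \<Rightarrow> 'b" where "lk \<equiv> Poly_Mapping.lookup"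

lemma lookup_mscale: "lk (mscale c p) m = c * lk p m"
proof -
  have "mscale c p = Poly_Mapping.map ((*) c) p"
    unfolding mscale_def mconst_def by (rule mult_map_scale_conv_mult[symmetric])
  then show ?thesis by (simp add: Poly_Mapping.map.rep_eq when_def)
qed

lemma poly_mapping_sum_single:
  fixes p :: "'a \<Rightarrow>\<^sub>0 'b::comm_monoid_add"
  assumes "finite S" "Poly_Mapping.keys p \<subseteq> S"
  shows "p = (\<Sum>m\<in>S. Poly_Mapping.single m (lk p m))"
proof (rule poly_mapping_eqI)
  fix k
  have "lk (\<Sum>m\<in>S. Poly_Mapping.single m (lk p m)) k = (\<Sum>m\<in>S. if m = k then lk p m else 0)"
    by (simp add: lookup_sum lookup_single when_def)
  also have "\<dots> = lk p k" using assms by (auto simp: sum.delta' in_keys_iff)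
  finally show "lk p k = lk (\<Sum>m\<in>S. Poly_Mapping.single m (lk p m)) k" by simp
qed

definition mono_eval :: "('v \<Rightarrow> 'r) \<Rightarrow> ('v \<Rightarrow>\<^sub>0 nat) \<Rightarrow> 'r::comm_ring_1" where
  "mono_eval x m = (\<Prod>v\<in>Poly_Mapping.keys m. x v ^ lk m v)"

lemma mono_eval_superset:
  "finite S \<Longrightarrow> Poly_Mapping.keys m \<subseteq> S \<Longrightarrow> mono_eval x m = (\<Prod>v\<in>S. x v ^ lk m v)"
  unfolding mono_eval_def by (rule prod.mono_neutral_left) (auto simp: in_keys_iff)

lemma mono_eval_add: "mono_eval x (m + m') = mono_eval x m * mono_eval x m'"
proof -
  let ?S = "Poly_Mapping.keys m \<union> Poly_Mapping.keys m'"
  have "mono_eval x (m + m') = (\<Prod>v\<in>?S. x v ^ lk (m + m') v)"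
    using Poly_Mapping.keys_add[of m m'] by (intro mono_eval_superset) auto
  also have "\<dots> = (\<Prod>v\<in>?S. x v ^ lk m v) * (\<Prod>v\<in>?S. x v ^ lk m' v)"
    by (simp add: lookup_add power_add prod.distrib)
  also have "\<dots> = mono_eval x m * mono_eval x m'"
    by (simp add: mono_eval_superset[of ?S])
  finally show ?thesis .
qed

lemma msubst_superset:
  assumes "finite S" "Poly_Mapping.keys p \<subseteq> S" "h 0 = 0"
  shows "msubst h x p = (\<Sum>m\<in>S. h (lk p m) * mono_eval x m)"
  unfolding msubst_def mono_eval_def[symmetric]
  using assms by (intro sum.mono_neutral_left) (auto simp: in_keys_iff)

lemma msubst_add:
  assumes "h 0 = 0" "\<And>a b. h (a + b) = h a + h b"
  shows "msubst h x (p + q) = msubst h x p + msubst h x q"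
proof -
  let ?S = "Poly_Mapping.keys p \<union> Poly_Mapping.keys q"
  have "msubst h x (p + q) = (\<Sum>m\<in>?S. h (lk (p + q) m) * mono_eval x m)"
    using Poly_Mapping.keys_add[of p q] by (intro msubst_superset assms) auto
  also have "\<dots> = (\<Sum>m\<in>?S. h (lk p m) * mono_eval x m) + (\<Sum>m\<in>?S. h (lk q m) * mono_eval x m)"
    by (simp add: lookup_add assms distrib_right sum.distrib)
  also have "\<dots> = msubst h x p + msubst h x q"
    by (simp add: msubst_superset[of ?S] assms)
  finally show ?thesis .
qed

lemma msubst_single: "h 0 = 0 \<Longrightarrow> msubst h x (Poly_Mapping.single m c) = h c * mono_eval x m"
  by (subst msubst_superset[of "{m}"]) auto

lemma msubst_sum:
  assumes "h 0 = 0" "\<And>a b. h (a + b) = h a + h b"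
  shows "msubst h x (\<Sum>a\<in>S. f a) = (\<Sum>a\<in>S. msubst h x (f a))"
proof (induction S rule: infinite_finite_induct)
  case (insert a S)
  then show ?case using msubst_add[of h x, OF assms] by simp
qed (simp_all add: msubst_def)

lemma msubst_mult:
  assumes h: "h 0 = 0" "\<And>a b. h (a + b) = h a + h b" "\<And>a b. h (a * b) = h a * h b"
  shows "msubst h x (p * q) = msubst h x p * msubst h x q"
proof -
  let ?P = "Poly_Mapping.keys p" and ?Q = "Poly_Mapping.keys q"
  have pq: "p = (\<Sum>m\<in>?P. Poly_Mapping.single m (lk p m))" "q = (\<Sum>m\<in>?Q. Poly_Mapping.single m (lk q m))"
    by (rule poly_mapping_sum_single; simp)+
  have "p * q = (\<Sum>m\<in>?P. Poly_Mapping.single m (lk p m)) * (\<Sum>m\<in>?Q. Poly_Mapping.single m (lk q m))"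
    using pq by metis
  also have "\<dots> = (\<Sum>a\<in>?P. \<Sum>b\<in>?Q. Poly_Mapping.single (a + b) (lk p a * lk q b))"
    by (simp add: sum_product mult_single)
  finally have "msubst h x (p * q) = (\<Sum>a\<in>?P. \<Sum>b\<in>?Q. h (lk p a * lk q b) * mono_eval x (a + b))"
    by (simp add: msubst_sum h msubst_single)
  also have "\<dots> = (\<Sum>a\<in>?P. \<Sum>b\<in>?Q. (h (lk p a) * mono_eval x a) * (h (lk q b) * mono_eval x b))"
    by (simp add: h mono_eval_add algebra_simps)
  also have "\<dots> = (\<Sum>a\<in>?P. h (lk p a) * mono_eval x a) * (\<Sum>b\<in>?Q. h (lk q b) * mono_eval x b)"
    by (simp add: sum_product)
  also have "\<dots> = msubst h x p * msubst h x q"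
    unfolding msubst_def mono_eval_def ..
  finally show ?thesis .
qed

lemma mdeg_superset:
  "finite S \<Longrightarrow> Poly_Mapping.keys m \<subseteq> S \<Longrightarrow> mdeg m = (\<Sum>v\<in>S. lk m v)"
  unfolding mdeg_def by (rule sum.mono_neutral_left) (auto simp: in_keys_iff)

lemma mdeg_UNIV: "mdeg (m :: 'v::finite \<Rightarrow>\<^sub>0 nat) = (\<Sum>v\<in>UNIV. lk m v)"
  by (rule mdeg_superset) auto

lemma mdeg_add: "mdeg (m + m') = mdeg m + mdeg m'"
proof -
  let ?S = "Poly_Mapping.keys m \<union> Poly_Mapping.keys m'"
  have "mdeg (m + m') = (\<Sum>v\<in>?S. lk (m + m') v)"
    using Poly_Mapping.keys_add[of m m'] by (intro mdeg_superset) auto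
  also have "\<dots> = mdeg m + mdeg m'"
    by (simp add: lookup_add sum.distrib mdeg_superset[of ?S])
  finally show ?thesis .
qed

lemma homog_iff: "p \<in> homog d \<longleftrightarrow> (\<forall>m. lk p m \<noteq> 0 \<longrightarrow> mdeg m = d)"
  unfolding homog_def by (auto simp: in_keys_iff)

lemma homog_add: "p \<in> homog d \<Longrightarrow> q \<in> homog d \<Longrightarrow> p + q \<in> homog d"
proof -
  assume pq: "p \<in> homog d" "q \<in> homog d"
  have "mdeg m = d" if "lk (p + q) m \<noteq> 0" for m
  proof -
    have "lk p m \<noteq> 0 \<or> lk q m \<noteq> 0" using that by (auto simp: lookup_add)
    then show ?thesis using pq unfolding homog_iff by blast
  qed
  then show ?thesis unfolding homog_iff by blast
qed

lemma homog_0: "0 \<in> homog d"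
  unfolding homog_iff by simp

lemma homog_sum: "(\<And>a. a \<in> S \<Longrightarrow> f a \<in> homog d) \<Longrightarrow> (\<Sum>a\<in>S. f a) \<in> homog d"
  by (induction S rule: infinite_finite_induct) (auto intro: homog_add homog_0)

lemma homog_mult:
  fixes p q :: "('v, 'k::comm_ring_1) mpoly"
  assumes "p \<in> homog a" "q \<in> homog b"
  shows "p * q \<in> homog (a + b)"
proof -
  have "mdeg m = a + b" if m: "m \<in> Poly_Mapping.keys (p * q)" for m
  proof -
    obtain k l where "m = k + l" "k \<in> Poly_Mapping.keys p" "l \<in> Poly_Mapping.keys q"
      using m Poly_Mapping.keys_mult[of p q] by blast
    then show ?thesis using assms by (auto simp: homog_def mdeg_add)
  qed
  then show ?thesis unfolding homog_def by blast
qed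

lemma homog_1: "1 \<in> homog 0"
  unfolding homog_iff by (simp add: lookup_one when_def mdeg_def)

lemma homog_prod: "finite S \<Longrightarrow> (\<And>a. a \<in> S \<Longrightarrow> f a \<in> homog 1) \<Longrightarrow> (\<Prod>a\<in>S. f a) \<in> homog (card S)"
proof (induction S rule: finite_induct)
  case (insert a S)
  then have "f a * (\<Prod>a\<in>S. f a) \<in> homog (1 + card S)" by (intro homog_mult) auto
  then show ?case using insert by simp
qed (simp add: homog_1)

lemma homog_mvar: "mvar v \<in> homog 1"
  unfolding homog_iff mvar_def by (auto simp: lookup_single when_def mdeg_def split: if_splits)

definition mcomp :: "('v::finite \<Rightarrow>\<^sub>0 nat) \<Rightarrow> ('v \<Rightarrow> 'v) \<Rightarrow> ('v \<Rightarrow>\<^sub>0 nat)" where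
  "mcomp m \<sigma> = Abs_poly_mapping (\<lambda>v. lk m (\<sigma> v))"

lemma lookup_mcomp: "lk (mcomp m \<sigma>) v = lk m (\<sigma> v)"
  unfolding mcomp_def by simp

lemma mcomp_mcomp: "mcomp (mcomp m \<sigma>) \<tau> = mcomp m (\<sigma> \<circ> \<tau>)"
  by (rule poly_mapping_eqI) (simp add: lookup_mcomp)

lemma mcomp_id: "mcomp m id = m"
  by (rule poly_mapping_eqI) (simp add: lookup_mcomp)

lemma mdeg_mcomp: "bij \<sigma> \<Longrightarrow> mdeg (mcomp m \<sigma>) = mdeg m"
  unfolding mdeg_UNIV lookup_mcomp by (rule sum.reindex_bij_betw) simp

lemma mono_eval_mvar:
  assumes "bij (\<sigma> :: 'v::finite \<Rightarrow> 'v)"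
  shows "mono_eval (\<lambda>v. mvar (\<sigma> v)) m = (Poly_Mapping.single (mcomp m (Hilbert_Choice.inv \<sigma>)) 1 :: ('v, 'k::comm_ring_1) mpoly)"
proof -
  have pow: "mvar u ^ k = (Poly_Mapping.single (Poly_Mapping.single u k) 1 :: ('v, 'k) mpoly)" for u k
    by (induction k) (simp_all add: mvar_def mult_single flip: single_add)
  have "(\<Prod>v\<in>S. mvar (\<sigma> v) ^ lk m v) =
      (Poly_Mapping.single (\<Sum>v\<in>S. Poly_Mapping.single (\<sigma> v) (lk m v)) 1 :: ('v, 'k) mpoly)" if "finite S" for S
    using that by (induction S rule: finite_induct) (simp_all add: pow mult_single)
  then have "mono_eval (\<lambda>v. mvar (\<sigma> v)) m =
      (Poly_Mapping.single (\<Sum>v\<in>UNIV. Poly_Mapping.single (\<sigma> v) (lk m v)) 1 :: ('v, 'k) mpoly)"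
    by (simp add: mono_eval_superset[of UNIV])
  moreover have "(\<Sum>v\<in>UNIV. Poly_Mapping.single (\<sigma> v) (lk m v)) = mcomp m (Hilbert_Choice.inv \<sigma>)"
  proof (rule poly_mapping_eqI)
    fix u
    have "lk (\<Sum>v\<in>UNIV. Poly_Mapping.single (\<sigma> v) (lk m v)) u = (\<Sum>v\<in>UNIV. if v = Hilbert_Choice.inv \<sigma> u then lk m v else 0)"
      unfolding lookup_sum lookup_single when_def
      using assms by (intro sum.cong) (auto simp: bij_inv_eq_iff)
    then show "lk (\<Sum>v\<in>UNIV. Poly_Mapping.single (\<sigma> v) (lk m v)) u = lk (mcomp m (Hilbert_Choice.inv \<sigma>)) u"
      by (simp add: lookup_mcomp)
  qed
  ultimately show ?thesis by simp
qed

lemma mcomp_inv: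
  assumes "bij \<sigma>"
  shows "mcomp m (Hilbert_Choice.inv \<sigma>) = m' \<longleftrightarrow> m = mcomp m' \<sigma>"
proof -
  have "Hilbert_Choice.inv \<sigma> \<circ> \<sigma> = id" "\<sigma> \<circ> Hilbert_Choice.inv \<sigma> = id"
    using assms by (simp_all add: bij_is_inj[THEN inj_iff[THEN iffD1]] bij_is_surj[THEN surj_iff[THEN iffD1]])
  then show ?thesis by (metis mcomp_id mcomp_mcomp)
qed

lemma mconst_0: "mconst 0 = 0" by (simp add: mconst_def)
lemma mconst_add: "mconst (a + b) = mconst a + mconst b" by (simp add: mconst_def single_add)

lemma lookup_sym_act:
  assumes "bij (\<sigma> :: 'v::finite \<Rightarrow> 'v)"
  shows "lk (sym_act \<sigma> p) m = lk p (mcomp m \<sigma>)"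
proof -
  have "sym_act \<sigma> p = (\<Sum>m\<in>Poly_Mapping.keys p. Poly_Mapping.single (mcomp m (Hilbert_Choice.inv \<sigma>)) (lk p m))"
    unfolding sym_act_def msubst_def mono_eval_def[symmetric] mono_eval_mvar[OF assms]
    by (simp add: mconst_def mult_single)
  then have "lk (sym_act \<sigma> p) m = (\<Sum>k\<in>Poly_Mapping.keys p. if k = mcomp m \<sigma> then lk p k else 0)"
    by (simp add: lookup_sum lookup_single when_def mcomp_inv[OF assms])
  then show ?thesis by (simp add: in_keys_iff)
qed

lemma sym_act_single:
  assumes "bij (\<sigma> :: 'v::finite \<Rightarrow> 'v)"
  shows "sym_act \<sigma> (Poly_Mapping.single (mcomp m \<sigma>) c) = Poly_Mapping.single m c"
proof (rule poly_mapping_eqI)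
  fix k
  have "mcomp m \<sigma> = mcomp k \<sigma> \<longleftrightarrow> m = k" using mcomp_inv[OF assms] by metis
  then show "lk (sym_act \<sigma> (Poly_Mapping.single (mcomp m \<sigma>) c)) k = lk (Poly_Mapping.single m c) k"
    by (simp add: lookup_sym_act[OF assms] lookup_single when_def)
qed

lemma sym_act_add: "sym_act \<sigma> (p + q) = sym_act \<sigma> p + sym_act \<sigma> q"
  unfolding sym_act_def by (rule msubst_add) (simp_all add: mconst_0 mconst_add)

lemma sym_act_mscale: "sym_act \<sigma> (mscale c p) = mscale c (sym_act \<sigma> p)"
proof -
  have "Poly_Mapping.keys (mscale c p) \<subseteq> Poly_Mapping.keys p" by (auto simp: in_keys_iff lookup_mscale)
  then have "sym_act \<sigma> (mscale c p)
      = (\<Sum>m\<in>Poly_Mapping.keys p. mconst (c * lk p m) * mono_eval (\<lambda>v. mvar (\<sigma> v)) m)"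
    unfolding sym_act_def by (subst msubst_superset) (auto simp: mconst_0 lookup_mscale)
  also have "\<dots> = mscale c (sym_act \<sigma> p)"
    unfolding sym_act_def msubst_def mono_eval_def mscale_def sum_distrib_left
    by (intro sum.cong refl) (simp add: mconst_def mult_single flip: mult.assoc)
  finally show ?thesis .
qed

lemma sym_rep_mpoly:
  assumes "CHAR('k::field) = 0 \<or> CHAR('k) > CARD('v::finite)"
  shows "sym_rep (mscale :: 'k \<Rightarrow> ('v, 'k) mpoly \<Rightarrow> ('v, 'k) mpoly) sym_act"
proof
  fix \<sigma> \<tau> :: "'v \<Rightarrow> 'v" and p q :: "('v, 'k) mpoly" and c :: 'k
  show "sym_act \<sigma> (p + q) = sym_act \<sigma> p + sym_act \<sigma> q" by (rule sym_act_add)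
  show "sym_act \<sigma> (mscale c p) = mscale c (sym_act \<sigma> p)" by (rule sym_act_mscale)
  show "sym_act id p = p" by (rule poly_mapping_eqI) (simp add: lookup_sym_act mcomp_id)
  show "sym_act \<sigma> (sym_act \<tau> p) = sym_act (\<sigma> \<circ> \<tau>) p" if "bij \<sigma>" "bij \<tau>"
    using that by (intro poly_mapping_eqI) (simp add: lookup_sym_act mcomp_mcomp bij_comp)
  show "of_nat (fact CARD('v)) \<noteq> (0 :: 'k)"
  proof
    assume "of_nat (fact CARD('v)) = (0 :: 'k)"
    then have dv: "CHAR('k) dvd fact CARD('v)" by (simp only: of_nat_eq_0_iff_char_dvd)
    have "CHAR('k) \<noteq> 0"
    proof
      assume "CHAR('k) = 0"
      then have "0 dvd (fact CARD('v) :: nat)" using dv by simp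
      then show False by simp
    qed
    then have "prime CHAR('k)" by (rule prime_CHAR_semidom[OF neq0_conv[THEN iffD1]])
    then have "CHAR('k) \<le> CARD('v)" using dv by (simp add: prime_dvd_fact_iff)
    then show False using assms \<open>CHAR('k) \<noteq> 0\<close> by simp
  qed
qed

lemma finite_mdeg: "finite {m :: 'v::finite \<Rightarrow>\<^sub>0 nat. mdeg m = d}"
proof -
  have "lk m v \<le> mdeg m" for m :: "'v \<Rightarrow>\<^sub>0 nat" and v
    unfolding mdeg_UNIV by (rule member_le_sum) auto
  then have "lk ` {m :: 'v \<Rightarrow>\<^sub>0 nat. mdeg m = d} \<subseteq> (UNIV \<rightarrow>\<^sub>E {..d})" by auto
  moreover have "finite ((UNIV :: 'v set) \<rightarrow>\<^sub>E {..d})" by (rule finite_PiE) auto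
  ultimately have "finite (lk ` {m :: 'v \<Rightarrow>\<^sub>0 nat. mdeg m = d})" by (rule finite_subset)
  moreover have "inj_on lk {m :: 'v \<Rightarrow>\<^sub>0 nat. mdeg m = d}" by (auto simp: inj_on_def)
  ultimately show ?thesis by (rule finite_imageD)
qed

section \<open>Partitions and orbits of monomials\<close>

definition partitions :: "nat \<Rightarrow> nat multiset set" where
  "partitions d = {P. 0 \<notin># P \<and> sum_mset P = d}"

definition exponents :: "('v::finite \<Rightarrow>\<^sub>0 nat) \<Rightarrow> nat multiset" where
  "exponents m = filter_mset (\<lambda>e. e \<noteq> 0) (image_mset (lk m) (mset_set UNIV))"

lemma sum_mset_nonzero: "sum_mset (filter_mset (\<lambda>e. e \<noteq> 0) M) = sum_mset (M :: nat multiset)"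
  by (induction M) auto

lemma exponents_partition: "exponents m \<in> partitions (mdeg m)"
proof -
  have "sum_mset (exponents m) = mdeg m"
    unfolding exponents_def mdeg_UNIV sum_mset_nonzero by (simp add: sum_unfold_sum_mset)
  moreover have "0 \<notin># exponents m" unfolding exponents_def by simp
  ultimately show ?thesis unfolding partitions_def by simp
qed

lemma mset_set_filter_size:
  "size (filter_mset P (image_mset f (mset_set (UNIV :: 'v::finite set)))) = card {v. P (f v)}"
  by (simp add: filter_mset_image_mset size_mset_set)

lemma ex_labelling: "finite A \<Longrightarrow> size M = card A \<Longrightarrow> \<exists>g. image_mset g (mset_set A) = M"
proof (induction A arbitrary: M rule: finite_induct)
  case (insert a A)
  then obtain x M' where M: "M = add_mset x M'" by (metis card_insert_disjoint size_eq_Suc_imp_eq_union)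
  then obtain g where g: "image_mset g (mset_set A) = M'" using insert by auto
  have eq: "image_mset (g(a := x)) (mset_set A) = image_mset g (mset_set A)"
    using insert by (intro image_mset_cong) auto
  have "image_mset (g(a := x)) (mset_set (insert a A)) = add_mset ((g(a := x)) a) (image_mset (g(a := x)) (mset_set A))"
    unfolding mset_set.insert[OF insert.hyps] by (rule image_mset_add_mset)
  also have "\<dots> = M" unfolding eq using g M by simp
  finally show ?case by blast
qed simp

lemma size_partition_le: "0 \<notin># P \<Longrightarrow> size P \<le> sum_mset (P :: nat multiset)"
  by (induction P) auto

lemma ex_exponents:
  assumes "P \<in> partitions d" "d < CARD('v::finite)"
  shows "\<exists>m :: 'v \<Rightarrow>\<^sub>0 nat. exponents m = P"
proof -
  have size: "size P \<le> CARD('v)" using assms size_partition_le unfolding partitions_def by fastforce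
  obtain g :: "'v \<Rightarrow> nat" where g: "image_mset g (mset_set UNIV) = P + replicate_mset (CARD('v) - size P) 0"
    using ex_labelling[of "UNIV :: 'v set" "P + replicate_mset (CARD('v) - size P) 0"] size by auto
  have "filter_mset (\<lambda>e. e \<noteq> 0) P = P"
    using assms(1) unfolding partitions_def by (auto simp: filter_mset_eq_conv intro!: gr0I)
  then have "exponents (Abs_poly_mapping g) = P"
    unfolding exponents_def by (simp add: g eta_contract_eq)
  then show ?thesis by blast
qed

lemma exponents_conj:
  assumes "exponents m = exponents (m' :: 'v::finite \<Rightarrow>\<^sub>0 nat)"
  shows "\<exists>\<sigma>. bij \<sigma> \<and> m = mcomp m' \<sigma>"
proof -
  let ?im = "\<lambda>m. image_mset (lk m) (mset_set (UNIV :: 'v set))"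
  have zeros: "filter_mset (\<lambda>e. \<not> e \<noteq> 0) M = replicate_mset (size (filter_mset (\<lambda>e. \<not> e \<noteq> 0) M)) 0"
    for M :: "nat multiset"
    by (induction M) auto
  have im: "?im m = exponents m + replicate_mset (CARD('v) - size (exponents m)) 0" for m
  proof -
    have part: "?im m = exponents m + filter_mset (\<lambda>e. \<not> e \<noteq> 0) (?im m)"
      unfolding exponents_def by (rule multiset_partition)
    have "size (?im m) = size (exponents m) + size (filter_mset (\<lambda>e. \<not> e \<noteq> 0) (?im m))"
      using arg_cong[OF part, of size] unfolding size_union .
    then have "size (filter_mset (\<lambda>e. \<not> e \<noteq> 0) (?im m)) = CARD('v) - size (exponents m)" by simp
    then have "filter_mset (\<lambda>e. \<not> e \<noteq> 0) (?im m) = replicate_mset (CARD('v) - size (exponents m)) 0"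
      using zeros[of "?im m"] by (simp only:)
    then show ?thesis using part by (simp only:)
  qed
  have "?im m = ?im m'" unfolding im[of m] im[of m'] assms ..
  then obtain \<sigma> where "\<sigma> permutes UNIV" "\<forall>x\<in>UNIV. lk m x = lk m' (\<sigma> x)"
    using image_mset_eq_implies_permutes[of "UNIV :: 'v set" "lk m" "lk m'"] by auto
  then show ?thesis
    by (intro exI[of _ \<sigma>]) (auto simp: permutes_bij lookup_mcomp intro!: poly_mapping_eqI)
qed

lemma exponents_mcomp:
  assumes "bij \<sigma>"
  shows "exponents (mcomp m \<sigma>) = exponents m"
proof -
  have "lk (mcomp m \<sigma>) = lk m \<circ> \<sigma>" by (simp add: fun_eq_iff lookup_mcomp)
  then have "image_mset (lk (mcomp m \<sigma>)) (mset_set UNIV) = image_mset (lk m) (image_mset \<sigma> (mset_set UNIV))"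
    by (simp add: multiset.map_comp)
  also have "image_mset \<sigma> (mset_set UNIV) = mset_set UNIV"
    using assms by (simp add: image_mset_mset_set bij_is_inj bij_is_surj)
  finally show ?thesis unfolding exponents_def by simp
qed

lemma mdeg_exponents: "mdeg m = sum_mset (exponents m)"
  using exponents_partition[of m] unfolding partitions_def by simp

lemma finite_partitions: "d < CARD('v::finite) \<Longrightarrow> finite (partitions d)"
proof -
  assume "d < CARD('v)"
  have "partitions d \<subseteq> exponents ` {m :: 'v \<Rightarrow>\<^sub>0 nat. mdeg m = d}"
  proof
    fix P assume P: "P \<in> partitions d"
    then obtain m :: "'v \<Rightarrow>\<^sub>0 nat" where m: "exponents m = P" using ex_exponents \<open>d < CARD('v)\<close> by blast
    then have "mdeg m = d" using P mdeg_exponents[of m] unfolding partitions_def by simp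
    then show "P \<in> exponents ` {m :: 'v \<Rightarrow>\<^sub>0 nat. mdeg m = d}" using m by blast
  qed
  then show ?thesis using finite_mdeg finite_surj by blast
qed

text \<open>Removing one copy of a part turns the pairs of a partition and one of its distinct parts into
  the partitions of smaller numbers.\<close>

lemma sum_distinct_parts:
  assumes fin: "\<And>i. i \<le> d \<Longrightarrow> finite (partitions i)"
  shows "(\<Sum>P\<in>partitions d. card (set_mset P)) = (\<Sum>i<d. num_partitions i)"
proof -
  let ?A = "SIGMA P:partitions d. set_mset P" and ?B = "SIGMA i:{..<d}. partitions i"
  have "bij_betw (\<lambda>(P, e). (d - e, P - {#e#})) ?A ?B"
  proof (rule bij_betw_byWitness[where f' = "\<lambda>(i, P). (add_mset (d - i) P, d - i)"])
    show "\<forall>x\<in>?A. (\<lambda>(i, P). (add_mset (d - i) P, d - i)) ((\<lambda>(P, e). (d - e, P - {#e#})) x) = x"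
      unfolding partitions_def by (auto simp: sum_mset.remove)
    show "\<forall>x\<in>?B. (\<lambda>(P, e). (d - e, P - {#e#})) ((\<lambda>(i, P). (add_mset (d - i) P, d - i)) x) = x"
      by auto
    show "(\<lambda>(P, e). (d - e, P - {#e#})) ` ?A \<subseteq> ?B"
      unfolding partitions_def by (auto simp: sum_mset.remove dest: in_diffD intro!: gr0I)
    show "(\<lambda>(i, P). (add_mset (d - i) P, d - i)) ` ?B \<subseteq> ?A"
      unfolding partitions_def by auto
  qed
  then have "card ?A = card ?B" by (rule bij_betw_same_card)
  moreover have "card ?A = (\<Sum>P\<in>partitions d. card (set_mset P))"
    using fin by (intro card_SigmaI) auto
  moreover have "card ?B = (\<Sum>i<d. card (partitions i))"
    using fin by (intro card_SigmaI) auto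
  ultimately show ?thesis unfolding num_partitions_def partitions_def by simp
qed

lemma set_exponents: "set_mset (exponents m) = range (lk m) - {0}"
  unfolding exponents_def by auto

lemma card_support: "card {v. lk m v \<noteq> 0} = size (exponents m)"
  unfolding exponents_def by (rule mset_set_filter_size[symmetric])

lemma ex_zero_exponent:
  fixes m :: "'v::finite \<Rightarrow>\<^sub>0 nat"
  assumes "mdeg m < CARD('v)"
  shows "\<exists>v. lk m v = 0"
proof (rule ccontr)
  assume "\<not> ?thesis"
  then have "(\<Sum>v\<in>(UNIV :: 'v set). 1) \<le> mdeg m"
    unfolding mdeg_UNIV by (intro sum_mono) (simp add: Suc_le_eq)
  then show False using assms by simp
qed

lemma card_range_exponents:
  fixes m :: "'v::finite \<Rightarrow>\<^sub>0 nat"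
  assumes "mdeg m < CARD('v)"
  shows "card (range (lk m)) = card (set_mset (exponents m)) + 1"
proof -
  have "0 \<in> range (lk m)" using ex_zero_exponent[OF assms] by (metis rangeI)
  then have "card (range (lk m)) = card (range (lk m) - {0}) + 1"
    using card_Suc_Diff1[of "range (lk m)" 0] by simp
  then show ?thesis unfolding set_exponents .
qed

text \<open>As the degree is smaller than the number of variables, more variables are absent than occur
  with any given exponent above one.\<close>

lemma card_zero_exponents:
  fixes m :: "'v::finite \<Rightarrow>\<^sub>0 nat"
  assumes "mdeg m < CARD('v)" "2 \<le> e"
  shows "card {v. lk m v = e} < card {v. lk m v = 0}"
proof -
  have "card {v. lk m v \<noteq> 0} + card {v. lk m v = e}
      = (\<Sum>v\<in>UNIV. (if lk m v \<noteq> 0 then 1 else 0) + (if lk m v = e then 1 else 0))"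
    by (simp add: sum.distrib sum.If_cases)
  also have "\<dots> \<le> mdeg m" unfolding mdeg_UNIV using assms(2) by (intro sum_mono) auto
  finally have "card {v. lk m v \<noteq> 0} + card {v. lk m v = e} < CARD('v)" using assms(1) by simp
  moreover have "CARD('v) = card {v. lk m v = 0} + card {v. lk m v \<noteq> 0}"
  proof -
    have "(UNIV :: 'v set) = {v. lk m v = 0} \<union> {v. lk m v \<noteq> 0}" by auto
    moreover have "card ({v. lk m v = 0} \<union> {v. lk m v \<noteq> 0}) = card {v. lk m v = 0} + card {v. lk m v \<noteq> 0}"
      by (rule card_Un_disjoint) auto
    ultimately show ?thesis by (simp only:)
  qed
  ultimately show ?thesis by simp
qed

lemma partition_of_ones:
  assumes "P \<in> partitions d" "\<And>e. e \<in># P \<Longrightarrow> e < 2"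
  shows "P = replicate_mset d 1"
proof -
  have "e = 1" if "e \<in># P" for e
    using assms(2)[OF that] that assms(1) unfolding partitions_def by (cases "e = 0") auto
  then have "set_mset P \<subseteq> {1}" by auto
  then have "P = replicate_mset (size P) 1" by (rule set_mset_subset_singletonD)
  then obtain k where "P = replicate_mset k 1" ..
  then show ?thesis using assms(1) unfolding partitions_def by (simp add: sum_mset_replicate_mset)
qed

abbreviation monom :: "('v \<Rightarrow>\<^sub>0 nat) \<Rightarrow> ('v, 'k::comm_ring_1) mpoly" where
  "monom m \<equiv> Poly_Mapping.single m 1"

definition orbit_rep :: "nat multiset \<Rightarrow> ('v::finite \<Rightarrow>\<^sub>0 nat)" where
  "orbit_rep P = (SOME m. exponents m = P)"

lemma exponents_orbit_rep:
  assumes "P \<in> partitions d" "d < CARD('v::finite)"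
  shows "exponents (orbit_rep P :: 'v \<Rightarrow>\<^sub>0 nat) = P"
  unfolding orbit_rep_def using someI_ex[OF ex_exponents[OF assms]] .

lemma mdeg_orbit_rep:
  assumes "P \<in> partitions d" "d < CARD('v::finite)"
  shows "mdeg (orbit_rep P :: 'v \<Rightarrow>\<^sub>0 nat) = d"
  using exponents_orbit_rep[OF assms] assms(1) unfolding mdeg_exponents partitions_def by simp

lemma lookup_mscale_sum: "lk (\<Sum>a\<in>S. mscale (c a) (f a)) m = (\<Sum>a\<in>S. c a * lk (f a) m)"
  by (simp add: lookup_sum lookup_mscale)

lemma subspace_homog: "mp.subspace (homog d)"
  unfolding mp.subspace_def by (auto simp: homog_0 homog_add) (auto simp: homog_iff lookup_mscale)

lemma homog_span: "homog d = mp.span (monom ` {m :: 'v::finite \<Rightarrow>\<^sub>0 nat. mdeg m = d} :: ('v, 'k::field) mpoly set)"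
proof
  show "mp.span (monom ` {m :: 'v \<Rightarrow>\<^sub>0 nat. mdeg m = d}) \<subseteq> (homog d :: ('v, 'k) mpoly set)"
    by (rule mp.span_minimal[OF _ subspace_homog]) (auto simp: homog_iff lookup_single when_def)
  show "homog d \<subseteq> mp.span (monom ` {m :: 'v \<Rightarrow>\<^sub>0 nat. mdeg m = d} :: ('v, 'k) mpoly set)"
  proof
    fix p :: "('v, 'k) mpoly" assume p: "p \<in> homog d"
    have "p = (\<Sum>m\<in>Poly_Mapping.keys p. Poly_Mapping.single m (lk p m))"
      by (rule poly_mapping_sum_single) auto
    also have "\<dots> = (\<Sum>m\<in>Poly_Mapping.keys p. mscale (lk p m) (monom m))"
      by (simp add: mscale_def mconst_def mult_single)
    also have "\<dots> \<in> mp.span (monom ` {m. mdeg m = d})"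
      using p unfolding homog_def by (intro mp.span_sum mp.span_scale mp.span_base) auto
    finally show "p \<in> mp.span (monom ` {m. mdeg m = d})" .
  qed
qed

lemma sym_act_homog: "bij \<sigma> \<Longrightarrow> p \<in> homog d \<Longrightarrow> sym_act \<sigma> p \<in> homog d" for p :: "('v::finite, 'k::field) mpoly"
  unfolding homog_iff by (simp add: lookup_sym_act) (metis mdeg_mcomp)

text \<open>The two type arguments only serve to fix the variables and the coefficients.\<close>

locale forms = sym_rep "mscale :: 'k::field \<Rightarrow> ('v::finite, 'k) mpoly \<Rightarrow> ('v, 'k) mpoly" sym_act
  for vars :: "'v::finite itself" and coeffs :: "'k::field itself" +
  fixes d :: nat
  assumes d2: "2 \<le> d" and dn: "d < CARD('v)"
begin

abbreviation V :: "('v, 'k) mpoly set" where "V \<equiv> homog d"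

lemma submod_V: "submod V"
  unfolding submod_def using subspace_homog sym_act_homog by blast

lemma fin_dim_V: "fin_dim V"
  unfolding homog_span by (rule fin_dim_span) (simp add: finite_mdeg)

lemma finite_parts: "i \<le> d \<Longrightarrow> finite (partitions i)"
  using finite_partitions[where 'v = 'v, of i] dn by simp

lemmas exp_rep = exponents_orbit_rep[where 'v = 'v, OF _ dn]
lemmas deg_rep = mdeg_orbit_rep[where 'v = 'v, OF _ dn]

lemma invariant_iff:
  assumes "p \<in> V"
  shows "p \<in> invariants V \<longleftrightarrow> (\<forall>\<sigma> m. bij \<sigma> \<longrightarrow> lk p (mcomp m \<sigma>) = lk p m)"
  using assms unfolding invariants_def by (auto simp: poly_mapping_eq_iff fun_eq_iff lookup_sym_act)

text \<open>The orbit sums \<open>s P\<close> of the monomials are a basis.\<close>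

lemma dim_invariants: "dim (invariants V) = num_partitions d"
proof -
  define s :: "nat multiset \<Rightarrow> ('v, 'k) mpoly" where "s P = (\<Sum>m\<in>{m. mdeg m = d \<and> exponents m = P}. monom m)" for P
  have fin: "finite {m :: 'v \<Rightarrow>\<^sub>0 nat. mdeg m = d \<and> exponents m = P}" for P
    by (rule finite_subset[OF _ finite_mdeg[of d]]) auto
  have ls: "lk (s P) m = (if mdeg m = d \<and> exponents m = P then 1 else 0)" for P m
    unfolding s_def using fin[of P] by (simp add: lookup_sum lookup_single when_def sum.delta')
  have sV: "s P \<in> V" for P unfolding homog_iff ls by auto
  have sI: "s P \<in> invariants V" for P
    unfolding invariant_iff[OF sV] ls by (simp add: mdeg_mcomp exponents_mcomp)
  have lsr: "lk (s P) (orbit_rep P') = (if P = P' then 1 else 0)" if "P' \<in> partitions d" for P P'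
    unfolding ls using deg_rep[OF that] exp_rep[OF that] by auto
  have inj: "inj_on s (partitions d)"
  proof (rule inj_onI)
    fix P P' assume "P \<in> partitions d" "P' \<in> partitions d" "s P = s P'"
    then show "P = P'" using lsr[of P P] lsr[of P P'] by (metis zero_neq_one)
  qed
  have "independent (s ` partitions d)"
  proof (rule independent_if_scalars_zero)
    show "finite (s ` partitions d)" using finite_parts by simp
    fix u x assume u: "(\<Sum>x\<in>s ` partitions d. mscale (u x) x) = 0" and x: "x \<in> s ` partitions d"
    then obtain P where P: "P \<in> partitions d" "x = s P" by blast
    have "0 = lk (\<Sum>x\<in>s ` partitions d. mscale (u x) x) (orbit_rep P)" using u by simp
    also have "\<dots> = (\<Sum>P'\<in>partitions d. u (s P') * lk (s P') (orbit_rep P))"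
      unfolding lookup_mscale_sum by (simp add: sum.reindex[OF inj])
    also have "\<dots> = (\<Sum>P'\<in>partitions d. if P' = P then u (s P') else 0)"
      by (intro sum.cong) (auto simp: lsr[OF P(1)])
    also have "\<dots> = u x" using P finite_parts by simp
    finally show "u x = 0" by simp
  qed
  moreover have "invariants V \<subseteq> span (s ` partitions d)"
  proof
    fix p assume p: "p \<in> invariants V"
    then have pV: "p \<in> V" unfolding invariants_def by simp
    have "p = (\<Sum>P\<in>partitions d. mscale (lk p (orbit_rep P)) (s P))"
    proof (rule poly_mapping_eqI)
      fix m
      have "lk (\<Sum>P\<in>partitions d. mscale (lk p (orbit_rep P)) (s P)) m
          = (\<Sum>P\<in>partitions d. if P = exponents m then (if mdeg m = d then lk p (orbit_rep P) else 0) else 0)"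
        unfolding lookup_mscale_sum ls by (intro sum.cong) auto
      also have "\<dots> = (if mdeg m = d then lk p (orbit_rep (exponents m)) else 0)"
        using finite_parts exponents_partition[of m] by auto
      also have "\<dots> = lk p m"
      proof (cases "mdeg m = d")
        case True
        then have "exponents (orbit_rep (exponents m) :: 'v \<Rightarrow>\<^sub>0 nat) = exponents m"
          using exp_rep exponents_partition[of m] by simp
        then obtain \<sigma> where "bij \<sigma>" "(orbit_rep (exponents m) :: 'v \<Rightarrow>\<^sub>0 nat) = mcomp m \<sigma>"
          using exponents_conj by blast
        then show ?thesis using p invariant_iff[OF pV] True by simp
      next
        case False
        then show ?thesis using pV unfolding homog_iff by auto
      qed
      finally show "lk p m = lk (\<Sum>P\<in>partitions d. mscale (lk p (orbit_rep P)) (s P)) m" by simp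
    qed
    also have "\<dots> \<in> span (s ` partitions d)" by (intro span_sum span_scale span_base) auto
    finally show "p \<in> span (s ` partitions d)" .
  qed
  moreover have "s ` partitions d \<subseteq> invariants V" using sI by auto
  ultimately have "dim (invariants V) = card (s ` partitions d)" by (intro dim_unique) auto
  also have "\<dots> = num_partitions d" using card_image[OF inj] unfolding num_partitions_def partitions_def by simp
  finally show ?thesis .
qed

lemma partition_labels:
  assumes P: "P \<in> partitions d"
  shows "card (range (lk (orbit_rep P :: 'v \<Rightarrow>\<^sub>0 nat))) = card (set_mset P) + 1"
  using card_range_exponents[of "orbit_rep P :: 'v \<Rightarrow>\<^sub>0 nat"] deg_rep[OF P] exp_rep[OF P] dn by simp

lemma ones_partition: "replicate_mset d 1 \<in> partitions d" "{#d#} \<in> partitions d"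
  using d2 unfolding partitions_def by (auto simp: sum_mset_replicate_mset)

lemma small_multiplicities:
  assumes Q: "(\<Sum>i<d. num_partitions i) \<le> r * (CARD('v) - 1)"
    and K: "submod K" "K \<subseteq> V" "K \<inter> invariants V \<subseteq> {0}"
  shows "(\<Sum>P\<in>partitions d. dim (young_inv K (lk (orbit_rep P :: 'v \<Rightarrow>\<^sub>0 nat)))) \<le> r * dim K"
proof -
  let ?lab = "\<lambda>P. lk (orbit_rep P :: 'v \<Rightarrow>\<^sub>0 nat)"
  have "card {v. ?lab {#d#} v \<noteq> 0} = 1"
    using card_support[of "orbit_rep {#d#} :: 'v \<Rightarrow>\<^sub>0 nat"] exp_rep[OF ones_partition(2)] by simp
  then obtain c where c: "{v. ?lab {#d#} v \<noteq> 0} = {c}" by (auto simp: card_1_singleton_iff)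
  show ?thesis
  proof (rule multiplicity_bound[of "partitions d" ?lab r "{#d#}" c "replicate_mset d 1"])
    show "2 \<le> CARD('v)" using d2 dn by simp
    show "finite (partitions d)" using finite_parts by simp
    have "(\<Sum>P\<in>partitions d. card (range (?lab P)) - 1) = (\<Sum>P\<in>partitions d. card (set_mset P))"
      by (intro sum.cong refl) (simp add: partition_labels)
    also have "\<dots> = (\<Sum>i<d. num_partitions i)" by (rule sum_distinct_parts[OF finite_parts])
    finally show "(\<Sum>P\<in>partitions d. card (range (?lab P)) - 1) \<le> r * (CARD('v) - 1)" using Q by simp
    show "{#d#} \<in> partitions d" "replicate_mset d 1 \<in> partitions d" by (rule ones_partition)+
    show "card (range (?lab {#d#})) = 2" using partition_labels[OF ones_partition(2)] by simp
    show "card (range (?lab (replicate_mset d 1))) = 2"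
      using partition_labels[OF ones_partition(1)] d2 by simp
    show "?lab {#d#} i = ?lab {#d#} j" if "i \<noteq> c" "j \<noteq> c" for i j
      using c that by (metis (mono_tags, lifting) mem_Collect_eq singletonD)
    have "size {#d#} \<noteq> size (replicate_mset d (1::nat))" using d2 by simp
    then show "{#d#} \<noteq> replicate_mset d 1" by metis
    show "submod K" "fin_dim K" using K fin_dim_mono[OF _ fin_dim_V] by auto
    show "w = 0" if w: "w \<in> K" "\<And>i j. sym_act (transp i j) w = w" for w
    proof -
      have "sym_act \<sigma> w = w" if "bij \<sigma>" for \<sigma>
        by (rule act_permutes[of UNIV]) (use w(2) that in \<open>auto intro: bij_imp_permutes\<close>)
      then have "w \<in> K \<inter> invariants V" using w(1) K(2) unfolding invariants_def by auto
      then show ?thesis using K(3) by blast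
    qed
    fix P assume P: "P \<in> partitions d" "P \<noteq> {#d#}" "P \<noteq> replicate_mset d 1"
    then obtain e where e: "e \<in># P" "2 \<le> e" using partition_of_ones[OF P(1)] by (metis not_le)
    have "set_mset P = range (?lab P) - {0}" using set_exponents exp_rep[OF P(1)] by metis
    then obtain i where i: "?lab P i = e" using e(1) by auto
    obtain j where j: "?lab P j = 0" using ex_zero_exponent deg_rep[OF P(1)] dn by metis
    have "card {y. ?lab P y = ?lab P i} < card {y. ?lab P y = ?lab P j}"
      unfolding i j using deg_rep[OF P(1)] dn e(2) by (intro card_zero_exponents) auto
    then show "\<exists>i j. card {y. ?lab P y = ?lab P i} \<noteq> card {y. ?lab P y = ?lab P j}"
      by (metis less_irrefl)
  qed
qed

lemma form_generators:
  assumes Q: "(\<Sum>i<d. num_partitions i) \<le> r * (CARD('v) - 1)"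
  shows "\<exists>f. (\<forall>i<r. f i \<in> V) \<and> V = {x + y |x y. x \<in> gen r f \<and> y \<in> invariants V}"
proof -
  let ?rep = "\<lambda>P. orbit_rep P :: 'v \<Rightarrow>\<^sub>0 nat"
  define lab :: "('v, 'k) mpoly \<Rightarrow> 'v \<Rightarrow> nat" where "lab x = lk (the_elem (Poly_Mapping.keys x))" for x
  have lab: "lab (monom m) = lk m" for m unfolding lab_def by simp
  define R :: "('v, 'k) mpoly set" where "R = (\<lambda>P. monom (?rep P)) ` partitions d"
  have inj: "inj_on (\<lambda>P. monom (?rep P) :: ('v, 'k) mpoly) (partitions d)"
  proof (rule inj_onI)
    fix P P' assume P: "P \<in> partitions d" "P' \<in> partitions d"
      "monom (?rep P) = (monom (?rep P') :: ('v, 'k) mpoly)"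
    then have "Poly_Mapping.keys (monom (?rep P) :: ('v, 'k) mpoly) = Poly_Mapping.keys (monom (?rep P') :: ('v, 'k) mpoly)"
      by simp
    then have "?rep P = ?rep P'" by simp
    then show "P = P'" using exp_rep[OF P(1)] exp_rep[OF P(2)] by metis
  qed
  show ?thesis
  proof (rule generators_modulo_invariants[OF submod_V fin_dim_V homog_span, of R lab r])
    show "finite R" unfolding R_def using finite_parts by simp
    show "R \<subseteq> V" unfolding R_def by (auto simp: homog_iff lookup_single when_def deg_rep)
    fix x :: "('v, 'k) mpoly" assume "x \<in> monom ` {m. mdeg m = d}"
    then obtain m where m: "mdeg m = d" "x = monom m" by blast
    have P: "exponents m \<in> partitions d" using exponents_partition[of m] m(1) by simp
    have "exponents (?rep (exponents m)) = exponents m" by (rule exp_rep[OF P])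
    then obtain \<sigma> where \<sigma>: "bij \<sigma>" "?rep (exponents m) = mcomp m \<sigma>" using exponents_conj by blast
    then have "x = sym_act \<sigma> (monom (?rep (exponents m)))" using m(2) sym_act_single[OF \<sigma>(1), of m "1 :: 'k"] by simp
    then show "\<exists>\<sigma> y. bij \<sigma> \<and> y \<in> R \<and> x = sym_act \<sigma> y" using \<sigma>(1) P unfolding R_def by blast
  next
    fix x i j assume "x \<in> R" "lab x i = lab x j"
    then obtain P where P: "P \<in> partitions d" "x = monom (?rep P)" unfolding R_def by blast
    then have eq: "lk (?rep P) i = lk (?rep P) j" using \<open>lab x i = lab x j\<close> lab by simp
    have "mcomp (?rep P) (transp i j) = ?rep P"
    proof (rule poly_mapping_eqI)
      fix v show "lk (mcomp (?rep P) (transp i j)) v = lk (?rep P) v"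
        unfolding lookup_mcomp using eq by (cases "v = i \<or> v = j") (auto simp: transpose_apply_other)
    qed
    then show "sym_act (transp i j) x = x"
      using sym_act_single[of "transp i j" "?rep P" "1 :: 'k"] P(2) by simp
  next
    fix K assume K: "submod K" "K \<subseteq> V" "K \<inter> invariants V \<subseteq> {0}"
    have "(\<Sum>x\<in>R. dim (young_inv K (lab x))) = (\<Sum>P\<in>partitions d. dim (young_inv K (lk (?rep P))))"
      unfolding R_def by (simp add: sum.reindex[OF inj] lab)
    then show "(\<Sum>x\<in>R. dim (young_inv K (lab x))) \<le> r * dim K"
      using small_multiplicities[OF Q K] by simp
  qed
qed

end

section \<open>Too few generators\<close>

lemma homogeneous_system:
  fixes a :: "'t \<Rightarrow> 'q \<Rightarrow> 'k::field"
  assumes "finite T" "finite Q" "card T < card Q"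
  shows "\<exists>c. (\<exists>q\<in>Q. c q \<noteq> 0) \<and> (\<forall>t\<in>T. (\<Sum>q\<in>Q. c q * a t q) = 0)"
  using assms
proof (induction T arbitrary: Q a rule: finite_induct)
  case empty
  then obtain q where "q \<in> Q" by fastforce
  then show ?case by (intro exI[of _ "\<lambda>_. 1"]) auto
next
  case (insert t T)
  show ?case
  proof (cases "\<forall>q\<in>Q. a t q = 0")
    case True
    obtain c where "\<exists>q\<in>Q. c q \<noteq> 0" "\<forall>t\<in>T. (\<Sum>q\<in>Q. c q * a t q) = 0"
      using insert.IH[of Q a] insert.prems insert.hyps by auto
    then show ?thesis using True by (intro exI[of _ c]) simp
  next
    case False
    then obtain q0 where q0: "q0 \<in> Q" "a t q0 \<noteq> 0" by blast
    let ?Q = "Q - {q0}"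
    define a' where "a' s q = a s q - a s q0 * a t q / a t q0" for s q
    have "card T < card ?Q" using insert.prems insert.hyps q0 by simp
    then obtain c where c: "\<exists>q\<in>?Q. c q \<noteq> 0" "\<forall>s\<in>T. (\<Sum>q\<in>?Q. c q * a' s q) = 0"
      using insert.IH[of ?Q a'] insert.prems by auto
    define x where "x = - (\<Sum>q\<in>?Q. c q * a t q) / a t q0"
    define c' where "c' = c(q0 := x)"
    have split: "(\<Sum>q\<in>Q. c' q * a s q) = x * a s q0 + (\<Sum>q\<in>?Q. c q * a s q)" for s
      using sum.remove[OF insert.prems(1) q0(1), of "\<lambda>q. c' q * a s q"] unfolding c'_def by simp
    have "(\<Sum>q\<in>Q. c' q * a s q) = 0" if "s \<in> insert t T" for s
    proof (cases "s = t")
      case True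
      then show ?thesis unfolding split x_def using q0(2) by simp
    next
      case False
      have "0 = (\<Sum>q\<in>?Q. c q * a' s q)" using c(2) that False by simp
      also have "\<dots> = (\<Sum>q\<in>?Q. c q * a s q) - (\<Sum>q\<in>?Q. (a s q0 / a t q0) * (c q * a t q))"
        unfolding a'_def sum_subtractf[symmetric] by (intro sum.cong refl) (simp add: algebra_simps)
      also have "\<dots> = (\<Sum>q\<in>?Q. c q * a s q) + x * a s q0"
        unfolding x_def sum_distrib_left[symmetric] by simp
      finally show ?thesis unfolding split by (simp add: add.commute)
    qed
    moreover have "\<exists>q\<in>Q. c' q \<noteq> 0" using c(1) unfolding c'_def by auto
    ultimately show ?thesis by blast
  qed
qed

context forms
begin

lemma symmetrizer_monom_diff:
  assumes "bij \<sigma>"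
  shows "symmetrizer (monom (mcomp m \<sigma>) - monom m) = 0"
  using symmetrizer_act(1)[OF assms, of "monom (mcomp m \<sigma>)"] sym_act_single[OF assms, of m "1 :: 'k"]
  by (simp add: symmetrizer_simps)

text \<open>For a partition \<open>P\<close> and a part \<open>e\<close>, the sums \<open>g (P, e) i p\<close> of the coefficients of the monomials of
  type \<open>P\<close> in which the variable \<open>i\<close> has exponent \<open>e\<close> map \<open>p\<close> equivariantly to a function of \<open>i\<close>. For
  a linear combination \<open>G\<close> of these maps, to be constant on the \<open>r\<close> generators, and thus on the
  submodule they generate, means \<open>r (n - 1)\<close> linear equations for the coefficients of \<open>G\<close>; so there is
  a nonzero solution. But \<open>G\<close> is not constant on the difference of two monomials that a swap exchanges.\<close>

lemma reduced_not_generated: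
  assumes Q: "r * (CARD('v) - 1) < (\<Sum>i<d. num_partitions i)" and f: "\<And>i. i < r \<Longrightarrow> f i \<in> V"
  shows "\<not> reduced V \<subseteq> gen r f"
proof
  assume red: "reduced V \<subseteq> gen r f"
  let ?n = "CARD('v) - 1"
  define Qs where "Qs = (SIGMA P:partitions d. set_mset P)"
  have finQ: "finite Qs" unfolding Qs_def using finite_parts by simp
  have "card Qs = (\<Sum>P\<in>partitions d. card (set_mset P))"
    unfolding Qs_def using finite_parts by (intro card_SigmaI) auto
  then have cardQ: "card Qs = (\<Sum>i<d. num_partitions i)" using sum_distinct_parts[OF finite_parts] by simp
  define A where "A q i = {m :: 'v \<Rightarrow>\<^sub>0 nat. mdeg m = d \<and> exponents m = fst q \<and> lk m i = snd q}"
    for q :: "nat multiset \<times> nat" and i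
  have finA: "finite (A q i)" for q i
    by (rule finite_subset[OF _ finite_mdeg[of d]]) (auto simp: A_def)
  define g where "g q i p = (\<Sum>m\<in>A q i. lk p m)" for q i and p :: "('v, 'k) mpoly"
  have g_add: "g q i (x + y) = g q i x + g q i y" and g_scale: "g q i (mscale c x) = c * g q i x"
    and g_diff: "g q i (x - y) = g q i x - g q i y" for q i c x y
    unfolding g_def by (simp_all add: lookup_add lookup_minus lookup_mscale sum.distrib sum_subtractf sum_distrib_left)
  have g_act: "g q (\<sigma> i) (sym_act \<sigma> p) = g q i p" if "bij \<sigma>" for q i p \<sigma>
  proof -
    have it: "Hilbert_Choice.inv \<sigma> \<circ> \<sigma> = id" "\<sigma> \<circ> Hilbert_Choice.inv \<sigma> = id"
      using that by (simp_all add: bij_is_inj[THEN inj_iff[THEN iffD1]] bij_is_surj[THEN surj_iff[THEN iffD1]])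
    have ii: "Hilbert_Choice.inv \<sigma> (\<sigma> i) = i" using that by (simp add: bij_is_inj)
    show ?thesis
      unfolding g_def
    proof (rule sum.reindex_bij_witness[of _ "\<lambda>m. mcomp m (Hilbert_Choice.inv \<sigma>)" "\<lambda>m. mcomp m \<sigma>"])
      fix m assume "m \<in> A q (\<sigma> i)"
      then show "mcomp m \<sigma> \<in> A q i" "lk p (mcomp m \<sigma>) = lk (sym_act \<sigma> p) m"
        using that unfolding A_def by (simp_all add: mdeg_mcomp exponents_mcomp lookup_mcomp lookup_sym_act)
      show "mcomp (mcomp m \<sigma>) (Hilbert_Choice.inv \<sigma>) = m" using it by (simp add: mcomp_mcomp mcomp_id)
    next
      fix m assume "m \<in> A q i"
      then show "mcomp m (Hilbert_Choice.inv \<sigma>) \<in> A q (\<sigma> i)"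
        using that ii unfolding A_def by (simp add: mdeg_mcomp exponents_mcomp lookup_mcomp bij_imp_bij_inv)
      show "mcomp (mcomp m (Hilbert_Choice.inv \<sigma>)) \<sigma> = m" using it by (simp add: mcomp_mcomp mcomp_id)
    qed
  qed
  obtain i0 :: 'v where True by blast
  let ?T = "{..<r} \<times> (UNIV - {i0})"
  have "card ?T = r * ?n" by (simp add: card_cartesian_product)
  then obtain c where c: "\<exists>q\<in>Qs. c q \<noteq> 0"
      "\<forall>t\<in>?T. (\<Sum>q\<in>Qs. c q * (g q (snd t) (f (fst t)) - g q i0 (f (fst t)))) = 0"
    using homogeneous_system[of ?T Qs "\<lambda>t q. g q (snd t) (f (fst t)) - g q i0 (f (fst t))"] finQ Q cardQ by auto
  define G where "G i p = (\<Sum>q\<in>Qs. c q * g q i p)" for i p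
  have G_add: "G i (x + y) = G i x + G i y" and G_scale: "G i (mscale b x) = b * G i x" for i b x y
    unfolding G_def by (simp_all add: g_add g_scale algebra_simps sum.distrib sum_distrib_left)
  have G_act: "G (\<sigma> i) (sym_act \<sigma> p) = G i p" if "bij \<sigma>" for \<sigma> i p
    unfolding G_def using g_act[OF that] by simp
  have Gf: "G i (f t) = G i0 (f t)" if "t < r" for i t
  proof (cases "i = i0")
    case False
    then have "(\<Sum>q\<in>Qs. c q * (g q i (f t) - g q i0 (f t))) = 0" using c(2) that by auto
    then show ?thesis unfolding G_def by (simp add: right_diff_distrib sum_subtractf)
  qed simp
  have "gen r f \<subseteq> {p. \<forall>i j. G i p = G j p}"
  proof (rule gen_least)
    have "subspace {p. \<forall>i j. G i p = G j p}"
    proof (rule subspaceI)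
      have "G i 0 = 0" for i using G_scale[of i 0 0] by simp
      then show "0 \<in> {p. \<forall>i j. G i p = G j p}" by simp
    next
      fix x y assume "x \<in> {p. \<forall>i j. G i p = G j p}" "y \<in> {p. \<forall>i j. G i p = G j p}"
      then show "x + y \<in> {p. \<forall>i j. G i p = G j p}" unfolding mem_Collect_eq G_add by metis
    next
      fix b x assume "x \<in> {p. \<forall>i j. G i p = G j p}"
      then show "mscale b x \<in> {p. \<forall>i j. G i p = G j p}" unfolding mem_Collect_eq G_scale by metis
    qed
    moreover have "sym_act \<sigma> p \<in> {p. \<forall>i j. G i p = G j p}"
      if s: "bij \<sigma>" "p \<in> {p. \<forall>i j. G i p = G j p}" for \<sigma> p
    proof -
      have "G k (sym_act \<sigma> p) = G (Hilbert_Choice.inv \<sigma> k) p" for k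
        using G_act[OF s(1), of "Hilbert_Choice.inv \<sigma> k" p] s(1) by (simp add: bij_is_surj surj_f_inv_f)
      then show ?thesis using s(2) by simp
    qed
    ultimately show "submod {p. \<forall>i j. G i p = G j p}" unfolding submod_def by blast
    fix t assume "t < r"
    then have "G i (f t) = G j (f t)" for i j using Gf[of t i] Gf[of t j] by simp
    then show "f t \<in> {p. \<forall>i j. G i p = G j p}" by blast
  qed
  then have sym: "G i p = G j p" if "p \<in> reduced V" for p i j using that red by blast
  obtain P e where q: "(P, e) \<in> Qs" "c (P, e) \<noteq> 0" using c(1) by auto
  then have P: "P \<in> partitions d" "e \<in># P" unfolding Qs_def by auto
  define m where "m = (orbit_rep P :: 'v \<Rightarrow>\<^sub>0 nat)"
  have m: "exponents m = P" "mdeg m = d" unfolding m_def using exp_rep[OF P(1)] deg_rep[OF P(1)] by auto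
  obtain i where i: "lk m i = e" using P(2) set_exponents[of m] m(1) by auto
  obtain j where j: "lk m j = 0" using ex_zero_exponent[of m] m(2) dn by auto
  define m' where "m' = mcomp m (transp i j)"
  have m': "exponents m' = P" "mdeg m' = d" "lk m' i = 0" "lk m' j = e"
    unfolding m'_def using m i j by (simp_all add: exponents_mcomp mdeg_mcomp lookup_mcomp)
  define p where "p = (monom m' - monom m :: ('v, 'k) mpoly)"
  have "p \<in> V" unfolding p_def homog_iff using m m' by (auto simp: lookup_minus lookup_single when_def split: if_splits)
  moreover have "symmetrizer p = 0" unfolding p_def m'_def by (rule symmetrizer_monom_diff) simp
  ultimately have pr: "p \<in> reduced V" unfolding reduced_def by blast
  have g_mono: "g q k (monom x) = (if q = (P, lk x k) then 1 else 0)" if "exponents x = P" "mdeg x = d" for q k x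
  proof -
    have "g q k (monom x) = (if x \<in> A q k then 1 else 0)"
      unfolding g_def using finA[of q k] by (simp add: lookup_single when_def sum.delta')
    then show ?thesis using that unfolding A_def by (cases q) auto
  qed
  have Gp: "G k p = (\<Sum>q\<in>Qs. c q * ((if q = (P, lk m' k) then 1 else 0) - (if q = (P, lk m k) then 1 else 0)))" for k
    unfolding G_def p_def g_diff using m m' by (simp add: g_mono)
  have P0: "(P, 0) \<notin> Qs" using P(1) unfolding Qs_def partitions_def by auto
  have delta: "(\<Sum>q\<in>Qs. c q * (if q = q' then 1 else 0)) = (if q' \<in> Qs then c q' else 0)" for q'
    using finQ by (simp add: if_distrib cong: if_cong)
  have "G i p = - c (P, e)" "G j p = c (P, e)"
    unfolding Gp right_diff_distrib sum_subtractf delta i j m' using q(1) P0 by simp_all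
  then have "of_nat 2 * c (P, e) = 0" using sym[OF pr, of i j] by simp
  then show False using of_nat_nonzero[of 2] q(2) d2 dn by simp
qed

lemma sym_submodule_iff: "sym_submodule M \<longleftrightarrow> submod M"
  unfolding sym_submodule_def submod_def ..

lemma hull_eq_gen: "sym_submodule hull (f ` {..<r}) = gen r f"
proof
  show "sym_submodule hull (f ` {..<r}) \<subseteq> gen r f"
    by (rule hull_minimal) (auto simp: sym_submodule_iff submod_gen intro: gen_base)
  have "sym_submodule (sym_submodule hull (f ` {..<r}))"
    by (rule hull_in) (auto simp: sym_submodule_def mp.subspace_Inter)
  moreover have "f ` {..<r} \<subseteq> sym_submodule hull (f ` {..<r})" by (rule hull_subset)
  ultimately show "gen r f \<subseteq> sym_submodule hull (f ` {..<r})"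
    unfolding sym_submodule_iff by (intro gen_least) auto
qed

section \<open>The component of lowest degree of the ideal\<close>

definition component :: "('v, 'k) mpoly \<Rightarrow> ('v, 'k) mpoly" where
  "component p = Abs_poly_mapping (\<lambda>m. if mdeg m = d then lk p m else 0)"

lemma lookup_component: "lk (component p) m = (if mdeg m = d then lk p m else 0)"
proof -
  have "finite {m. (if mdeg m = d then lk p m else 0) \<noteq> 0}"
    by (rule finite_subset[OF _ finite_lookup[of p]]) auto
  then show ?thesis unfolding component_def by simp
qed

lemma component_add: "component (p + q) = component p + component q"
  by (rule poly_mapping_eqI) (simp add: lookup_component lookup_add)

lemma component_sum: "component (\<Sum>a\<in>S. F a) = (\<Sum>a\<in>S. component (F a))"
proof -
  have "component 0 = 0" by (rule poly_mapping_eqI) (simp add: lookup_component)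
  then show ?thesis by (induction S rule: infinite_finite_induct) (simp_all add: component_add)
qed

lemma component_mult:
  assumes x: "x \<in> V"
  shows "component (q * x) = mscale (lk q 0) x"
proof -
  let ?S = "insert 0 (Poly_Mapping.keys q)"
  have "q = (\<Sum>m\<in>?S. Poly_Mapping.single m (lk q m))"
    by (rule poly_mapping_sum_single) auto
  then have "q * x = (\<Sum>m\<in>?S. Poly_Mapping.single m (lk q m)) * x"
    by (rule arg_cong)
  then have "component (q * x) = (\<Sum>m\<in>?S. component (Poly_Mapping.single m (lk q m) * x))"
    by (simp only: sum_distrib_right component_sum)
  also have "\<dots> = (\<Sum>m\<in>?S. if m = 0 then mscale (lk q 0) x else 0)"
  proof (rule sum.cong[OF refl])
    fix m assume "m \<in> ?S"
    show "component (Poly_Mapping.single m (lk q m) * x) = (if m = 0 then mscale (lk q 0) x else 0)"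
    proof (cases "m = 0")
      case True
      have "mscale (lk q 0) x \<in> V" by (rule mp.subspace_scale[OF subspace_homog x])
      then have "component (mscale (lk q 0) x) = mscale (lk q 0) x"
        by (intro poly_mapping_eqI) (auto simp: lookup_component homog_iff)
      then show ?thesis using True by (simp add: mscale_def mconst_def)
    next
      case False
      then obtain v where "lk m v \<noteq> 0" by (metis lookup_zero poly_mapping_eqI)
      then have "mdeg m \<noteq> 0" unfolding mdeg_UNIV by auto
      moreover have "Poly_Mapping.single m (lk q m) * x \<in> homog (mdeg m + d)"
        by (intro homog_mult x) (auto simp: homog_iff lookup_single when_def)
      ultimately have "component (Poly_Mapping.single m (lk q m) * x) = 0"
        by (intro poly_mapping_eqI) (auto simp: lookup_component homog_iff)
      then show ?thesis using False by simp
    qed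
  qed
  also have "\<dots> = mscale (lk q 0) x" by simp
  finally show ?thesis .
qed

text \<open>The ideal is generated in degree \<open>d\<close>, where only constant multiples of the generators occur.\<close>

lemma sym_ideal_component:
  assumes f: "\<And>i. i < r \<Longrightarrow> f i \<in> V" and L: "L = span (f ` {..<r})"
  shows "sym_ideal L \<inter> V = gen r f"
proof -
  interpret rm: Modules.module "(*) :: ('v, 'k) mpoly \<Rightarrow> _ \<Rightarrow> _"
    by unfold_locales (simp_all add: algebra_simps)
  let ?A = "{sym_act \<sigma> f |\<sigma> f. bij \<sigma> \<and> f \<in> L}"
  have I: "sym_ideal L = rm.span ?A" unfolding sym_ideal_def ideal_gen_def ..
  have LV: "gen r f \<subseteq> V" using f by (intro gen_least submod_V)
  have "L \<subseteq> gen r f"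
    unfolding L by (intro span_minimal submodD(1)[OF submod_gen]) (auto intro: gen_base)
  then have A: "?A \<subseteq> gen r f" using submodD(2)[OF submod_gen] by auto
  have comp: "component p \<in> gen r f" if "p \<in> rm.span ?A" for p
    using that
  proof (induction rule: rm.span_induct_alt)
    case base
    have "component 0 = 0" by (rule poly_mapping_eqI) (simp add: lookup_component)
    then show ?case using subspace_0[OF submodD(1)[OF submod_gen]] by simp
  next
    case (step c x y)
    then have x: "x \<in> gen r f" using A by blast
    then have "component (c * x + y) = mscale (lk c 0) x + component y"
      using LV component_mult component_add by auto
    then show ?case using x step subspace_add[OF submodD(1)[OF submod_gen]] subspace_scale[OF submodD(1)[OF submod_gen]]
      by simp
  qed
  have id: "component p = p" if "p \<in> V" for p
    using that by (intro poly_mapping_eqI) (auto simp: lookup_component homog_iff)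
  have "p \<in> gen r f" if "p \<in> sym_ideal L \<inter> V" for p
    using that comp[of p] id[of p] unfolding I by simp
  then have "sym_ideal L \<inter> V \<subseteq> gen r f" by blast
  moreover have "gen r f \<subseteq> rm.span ?A"
    unfolding gen_def
  proof (rule span_minimal)
    have fL: "f i \<in> L" if "i < r" for i unfolding L using that by (intro span_base) auto
    have "{sym_act \<sigma> (f i) |\<sigma> i. bij \<sigma> \<and> i < r} \<subseteq> ?A"
    proof
      fix x assume "x \<in> {sym_act \<sigma> (f i) |\<sigma> i. bij \<sigma> \<and> i < r}"
      then obtain \<sigma> i where "x = sym_act \<sigma> (f i)" "bij \<sigma>" "i < r" by blast
      then show "x \<in> ?A" using fL[of i] by blast
    qed
    then show "{sym_act \<sigma> (f i) |\<sigma> i. bij \<sigma> \<and> i < r} \<subseteq> rm.span ?A"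
      using rm.span_superset by (rule subset_trans)
    show "subspace (rm.span ?A)"
    proof (rule subspaceI)
      show "mscale c x \<in> rm.span ?A" if "x \<in> rm.span ?A" for c x
        unfolding mscale_def using that by (rule rm.span_scale)
    qed (auto intro: rm.span_zero rm.span_add)
  qed
  ultimately show ?thesis using LV unfolding I by blast
qed

end

section \<open>Minors and Pluecker coordinates\<close>

lemma independent_family:
  fixes v :: "nat \<Rightarrow> ('v, 'k::field) mpoly"
  shows "inj_on v {..<N} \<and> mp.independent (v ` {..<N}) \<longleftrightarrow>
    (\<forall>c. (\<Sum>i<N. mscale (c i) (v i)) = 0 \<longrightarrow> (\<forall>i<N. c i = 0))"
proof
  assume v: "inj_on v {..<N} \<and> mp.independent (v ` {..<N})"
  show "\<forall>c. (\<Sum>i<N. mscale (c i) (v i)) = 0 \<longrightarrow> (\<forall>i<N. c i = 0)"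
  proof (intro allI impI)
    fix c i assume c: "(\<Sum>i<N. mscale (c i) (v i)) = 0" and i: "i < N"
    let ?u = "\<lambda>x. c (the_inv_into {..<N} v x)"
    have inv: "the_inv_into {..<N} v (v i) = i" if "i < N" for i
      using v that by (simp add: the_inv_into_f_f)
    have "(\<Sum>x\<in>v ` {..<N}. mscale (?u x) x) = (\<Sum>i<N. mscale (c i) (v i))"
      using v inv by (subst sum.reindex) auto
    then have "?u (v i) = 0"
      using mp.independentD[of "v ` {..<N}" "v ` {..<N}" ?u "v i"] v c i by auto
    then show "c i = 0" using inv[OF i] by simp
  qed
next
  assume c: "\<forall>c. (\<Sum>i<N. mscale (c i) (v i)) = 0 \<longrightarrow> (\<forall>i<N. c i = 0)"
  have inj: "inj_on v {..<N}"
  proof (rule inj_onI, rule ccontr)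
    fix i j assume ij: "i \<in> {..<N}" "j \<in> {..<N}" "v i = v j" "i \<noteq> j"
    let ?c = "\<lambda>l. if l = i then 1 else if l = j then -1 else (0::'k)"
    have "(\<Sum>l<N. mscale (?c l) (v l)) = (\<Sum>l\<in>{i, j}. mscale (?c l) (v l))"
      using ij by (intro sum.mono_neutral_right) auto
    also have "\<dots> = 0" using ij by simp
    finally show False using c[rule_format, of ?c i] ij by simp
  qed
  moreover have "mp.independent (v ` {..<N})"
  proof (rule mp.independent_if_scalars_zero)
    fix u x assume "(\<Sum>x\<in>v ` {..<N}. mscale (u x) x) = 0" "x \<in> v ` {..<N}"
    then show "u x = 0" using c[rule_format, of "u \<circ> v"] inj by (auto simp: sum.reindex)
  qed simp
  ultimately show "inj_on v {..<N} \<and> mp.independent (v ` {..<N})" by blast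
qed

definition coeff_minor :: "nat \<Rightarrow> (nat \<Rightarrow> ('v, 'k::field) mpoly) \<Rightarrow> (nat \<Rightarrow> ('v \<Rightarrow>\<^sub>0 nat)) \<Rightarrow> 'k" where
  "coeff_minor N v s = det (mat N N (\<lambda>(i, j). lk (v i) (s j)))"

lemma coeff_minor_independent:
  fixes v :: "nat \<Rightarrow> ('v, 'k::field) mpoly"
  assumes "coeff_minor N v s \<noteq> 0"
  shows "inj_on v {..<N} \<and> mp.independent (v ` {..<N})"
  unfolding independent_family
proof (intro allI impI, rule ccontr)
  fix c i assume c: "(\<Sum>i<N. mscale (c i) (v i)) = 0" and i: "i < N" "c i \<noteq> 0"
  let ?A = "mat N N (\<lambda>(i, j). lk (v i) (s j))"
  let ?B = "transpose_mat ?A"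
  have B: "?B \<in> carrier_mat N N" by simp
  have "?B *\<^sub>v vec N c = 0\<^sub>v N"
  proof (rule eq_vecI)
    fix j assume "j < dim_vec (0\<^sub>v N)"
    then have j: "j < N" by simp
    have "(?B *\<^sub>v vec N c) $ j = (\<Sum>i<N. lk (v i) (s j) * c i)"
      using j by (simp add: scalar_prod_def atLeast0LessThan)
    also have "\<dots> = lk (\<Sum>i<N. mscale (c i) (v i)) (s j)"
      unfolding lookup_mscale_sum by (simp add: mult.commute)
    finally show "(?B *\<^sub>v vec N c) $ j = 0\<^sub>v N $ j" using c j by simp
  qed simp
  moreover have "vec N c \<noteq> 0\<^sub>v N" using i by (metis index_vec index_zero_vec(1))
  ultimately have "det ?B = 0"
    using det_0_iff_vec_prod_zero_field[OF B] vec_carrier[of N c] by blast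
  then have "det ?A = 0" using det_transpose[of ?A N] by simp
  then show False using assms unfolding coeff_minor_def by simp
qed

lemma coeff_minor_column:
  fixes v :: "nat \<Rightarrow> ('v, 'k::field) mpoly"
  assumes "j < N"
  shows "coeff_minor N v (s(j := m)) =
    (\<Sum>i<N. cofactor (mat N N (\<lambda>(i, j). lk (v i) (s j))) i j * lk (v i) m)"
proof -
  let ?A = "\<lambda>s. mat N N (\<lambda>(i, j). lk (v i) (s j))"
  have "coeff_minor N v (s(j := m)) = (\<Sum>i<N. ?A (s(j := m)) $$ (i, j) * cofactor (?A (s(j := m))) i j)"
    unfolding coeff_minor_def by (rule laplace_expansion_column) (use assms in auto)
  also have "\<dots> = (\<Sum>i<N. cofactor (?A s) i j * lk (v i) m)"
  proof (rule sum.cong[OF refl])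
    fix i assume "i \<in> {..<N}"
    have "mat_delete (?A (s(j := m))) i j = mat_delete (?A s) i j"
      by (rule eq_matI) (use assms \<open>i \<in> {..<N}\<close> in \<open>auto simp: mat_delete_def\<close>)
    then show "?A (s(j := m)) $$ (i, j) * cofactor (?A (s(j := m))) i j = cofactor (?A s) i j * lk (v i) m"
      using assms \<open>i \<in> {..<N}\<close> unfolding cofactor_def by simp
  qed
  finally show ?thesis .
qed

lemma lookup_nonzero: "p \<noteq> 0 \<Longrightarrow> \<exists>m. lk p m \<noteq> 0"
  by (auto simp: poly_mapping_eq_iff fun_eq_iff)

text \<open>Extend a nonzero minor of the first \<open>N\<close> rows by one more row and a column \<open>m\<close>. Its expansion along
  that column is the coefficient at \<open>m\<close> of a fixed nontrivial combination of the rows.\<close>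

lemma coeff_minor_exists:
  fixes v :: "nat \<Rightarrow> ('v, 'k::field) mpoly"
  assumes "inj_on v {..<N} \<and> mp.independent (v ` {..<N})"
  shows "\<exists>s. coeff_minor N v s \<noteq> 0"
  using assms
proof (induction N)
  case 0
  have "coeff_minor 0 v s = 1" for s unfolding coeff_minor_def by (rule det_dim_zero) simp
  then show ?case by simp
next
  case (Suc N)
  have "inj_on v {..<N} \<and> mp.independent (v ` {..<N})"
    using Suc.prems mp.independent_mono[of "v ` {..<Suc N}" "v ` {..<N}"]
    by (auto simp: lessThan_Suc)
  then obtain s where s: "coeff_minor N v s \<noteq> 0" using Suc.IH by blast
  let ?A = "mat (Suc N) (Suc N) (\<lambda>(i, j). lk (v i) (s j))"
  let ?C = "\<lambda>i. cofactor ?A i N"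
  have "mat_delete ?A N N = mat N N (\<lambda>(i, j). lk (v i) (s j))"
    by (rule eq_matI) (auto simp: mat_delete_def)
  then have "?C N \<noteq> 0" using s unfolding coeff_minor_def cofactor_def by simp
  then have "(\<Sum>i<Suc N. mscale (?C i) (v i)) \<noteq> 0"
    using spec[OF Suc.prems[unfolded independent_family], of ?C] by blast
  then obtain m where "lk (\<Sum>i<Suc N. mscale (?C i) (v i)) m \<noteq> 0"
    by (blast dest: lookup_nonzero)
  then have "coeff_minor (Suc N) v (s(N := m)) \<noteq> 0"
    unfolding lookup_mscale_sum using coeff_minor_column[of N "Suc N" v s m] by simp
  then show ?case by blast
qed

lemma pluecker_eq: "pluecker r f s = coeff_minor r f s"
  unfolding pluecker_def coeff_minor_def ..

text \<open>A basis of the span of \<open>f\<close> (if the Pluecker coordinate at \<open>s\<close> is nonzero) all of whose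
  coefficients are Pluecker coordinates, by Cramer's rule.\<close>

definition pluecker_basis :: "nat \<Rightarrow> (nat \<Rightarrow> ('v, 'k::field) mpoly) \<Rightarrow> (nat \<Rightarrow> ('v \<Rightarrow>\<^sub>0 nat)) \<Rightarrow> nat \<Rightarrow> ('v, 'k) mpoly" where
  "pluecker_basis r f s i = (\<Sum>a<r. mscale (cofactor (mat r r (\<lambda>(a, j). lk (f a) (s j))) a i) (f a))"

lemma lookup_pluecker_basis: "i < r \<Longrightarrow> lk (pluecker_basis r f s i) m = pluecker r f (s(i := m))"
  unfolding pluecker_basis_def pluecker_eq lookup_mscale_sum by (simp add: coeff_minor_column)

lemma pluecker_basis_in_span: "pluecker_basis r f s i \<in> mp.span (f ` {..<r})"
  unfolding pluecker_basis_def by (intro mp.span_sum mp.span_scale mp.span_base) auto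

lemma pluecker_basis_independent:
  assumes "pluecker r f s \<noteq> 0"
  shows "inj_on (pluecker_basis r f s) {..<r} \<and> mp.independent (pluecker_basis r f s ` {..<r})"
  unfolding independent_family
proof (intro allI impI)
  fix c j assume c: "(\<Sum>i<r. mscale (c i) (pluecker_basis r f s i)) = 0" and j: "j < r"
  have off: "pluecker r f (s(i := s j)) = (if i = j then pluecker r f s else 0)" if "i < r" for i
  proof (cases "i = j")
    case False
    let ?A = "mat r r (\<lambda>(a, l). lk (f a) ((s(i := s j)) l))"
    have "col ?A i = col ?A j" using that j by (intro eq_vecI) auto
    then have "det ?A = 0" using det_identical_columns[of ?A r i j] False that j by auto
    then show ?thesis using False unfolding pluecker_def by simp
  qed simp
  have "0 = lk (\<Sum>i<r. mscale (c i) (pluecker_basis r f s i)) (s j)" using c by simp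
  also have "\<dots> = (\<Sum>i<r. c i * pluecker r f (s(i := s j)))"
    unfolding lookup_mscale_sum by (simp add: lookup_pluecker_basis)
  also have "\<dots> = (\<Sum>i<r. if i = j then c i * pluecker r f s else 0)"
    by (intro sum.cong refl) (simp add: off)
  also have "\<dots> = c j * pluecker r f s" using j by simp
  finally show "c j = 0" using assms by simp
qed

lemma comm_ring_hom_msubst: "comm_ring_hom (msubst id x :: ('a, 'k::comm_ring_1) mpoly \<Rightarrow> 'k)"
proof
  fix p q :: "('a, 'k) mpoly"
  show "msubst id x (p + q) = msubst id x p + msubst id x q" by (rule msubst_add) simp_all
  show "msubst id x (p * q) = msubst id x p * msubst id x q" by (rule msubst_mult) simp_all
  show "msubst id x (1 :: ('a, 'k) mpoly) = 1"
    using msubst_single[of id x 0 1] by (simp add: mono_eval_def)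
  show "msubst id x (0 :: ('a, 'k) mpoly) = 0" by (simp add: msubst_def)
qed

lemma msubst_mvar: "msubst id x (mvar v) = x v"
  unfolding mvar_def by (subst msubst_single) (simp_all add: mono_eval_def)

lemma homog_det_mvar: "det (mat N N (\<lambda>(k, l). mvar (w k l))) \<in> (homog N :: ('a, 'k::comm_ring_1) mpoly set)"
proof -
  let ?A = "mat N N (\<lambda>(k, l). mvar (w k l)) :: ('a, 'k) mpoly mat"
  have minus1: "- 1 \<in> (homog 0 :: ('a, 'k) mpoly set)"
    using homog_1[where 'a = 'a and 'b = 'k] unfolding homog_iff by simp
  have sgn: "signof \<pi> \<in> (homog 0 :: ('a, 'k) mpoly set)" for \<pi> :: "nat \<Rightarrow> nat"
    by (cases \<pi> rule: sign_cases) (simp_all add: homog_1 minus1)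
  have "signof \<pi> * (\<Prod>i = 0..<N. ?A $$ (i, \<pi> i)) \<in> homog N" if "\<pi> permutes {0..<N}" for \<pi>
  proof -
    have "(\<Prod>i = 0..<N. ?A $$ (i, \<pi> i)) \<in> homog (card {0..<N})"
    proof (rule homog_prod)
      fix i assume "i \<in> {0..<N}"
      moreover have "\<pi> i \<in> {0..<N}" using permutes_in_image[OF that] \<open>i \<in> _\<close> by blast
      ultimately show "?A $$ (i, \<pi> i) \<in> homog 1" using homog_mvar by simp
    qed simp
    then show ?thesis using homog_mult[OF sgn[of \<pi>]] by force
  qed
  then show ?thesis
    by (subst det_def'[of _ N]) (auto intro!: homog_sum)
qed

section \<open>General ideals and maximal submodules\<close>

context forms
begin

text \<open>On the chart where the Pluecker coordinate at \<open>s\<close> is nonzero, the Pluecker basis generates the same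
  submodule as \<open>L\<close>. A minor of maximal size of the coefficients of its images under the group is a form
  \<open>F\<close> in the Pluecker coordinates. Wherever it does not vanish, the submodule generated by \<open>L\<close> has at least
  the dimension found at one \<open>L\<close>, and this is the maximal one.\<close>

lemma large_general:
  assumes Q: "(\<Sum>i<d. num_partitions i) \<le> r * (CARD('v) - 1)" and r: "r \<le> num_partitions d"
  shows "general_sym_ideal r d (\<lambda>I :: ('v, 'k) mpoly set. dim (I \<inter> V) + num_partitions d = dim V + r)"
proof -
  let ?P = "num_partitions d"
  obtain f where f: "\<And>i. i < r \<Longrightarrow> f i \<in> V" "V = {x + y |x y. x \<in> gen r f \<and> y \<in> invariants V}"
    using form_generators[OF Q] by blast
  obtain h where h: "\<And>i. i < r \<Longrightarrow> h i \<in> V" "dim (gen r h) + ?P = dim V + r"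
      "inj_on h {..<r} \<and> independent (h ` {..<r})"
    using extend_to_large[OF submod_V fin_dim_V _ f, of "\<lambda>_. 0"] r homog_0 unfolding dim_invariants by auto
  obtain s where s: "pluecker r h s \<noteq> 0" using coeff_minor_exists[OF h(3)] unfolding pluecker_eq by blast
  let ?b = "pluecker_basis r h s"
  note b = pluecker_basis_independent[OF s]
  have hs_dim: "dim (span (h ` {..<r})) = r"
    using h(3) dim_span_eq_card_independent[of "h ` {..<r}"] by (simp add: card_image)
  have b_dim: "dim (span (?b ` {..<r})) = r"
    using b dim_span_eq_card_independent[of "?b ` {..<r}"] by (simp add: card_image)
  have "span (?b ` {..<r}) = span (h ` {..<r})"
  proof (rule subspace_dim_eq_fin_dim)
    show "span (?b ` {..<r}) \<subseteq> span (h ` {..<r})"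
      using pluecker_basis_in_span[of r h s] by (intro span_minimal) auto
    show "dim (span (h ` {..<r})) \<le> dim (span (?b ` {..<r}))" unfolding hs_dim b_dim ..
  qed (auto intro: fin_dim_span)
  then have "h i \<in> gen r ?b" if "i < r" for i
    using that span_base[of "h i" "h ` {..<r}"]
      span_minimal[OF _ submodD(1)[OF submod_gen], of "?b ` {..<r}" r ?b] gen_base[of _ r ?b] by auto
  then have "gen r h \<subseteq> gen r ?b" by (intro gen_least submod_gen)
  have bV: "?b i \<in> V" for i
    using pluecker_basis_in_span[of r h s i] span_minimal[OF _ subspace_homog, of "h ` {..<r}" d] h(1) by auto
  have bfd: "fin_dim (gen r ?b)"
    using gen_least[OF submod_V, of r ?b] bV fin_dim_V by (blast intro: fin_dim_mono)
  define D where "D = dim (gen r h)"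
  have D: "D \<le> dim (gen r ?b)"
    unfolding D_def using \<open>gen r h \<subseteq> gen r ?b\<close> bfd by (rule dim_mono_fin_dim)
  let ?S = "{sym_act \<sigma> (?b i) |\<sigma> i. bij \<sigma> \<and> i < r}"
  obtain B where B: "B \<subseteq> ?S" "independent B" "?S \<subseteq> span B" "card B = dim ?S"
    by (rule basis_exists)
  have "dim ?S = dim (gen r ?b)" unfolding gen_def by simp
  then have "D \<le> card B" using D B(4) by simp
  then obtain B' where B': "B' \<subseteq> B" "card B' = D" "finite B'" by (meson obtain_subset_with_card_n)
  obtain v where v: "bij_betw v {..<D} B'"
    using ex_bij_betw_nat_finite[OF B'(3)] B'(2) by (metis atLeast0LessThan)
  have "\<exists>\<sigma> i. v k = sym_act \<sigma> (?b i) \<and> bij \<sigma> \<and> i < r" if "k < D" for k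
    using v that B'(1) B(1) unfolding bij_betw_def by blast
  then obtain \<sigma> i where \<sigma>i: "\<And>k. k < D \<Longrightarrow> v k = sym_act (\<sigma> k) (?b (i k)) \<and> bij (\<sigma> k) \<and> i k < r"
    by metis
  have "inj_on v {..<D} \<and> independent (v ` {..<D})"
    using v independent_mono[OF B(2) B'(1)] unfolding bij_betw_def by auto
  then obtain t where t: "coeff_minor D v t \<noteq> 0" using coeff_minor_exists by blast
  define W where "W k l = s(i k := mcomp (t l) (\<sigma> k))" for k l
  define F where "F = (det (mat D D (\<lambda>(k, l). mvar (W k l))) :: (nat \<Rightarrow> ('v \<Rightarrow>\<^sub>0 nat), 'k) mpoly)"
  have F_eval: "msubst id (pluecker r g) F
      = coeff_minor D (\<lambda>k. sym_act (\<sigma> k) (pluecker_basis r g s (i k))) t" for g :: "nat \<Rightarrow> ('v, 'k) mpoly"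
  proof -
    interpret hom: comm_ring_hom "msubst id (pluecker r g) :: (nat \<Rightarrow> ('v \<Rightarrow>\<^sub>0 nat), 'k) mpoly \<Rightarrow> 'k"
      by (rule comm_ring_hom_msubst)
    have "msubst id (pluecker r g) F = det (map_mat (msubst id (pluecker r g)) (mat D D (\<lambda>(k, l). mvar (W k l))))"
      unfolding F_def by (rule hom.hom_det[symmetric])
    also have "map_mat (msubst id (pluecker r g)) (mat D D (\<lambda>(k, l). mvar (W k l)))
        = mat D D (\<lambda>(k, l). lk (sym_act (\<sigma> k) (pluecker_basis r g s (i k))) (t l))"
      using \<sigma>i by (intro eq_matI) (auto simp: msubst_mvar W_def lookup_sym_act lookup_pluecker_basis)
    finally show ?thesis unfolding coeff_minor_def .
  qed
  define U where "U = {L \<in> grassmannian r V. \<exists>g. ordered_basis r g L \<and> msubst id (pluecker r g) F \<noteq> 0}"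
  have "zariski_open r V U"
    unfolding zariski_open_def zariski_closed_def
  proof (intro conjI exI[of _ "{F}"])
    show "U \<subseteq> grassmannian r V" unfolding U_def by blast
    show "\<forall>F\<in>{F}. \<exists>e. F \<in> homog e" unfolding F_def using homog_det_mvar by blast
    show "grassmannian r V - U = {L \<in> grassmannian r V.
        \<forall>g. ordered_basis r g L \<longrightarrow> (\<forall>F\<in>{F}. msubst id (pluecker r g) F = 0)}"
      unfolding U_def by blast
  qed
  moreover have "span (h ` {..<r}) \<in> U"
  proof -
    have "span (h ` {..<r}) \<in> grassmannian r V"
      unfolding grassmannian_def using hs_dim h(1) span_minimal[OF _ subspace_homog, of "h ` {..<r}" d] by auto
    moreover have "ordered_basis r h (span (h ` {..<r}))" unfolding ordered_basis_def using h(3) by blast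
    moreover have "coeff_minor D (\<lambda>k. sym_act (\<sigma> k) (?b (i k))) t = coeff_minor D v t"
      unfolding coeff_minor_def using \<sigma>i by (intro arg_cong[of _ _ det] eq_matI) auto
    ultimately show ?thesis unfolding U_def using t F_eval by auto
  qed
  then have "U \<noteq> {}" by blast
  moreover have "dim (sym_ideal L \<inter> V) + ?P = dim V + r" if L: "L \<in> U" for L
  proof -
    obtain g where g: "ordered_basis r g L" "msubst id (pluecker r g) F \<noteq> 0" and LV: "L \<subseteq> V"
      using L unfolding U_def grassmannian_def by blast
    have Lg: "L = span (g ` {..<r})" using g(1) unfolding ordered_basis_def by blast
    have gV: "g i \<in> V" if "i < r" for i using LV that unfolding Lg by (auto intro: span_base)
    let ?c = "pluecker_basis r g s" and ?v = "\<lambda>k. sym_act (\<sigma> k) (pluecker_basis r g s (i k))"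
    have fd: "fin_dim (gen r g)" using gen_least[OF submod_V, of r g] gV fin_dim_V by (blast intro: fin_dim_mono)
    have "g ` {..<r} \<subseteq> gen r g" using gen_base by blast
    then have c: "?c j \<in> gen r g" for j
      using pluecker_basis_in_span[of r g s j] span_minimal[OF _ submodD(1)[OF submod_gen], of "g ` {..<r}" r g] by blast
    have ind: "inj_on ?v {..<D} \<and> independent (?v ` {..<D})"
      using g(2) unfolding F_eval by (rule coeff_minor_independent)
    have "?v ` {..<D} \<subseteq> gen r g" using \<sigma>i c submodD(2)[OF submod_gen] by auto
    then have "card (?v ` {..<D}) \<le> dim (gen r g)" using independent_fin_dim(2)[OF fd] ind by blast
    moreover have "card (?v ` {..<D}) = D" using ind by (simp add: card_image)
    ultimately have "D \<le> dim (gen r g)" by simp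
    then have "dim (gen r g) + ?P = dim V + r"
      using dim_gen_le(1)[OF submod_V fin_dim_V, of r g] gV h(2) unfolding D_def dim_invariants by simp
    then show ?thesis using sym_ideal_component[of r g L] gV Lg by simp
  qed
  ultimately show ?thesis unfolding general_sym_ideal_def by blast
qed

lemma gen_large_imp:
  assumes "\<And>i. i < r \<Longrightarrow> f i \<in> V" "dim (gen r f) + num_partitions d = dim V + r"
  shows "(\<Sum>i<d. num_partitions i) \<le> r * (CARD('v) - 1)"
  using reduced_not_generated[of r f] dim_gen_le(2)[OF submod_V fin_dim_V, of r f] assms
  unfolding dim_invariants by fastforce

lemma general_iff:
  assumes r: "1 \<le> r" "r \<le> num_partitions d"
  shows "general_sym_ideal r d (\<lambda>I :: ('v, 'k) mpoly set. dim (I \<inter> V) + num_partitions d = dim V + r)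
    \<longleftrightarrow> (\<Sum>i<d. num_partitions i) \<le> r * (CARD('v) - 1)"
proof
  assume "general_sym_ideal r d (\<lambda>I :: ('v, 'k) mpoly set. dim (I \<inter> V) + num_partitions d = dim V + r)"
  then obtain L :: "('v, 'k) mpoly set" where L: "L \<in> grassmannian r V"
      "dim (sym_ideal L \<inter> V) + num_partitions d = dim V + r"
    unfolding general_sym_ideal_def zariski_open_def by blast
  obtain B where B: "B \<subseteq> L" "independent B" "L \<subseteq> span B" "card B = dim L" by (rule basis_exists)
  have sub: "subspace L" "L \<subseteq> V" "dim L = r" using L(1) unfolding grassmannian_def by auto
  have finB: "finite B" using B(4) sub(3) r(1) by (metis card.infinite not_one_le_zero)
  obtain f where f: "bij_betw f {..<r} B"
    using ex_bij_betw_nat_finite[OF finB] B(4) sub(3) by (metis atLeast0LessThan)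
  then have img: "f ` {..<r} = B" unfolding bij_betw_def by blast
  have fV: "f i \<in> V" if "i < r" for i using that img B(1) sub(2) by blast
  have "L = span (f ` {..<r})" unfolding img using B(1,3) span_minimal[OF B(1) sub(1)] by blast
  then have "sym_ideal L \<inter> V = gen r f" using sym_ideal_component[of r f L] fV by simp
  then show "(\<Sum>i<d. num_partitions i) \<le> r * (CARD('v) - 1)" using L(2) fV by (intro gen_large_imp[of r f]) auto
next
  assume "(\<Sum>i<d. num_partitions i) \<le> r * (CARD('v) - 1)"
  then show "general_sym_ideal r d (\<lambda>I :: ('v, 'k) mpoly set. dim (I \<inter> V) + num_partitions d = dim V + r)"
    using r(2) by (rule large_general)
qed

lemma maximal_submodule_dim:
  assumes r: "r \<le> num_partitions d" and M: "max_r_gen_submodule r V M"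
  shows "dim M + num_partitions d \<le> dim V + r"
    and "dim M + num_partitions d = dim V + r \<longleftrightarrow> (\<Sum>i<d. num_partitions i) \<le> r * (CARD('v) - 1)"
proof -
  obtain f where f: "M = gen r f"
    using M unfolding max_r_gen_submodule_def r_gen_submodule_def r_generated_def hull_eq_gen by blast
  have MV: "M \<subseteq> V" using M unfolding max_r_gen_submodule_def r_gen_submodule_def by blast
  have fV: "f i \<in> V" if "i < r" for i using gen_base[OF that, of f] MV f by blast
  show "dim M + num_partitions d \<le> dim V + r"
    using dim_gen_le(1)[OF submod_V fin_dim_V, of r f] fV unfolding dim_invariants f by simp
  show "dim M + num_partitions d = dim V + r \<longleftrightarrow> (\<Sum>i<d. num_partitions i) \<le> r * (CARD('v) - 1)"
  proof
    assume "dim M + num_partitions d = dim V + r"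
    then show "(\<Sum>i<d. num_partitions i) \<le> r * (CARD('v) - 1)" unfolding f using fV by (intro gen_large_imp)
  next
    assume "(\<Sum>i<d. num_partitions i) \<le> r * (CARD('v) - 1)"
    then obtain g where g: "\<And>i. i < r \<Longrightarrow> g i \<in> V" "V = {x + y |x y. x \<in> gen r g \<and> y \<in> invariants V}"
      using form_generators by blast
    have "\<exists>h. (\<forall>i<r. h i \<in> V) \<and> gen r f \<subseteq> gen r h \<and> dim (gen r h) + dim (invariants V) = dim V + r \<and>
        inj_on h {..<r} \<and> independent (h ` {..<r})"
      by (rule extend_to_large[OF submod_V fin_dim_V _ g fV]) (simp_all add: dim_invariants r)
    then obtain h where h: "\<And>i. i < r \<Longrightarrow> h i \<in> V" "gen r f \<subseteq> gen r h"
        "dim (gen r h) + num_partitions d = dim V + r"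
      unfolding dim_invariants by blast
    have "r_gen_submodule r V (gen r h)"
      unfolding r_gen_submodule_def r_generated_def hull_eq_gen sym_submodule_iff
      using submod_gen gen_least[OF submod_V, of r h] h(1) by blast
    then have "gen r h = M" using M h(2) f unfolding max_r_gen_submodule_def by blast
    then show "dim M + num_partitions d = dim V + r" using h(3) by simp
  qed
qed

end

theorem mainTheorem3:
  fixes d r :: nat
  assumes "infinite (UNIV :: 'k::field set)"
    and "CHAR('k) = 0 \<or> CHAR('k) > CARD('v::finite)"
    and "d \<ge> 2" and "CARD('v) > d"
    and "1 \<le> r" and "r \<le> num_partitions d"
  shows
    "(\<forall>M :: ('v, 'k) mpoly set. max_r_gen_submodule r (homog d) M \<longrightarrow>
        int (mp.dim M) \<le> int (mp.dim (homog d :: ('v, 'k) mpoly set))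
                          - (int (num_partitions d) - int r) \<and>
        (int (mp.dim M) = int (mp.dim (homog d :: ('v, 'k) mpoly set))
                          - (int (num_partitions d) - int r)
         \<longleftrightarrow> real CARD('v) \<ge> 1 + real (\<Sum>i = 0..d - 1. num_partitions i) / real r)) \<and>
     (general_sym_ideal r d (\<lambda>I :: ('v, 'k) mpoly set.
        int (mp.dim (I \<inter> homog d)) = int (mp.dim (homog d :: ('v, 'k) mpoly set))
                          - (int (num_partitions d) - int r))
      \<longleftrightarrow> real CARD('v) \<ge> 1 + 1 / real r * real (\<Sum>i = 0..d - 1. num_partitions i))"
proof -
  interpret sr: sym_rep "mscale :: 'k \<Rightarrow> ('v, 'k) mpoly \<Rightarrow> ('v, 'k) mpoly" sym_act
    by (rule sym_rep_mpoly[OF assms(2)])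
  interpret fm: forms "TYPE('v)" "TYPE('k)" d
    using assms(3,4) by unfold_locales
  let ?Q = "\<Sum>i<d. num_partitions i" and ?P = "num_partitions d"
  let ?V = "homog d :: ('v, 'k) mpoly set"
  have eq: "int x = int (mp.dim ?V) - (int ?P - int r) \<longleftrightarrow> x + ?P = mp.dim ?V + r"
    and le: "int x \<le> int (mp.dim ?V) - (int ?P - int r) \<longleftrightarrow> x + ?P \<le> mp.dim ?V + r" for x
    by linarith+
  have "{0..d - 1} = {..<d}" using assms(3) by auto
  then have Q: "(\<Sum>i = 0..d - 1. num_partitions i) = ?Q" by simp
  have bound: "real CARD('v) \<ge> 1 + real ?Q / real r \<longleftrightarrow> ?Q \<le> r * (CARD('v) - 1)"
  proof -
    have "real CARD('v) \<ge> 1 + real ?Q / real r \<longleftrightarrow> real ?Q \<le> real r * (real CARD('v) - 1)"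
      using assms(5) by (simp add: field_simps)
    also have "real r * (real CARD('v) - 1) = real (r * (CARD('v) - 1))"
      using assms(4) by (simp add: of_nat_diff)
    also have "real ?Q \<le> real (r * (CARD('v) - 1)) \<longleftrightarrow> ?Q \<le> r * (CARD('v) - 1)"
      by (rule of_nat_le_iff)
    finally show ?thesis .
  qed
  have "1 / real r * real ?Q = real ?Q / real r" by simp
  then show ?thesis
    unfolding Q eq le bound
    using fm.maximal_submodule_dim[OF assms(6)] fm.general_iff[OF assms(5,6)] bound by simp
qed

end
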